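(* Let $(X,d)$ be a metric space of finite diameter without isolated points. Let $\Gamma$ be a countable group which admits a weakly hyperbolic action by homeomorphisms of $X$. Assume that $\Gamma$ contains a free subgroup $G$ with two generators and the following properties. (1) Every $e\neq g\in G$ acts with north-south dynamics on $X$. (2) There are infinitely many $g_i\in G$ $(i>0)$ such that the $\Gamma$-orbits of the ordered pairs of fixed points of the elements $g_i,g_j^{-1}$ $(i,j>0)$ are pairwise disjoint. (3) There is a $G$-equivariant continuous embedding of the Gromov boundary of $G$ into $X$. If the action of $\Gamma$ on the space of triples of pairwise distinct points in $X$ is metrically proper, then for every $p\in(1,\infty)$ the kernel of the natural map $H_b^2(\Gamma,\ell^p(\Gamma))\to H^2(\Gamma,\ell^p(\Gamma))$ is infinite dimensional.
   Context: Weakly hyperbolic. The action of a group $G$ on a metric space $(X,d)$ of finite diameter is weakly hyperbolic if for every $\epsilon>0$ there is a number $b=b(\epsilon)\in(0,1)$ with the following property. Let $x,y\in X$ with $d(x,y)\ge 2\epsilon$ and let $g\in G$ be such that $d(gx,gy)\ge 2\epsilon$. Let $z\in X-\{x,y\}$ be such that $\min\{d(gz,gx),d(gz,gy)\}\ge\epsilon$; then $d(gw,gx)\le d(z,y)^b/b$ for every $w\in X$ with $d(w,x)\le\epsilon$. North-south dynamics. A homeomorphism $g$ of $X$ has north-south dynamics with respect to an attracting fixed point $a\in X$ and a repelling fixed point $b\in X-\{a\}$ if (i) for every $\epsilon>0$ there is $m>0$ with $g^m(X-B(b,\epsilon))\subset B(a,\epsilon)$ and $g^{-m}(X-B(a,\epsilon))\subset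 B(b,\epsilon)$; (ii) there is $\delta>0$ with $\bigcup_{m\in\mathbb{Z}}g^m(X-B(a,\delta)-B(b,\delta))=X-\{a,b\}$. Here $B(x,\epsilon)$ is the open ball. The ordered pair of fixed points of $g$ is $(a,b)$ (so that of $g^{-1}$ is $(b,a)$). $\Gamma$ acts diagonally on pairs and triples. Metrically proper. Let $\Delta\subset X^3$ be the set of triples in which at least two points coincide. The diagonal action of $\Gamma$ on the space $X^3-\Delta$ of triples of pairwise distinct points is metrically proper if for every $\nu\in(0,\frac12)$ there are constants $m(\nu)>0$ and $R(\nu)>-\log(\nu/4)$ such that for any two open disjoint sets $U,V\subset X$ of distance at least $\nu$ and of diameter at most $e^{-R(\nu)}$ the following holds. (1) Let $W\subset X$ be a set of diameter at most $e^{-R(\nu)}$ whose distance to $U\cup V$ is at least $\nu$, and write $C=U\times V\times W$. Then for all $k\in\mathbb{Z}$ and every fixed pair of points $x_0\ne y_0\in X$ with $d(x_0,y_0)\ge\nu$ there are at most $m(\nu)$ elements $g\in\Gamma$ with $g(C)\cap\{(x,y,z)\in X^3-\Delta\mid x=x_0,\ y=y_0,\ e^{-k}\le\min\{d(z,x_0),d(z,y_0)\}\le e^{-k+1}\}\ne\emptyset$. (2) Let $U',V'\subset X$ be open disjoint sets of distance at least $\nu$ and of diameter at most $e^{-R(\nu)}$. Let $Z$ (resp. $Z'$) be the set of all points of $X$ whose distance to $U\cup V$ (resp. $U'\cup V'$) is bigger than $\nu$. Then there are at most $m(\nu)$ elements $g\in\Gamma$ with $g(U\times V\times Z)\cap U'\times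 V'\times Z'\neq\emptyset$. Bounded cohomology. $\ell^p(\Gamma)$ carries the isometric $\Gamma$-action $(gf)(h)=f(hg)$. $H_b^2(\Gamma,\ell^p(\Gamma))$ is the second cohomology group of the complex of bounded $\Gamma$-equivariant functions $0\to L^\infty(\Gamma,\ell^p(\Gamma))^\Gamma\to L^\infty(\Gamma^2,\ell^p(\Gamma))^\Gamma\to L^\infty(\Gamma^3,\ell^p(\Gamma))^\Gamma\to\cdots$ with the homogeneous coboundary; the natural map to ordinary group cohomology $H^2(\Gamma,\ell^p(\Gamma))$ forgets boundedness. *)

theory Defs
  imports
    "HOL-Analysis.Analysis"
    "HOL-Library.Disjoint_Sets"
    "HOL-Algebra.AbelCoset"
    "HOL-Algebra.Generated_Groups"
    "HOL-Algebra.Group_Action"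
    "Jordan_Normal_Form.VS_Connect"
begin

section \<open>Group actions on metric spaces\<close>

definition weakly_hyperbolic ::
  "('g, 'm) monoid_scheme \<Rightarrow> ('g \<Rightarrow> 'x::metric_space \<Rightarrow> 'x) \<Rightarrow> bool" where
  "weakly_hyperbolic \<Gamma> \<phi> \<longleftrightarrow>
     (\<forall>\<epsilon>>0. \<exists>b::real. 0 < b \<and> b < 1 \<and>
        (\<forall>g\<in>carrier \<Gamma>. \<forall>x y z.
           dist x y \<ge> 2 * \<epsilon> \<and> dist (\<phi> g x) (\<phi> g y) \<ge> 2 * \<epsilon> \<and> z \<notin> {x, y} \<and>
           min (dist (\<phi> g z) (\<phi> g x)) (dist (\<phi> g z) (\<phi> g y)) \<ge> \<epsilon> \<longrightarrow>
           (\<forall>w. dist w x \<le> \<epsilon> \<longrightarrow> dist (\<phi> g w) (\<phi> g x) \<le> dist z y powr b / b)))"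

definition int_iterate :: "('x \<Rightarrow> 'x) \<Rightarrow> int \<Rightarrow> 'x \<Rightarrow> 'x" where
  "int_iterate f m = (if m \<ge> 0 then f ^^ nat m else inv_into UNIV f ^^ nat (- m))"

text \<open>
  \<open>a\<close> is the attracting and \<open>b\<close> the repelling fixed point of the homeomorphism \<open>f\<close>.
\<close>
definition north_south :: "('x::metric_space \<Rightarrow> 'x) \<Rightarrow> 'x \<Rightarrow> 'x \<Rightarrow> bool" where
  "north_south f a b \<longleftrightarrow>
     homeomorphism UNIV UNIV f (inv_into UNIV f) \<and> f a = a \<and> f b = b \<and> a \<noteq> b \<and>
     (\<forall>\<epsilon>>0. \<exists>m>0. int_iterate f m ` (UNIV - ball b \<epsilon>) \<subseteq> ball a \<epsilon> \<and>
                   int_iterate f (- m) ` (UNIV - ball a \<epsilon>) \<subseteq> ball b \<epsilon>) \<and>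
     (\<exists>\<delta>>0. (\<Union>m. int_iterate f m ` (UNIV - ball a \<delta> - ball b \<delta>)) = UNIV - {a, b})"

definition fixed_pair :: "('x::metric_space \<Rightarrow> 'x) \<Rightarrow> 'x \<times> 'x" where
  "fixed_pair f = (THE q. north_south f (fst q) (snd q))"

text \<open>
  The description in \<open>fixed_pair\<close> is proper as soon as the space has a third point. (On a
  two-point space the identity has north-south dynamics with respect to both orderings.)
\<close>

lemma north_south_iterate:
  assumes "north_south f a b" "0 < e"
  obtains k :: nat where "0 < k" "(f ^^ k) ` (UNIV - ball b e) \<subseteq> ball a e"
proof -
  have "\<forall>\<epsilon>>0. \<exists>m>0. int_iterate f m ` (UNIV - ball b \<epsilon>) \<subseteq> ball a \<epsilon> \<and>
           int_iterate f (- m) ` (UNIV - ball a \<epsilon>) \<subseteq> ball b \<epsilon>"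
    using assms(1) unfolding north_south_def by (elim conjE)
  from this[rule_format, OF assms(2)]
  obtain m where m: "m > 0" "int_iterate f m ` (UNIV - ball b e) \<subseteq> ball a e"
    by (elim exE conjE)
  then show ?thesis by (intro that[of "nat m"]) (auto simp: int_iterate_def)
qed

lemma north_south_fixed:
  assumes "north_south f a b" "f x = x"
  shows "x = a \<or> x = b"
proof (rule ccontr)
  assume *: "\<not> ?thesis"
  define e where "e = min (dist x a) (dist x b)"
  have e: "0 < e" using * by (auto simp: e_def)
  obtain k :: nat where k: "(f ^^ k) ` (UNIV - ball b e) \<subseteq> ball a e"
    using north_south_iterate[OF assms(1) e] by blast
  have "(f ^^ k) x = x" using assms(2) by (induction k) auto
  moreover have "x \<in> UNIV - ball b e" by (simp add: e_def dist_commute[of b x])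
  then have "(f ^^ k) x \<in> ball a e" using k by blast
  ultimately show False by (simp add: e_def dist_commute[of a x])
qed

lemma north_south_mult_iterate:
  assumes sub: "(f ^^ k) ` (UNIV - ball b e) \<subseteq> ball a e" and e: "2 * e \<le> dist a b"
    and x: "x \<notin> ball b e" and "0 < n"
  shows "(f ^^ (n * k)) x \<in> ball a e"
  using \<open>0 < n\<close>
proof (induction n)
  case (Suc n)
  have disj: "y \<notin> ball b e" if "y \<in> ball a e" for y
    using that e dist_triangle[of a b y] by (auto simp: dist_commute)
  have "(f ^^ (n * k)) x \<notin> ball b e"
    using Suc x disj by (cases "n = 0") auto
  then have "(f ^^ k) ((f ^^ (n * k)) x) \<in> ball a e" using sub by blast
  then show ?case by (simp add: funpow_add)
qed simp

lemma fixed_pair_eq: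
  assumes ns: "north_south f a b" and c: "c \<notin> {a, b}"
  shows "fixed_pair f = (a, b)"
proof -
  have no_swap: False if swap: "north_south f b a"
  proof -
    define e where "e = min (dist a b / 2) (min (dist c a) (dist c b))"
    have "a \<noteq> b" using ns by (simp add: north_south_def)
    then have e: "0 < e" using c by (auto simp: e_def)
    obtain k where k: "0 < k" "(f ^^ k) ` (UNIV - ball b e) \<subseteq> ball a e"
      using north_south_iterate[OF ns e] by blast
    obtain l where l: "0 < l" "(f ^^ l) ` (UNIV - ball a e) \<subseteq> ball b e"
      using north_south_iterate[OF swap e] by blast
    have "(f ^^ (l * k)) c \<in> ball a e"
      by (rule north_south_mult_iterate[OF k(2)]) (use l in \<open>auto simp: e_def dist_commute\<close>)
    moreover have "(f ^^ (k * l)) c \<in> ball b e"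
      by (rule north_south_mult_iterate[OF l(2)]) (use k in \<open>auto simp: e_def dist_commute\<close>)
    ultimately have "dist a b < 2 * e"
      using dist_triangle2[of a b "(f ^^ (k * l)) c"] by (auto simp: mult.commute)
    then show False by (auto simp: e_def)
  qed
  have "q = (a, b)" if q: "north_south f (fst q) (snd q)" for q
  proof -
    have "fst q \<in> {a, b}" "snd q \<in> {a, b}" "fst q \<noteq> snd q"
      using q north_south_fixed[OF ns] by (auto simp: north_south_def)
    moreover have "q \<noteq> (b, a)" using q no_swap by auto
    ultimately show ?thesis by (cases q) auto
  qed
  then show ?thesis unfolding fixed_pair_def using ns by (intro the_equality) auto
qed

text \<open>
  \<open>metrically_proper\<close> is meant for bounded spaces, where \<open>diameter\<close> is the usual
  diameter. The library's \<open>setdist\<close> is 0 if one of the two sets is empty, so empty sets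
  are excluded below; for them the counting conditions would be void anyway.
\<close>

definition separated_small :: "real \<Rightarrow> real \<Rightarrow> 'x::metric_space set \<Rightarrow> 'x set \<Rightarrow> bool" where
  "separated_small \<nu> R U V \<longleftrightarrow>
     open U \<and> open V \<and> U \<inter> V = {} \<and> setdist U V \<ge> \<nu> \<and>
     diameter U \<le> exp (- R) \<and> diameter V \<le> exp (- R)"

definition triple_map :: "('x \<Rightarrow> 'x) \<Rightarrow> 'x \<times> 'x \<times> 'x \<Rightarrow> 'x \<times> 'x \<times> 'x" where
  "triple_map f = (\<lambda>(x, y, z). (f x, f y, f z))"

definition distinct_triples :: "('x \<times> 'x \<times> 'x) set" where
  "distinct_triples = {(x, y, z). x \<noteq> y \<and> y \<noteq> z \<and> x \<noteq> z}"

definition at_most :: "real \<Rightarrow> 'a set \<Rightarrow> bool" where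
  "at_most m A \<longleftrightarrow> finite A \<and> real (card A) \<le> m"

definition metrically_proper ::
  "('g, 'm) monoid_scheme \<Rightarrow> ('g \<Rightarrow> 'x::metric_space \<Rightarrow> 'x) \<Rightarrow> bool" where
  "metrically_proper \<Gamma> \<phi> \<longleftrightarrow>
     (\<forall>\<nu>. 0 < \<nu> \<and> \<nu> < 1/2 \<longrightarrow> (\<exists>m R::real. m > 0 \<and> R > - ln (\<nu> / 4) \<and>
       (\<forall>U V. separated_small \<nu> R U V \<longrightarrow>
          (\<forall>W. diameter W \<le> exp (- R) \<and> setdist W (U \<union> V) \<ge> \<nu> \<longrightarrow>
             (\<forall>(k::int) x0 y0. x0 \<noteq> y0 \<and> dist x0 y0 \<ge> \<nu> \<longrightarrow>
                at_most m {g \<in> carrier \<Gamma>.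
                  triple_map (\<phi> g) ` (U \<times> V \<times> W) \<inter>
                  {(x, y, z) \<in> distinct_triples. x = x0 \<and> y = y0 \<and>
                     exp (- of_int k) \<le> min (dist z x0) (dist z y0) \<and>
                     min (dist z x0) (dist z y0) \<le> exp (- of_int k + 1)} \<noteq> {}})) \<and>
          (\<forall>U' V'. separated_small \<nu> R U' V' \<longrightarrow>
             (let Z = {z. infdist z (U \<union> V) > \<nu>}; Z' = {z. infdist z (U' \<union> V') > \<nu>}
              in at_most m {g \<in> carrier \<Gamma>.
                   triple_map (\<phi> g) ` (U \<times> V \<times> Z) \<inter> (U' \<times> V' \<times> Z') \<noteq> {}})))))"


section \<open>Free subgroups and their Gromov boundary\<close>

text \<open>The letter \<open>(s, True)\<close> stands for \<open>s\<close> and \<open>(s, False)\<close> for its inverse.\<close>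

definition word_value :: "('g, 'm) monoid_scheme \<Rightarrow> ('g \<times> bool) list \<Rightarrow> 'g" where
  "word_value \<Gamma> w =
     foldr (\<lambda>(s, e) g. (if e then s else inv\<^bsub>\<Gamma>\<^esub> s) \<otimes>\<^bsub>\<Gamma>\<^esub> g) w \<one>\<^bsub>\<Gamma>\<^esub>"

definition reduced_word :: "('g \<times> bool) list \<Rightarrow> bool" where
  "reduced_word w \<longleftrightarrow> successively (\<lambda>(s, e) (t, e'). s = t \<longrightarrow> e = e') w"

definition free_basis :: "('g, 'm) monoid_scheme \<Rightarrow> 'g set \<Rightarrow> 'g set \<Rightarrow> bool" where
  "free_basis \<Gamma> S G \<longleftrightarrow> S \<subseteq> carrier \<Gamma> \<and> generate \<Gamma> S = G \<and>
     (\<forall>w. set w \<subseteq> S \<times> UNIV \<and> reduced_word w \<and> w \<noteq> [] \<longrightarrow> word_value \<Gamma> w \<noteq> \<one>\<^bsub>\<Gamma>\<^esub>)"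

definition word_length :: "('g, 'm) monoid_scheme \<Rightarrow> 'g set \<Rightarrow> 'g \<Rightarrow> nat" where
  "word_length \<Gamma> S g =
     (LEAST n. \<exists>w. length w = n \<and> set w \<subseteq> S \<times> UNIV \<and> word_value \<Gamma> w = g)"

text \<open>
  The Gromov product, based at the identity, for the left-invariant word metric
  \<open>word_length \<Gamma> S (inv x \<otimes> y)\<close>. The Gromov boundary of the group generated by \<open>S\<close> is the
  set of equivalence classes of sequences converging to infinity; the sets
  \<open>boundary_nhd \<Gamma> S r \<xi>\<close> with \<open>r\<close> real are its basic neighbourhoods of \<open>\<xi>\<close>.
\<close>

definition gromov_product :: "('g, 'm) monoid_scheme \<Rightarrow> 'g set \<Rightarrow> 'g \<Rightarrow> 'g \<Rightarrow> real" where
  "gromov_product \<Gamma> S x y =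
     (real (word_length \<Gamma> S x) + real (word_length \<Gamma> S y)
        - real (word_length \<Gamma> S (inv\<^bsub>\<Gamma>\<^esub> x \<otimes>\<^bsub>\<Gamma>\<^esub> y))) / 2"

definition gromov_rel ::
  "('g, 'm) monoid_scheme \<Rightarrow> 'g set \<Rightarrow> (nat \<Rightarrow> 'g) \<Rightarrow> (nat \<Rightarrow> 'g) \<Rightarrow> bool" where
  "gromov_rel \<Gamma> S x y \<longleftrightarrow>
     filterlim (\<lambda>(i, j). gromov_product \<Gamma> S (x i) (y j)) at_top (sequentially \<times>\<^sub>F sequentially)"

definition gromov_sequences :: "('g, 'm) monoid_scheme \<Rightarrow> 'g set \<Rightarrow> (nat \<Rightarrow> 'g) set" where
  "gromov_sequences \<Gamma> S = {x. range x \<subseteq> generate \<Gamma> S \<and> gromov_rel \<Gamma> S x x}"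

definition gromov_boundary :: "('g, 'm) monoid_scheme \<Rightarrow> 'g set \<Rightarrow> (nat \<Rightarrow> 'g) set set" where
  "gromov_boundary \<Gamma> S =
     gromov_sequences \<Gamma> S //
       {(x, y). x \<in> gromov_sequences \<Gamma> S \<and> y \<in> gromov_sequences \<Gamma> S \<and> gromov_rel \<Gamma> S x y}"

definition boundary_nhd ::
  "('g, 'm) monoid_scheme \<Rightarrow> 'g set \<Rightarrow> real \<Rightarrow> (nat \<Rightarrow> 'g) set \<Rightarrow> (nat \<Rightarrow> 'g) set set" where
  "boundary_nhd \<Gamma> S r \<xi> =
     {\<eta> \<in> gromov_boundary \<Gamma> S. \<exists>x\<in>\<xi>. \<exists>y\<in>\<eta>.
        ereal r \<le> Liminf (sequentially \<times>\<^sub>F sequentially)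
                    (\<lambda>(i, j). ereal (gromov_product \<Gamma> S (x i) (y j)))}"

definition boundary_topology ::
  "('g, 'm) monoid_scheme \<Rightarrow> 'g set \<Rightarrow> (nat \<Rightarrow> 'g) set topology" where
  "boundary_topology \<Gamma> S = topology (\<lambda>V. V \<subseteq> gromov_boundary \<Gamma> S \<and>
     (\<forall>\<xi>\<in>V. \<exists>r. boundary_nhd \<Gamma> S r \<xi> \<subseteq> V))"

lemma openin_boundary_topology:
  "openin (boundary_topology \<Gamma> S) V \<longleftrightarrow>
     V \<subseteq> gromov_boundary \<Gamma> S \<and> (\<forall>\<xi>\<in>V. \<exists>r. boundary_nhd \<Gamma> S r \<xi> \<subseteq> V)"
proof -
  have mono: "boundary_nhd \<Gamma> S r' \<xi> \<subseteq> boundary_nhd \<Gamma> S r \<xi>" if "r \<le> r'" for r r' \<xi>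
  proof -
    have "ereal r \<le> L" if "ereal r' \<le> L" for L
      using \<open>r \<le> r'\<close> that by (metis ereal_less_eq(3) order_trans)
    then show ?thesis unfolding boundary_nhd_def by blast
  qed
  have "istopology (\<lambda>V. V \<subseteq> gromov_boundary \<Gamma> S \<and>
          (\<forall>\<xi>\<in>V. \<exists>r. boundary_nhd \<Gamma> S r \<xi> \<subseteq> V))" (is "istopology ?P")
    unfolding istopology_def
  proof (intro conjI allI impI)
    fix A B assume A: "?P A" and B: "?P B"
    show "A \<inter> B \<subseteq> gromov_boundary \<Gamma> S" using A by blast
    show "\<forall>\<xi>\<in>A \<inter> B. \<exists>r. boundary_nhd \<Gamma> S r \<xi> \<subseteq> A \<inter> B"
    proof
      fix \<xi> assume "\<xi> \<in> A \<inter> B"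
      then obtain r s where "boundary_nhd \<Gamma> S r \<xi> \<subseteq> A" "boundary_nhd \<Gamma> S s \<xi> \<subseteq> B"
        using A B by blast
      then have "boundary_nhd \<Gamma> S (max r s) \<xi> \<subseteq> A \<inter> B"
        using mono[of r "max r s" \<xi>] mono[of s "max r s" \<xi>] by auto
      then show "\<exists>r. boundary_nhd \<Gamma> S r \<xi> \<subseteq> A \<inter> B" ..
    qed
  next
    fix K assume K: "\<forall>V\<in>K. ?P V"
    then show "\<Union>K \<subseteq> gromov_boundary \<Gamma> S" by blast
    show "\<forall>\<xi>\<in>\<Union>K. \<exists>r. boundary_nhd \<Gamma> S r \<xi> \<subseteq> \<Union>K"
      using K by (meson Sup_upper UnionE subset_trans)
  qed
  then show ?thesis by (simp add: boundary_topology_def topology_inverse')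
qed

definition boundary_action ::
  "('g, 'm) monoid_scheme \<Rightarrow> 'g \<Rightarrow> (nat \<Rightarrow> 'g) set \<Rightarrow> (nat \<Rightarrow> 'g) set" where
  "boundary_action \<Gamma> g \<xi> = (\<lambda>x n. g \<otimes>\<^bsub>\<Gamma>\<^esub> x n) ` \<xi>"


section \<open>Group cohomology with coefficients in \<open>\<ell>\<^sup>p(\<Gamma>)\<close>\<close>

text \<open>
  Functions on the group, and cochains, are extended by zero to the whole type. An
  \<open>n\<close>-cochain is a function on lists of \<open>n + 1\<close> group elements.
\<close>

definition lp_space :: "('g, 'm) monoid_scheme \<Rightarrow> real \<Rightarrow> ('g \<Rightarrow> real) set" where
  "lp_space \<Gamma> p = {f. (\<forall>h. h \<notin> carrier \<Gamma> \<longrightarrow> f h = 0) \<and>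
                      (\<lambda>h. \<bar>f h\<bar> powr p) summable_on carrier \<Gamma>}"

definition lp_norm :: "('g, 'm) monoid_scheme \<Rightarrow> real \<Rightarrow> ('g \<Rightarrow> real) \<Rightarrow> real" where
  "lp_norm \<Gamma> p f = (\<Sum>\<^sub>\<infinity>h\<in>carrier \<Gamma>. \<bar>f h\<bar> powr p) powr (1 / p)"

definition lp_action :: "('g, 'm) monoid_scheme \<Rightarrow> 'g \<Rightarrow> ('g \<Rightarrow> real) \<Rightarrow> 'g \<Rightarrow> real" where
  "lp_action \<Gamma> g f = (\<lambda>h. if h \<in> carrier \<Gamma> then f (h \<otimes>\<^bsub>\<Gamma>\<^esub> g) else 0)"

definition tuples :: "('g, 'm) monoid_scheme \<Rightarrow> nat \<Rightarrow> 'g list set" where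
  "tuples \<Gamma> n = {xs. length xs = n \<and> set xs \<subseteq> carrier \<Gamma>}"

type_synonym 'g cochain = "'g list \<Rightarrow> 'g \<Rightarrow> real"

definition cochains :: "('g, 'm) monoid_scheme \<Rightarrow> real \<Rightarrow> nat \<Rightarrow> 'g cochain set" where
  "cochains \<Gamma> p n = {c.
     (\<forall>xs. xs \<notin> tuples \<Gamma> (n + 1) \<longrightarrow> c xs = (\<lambda>_. 0)) \<and>
     (\<forall>xs\<in>tuples \<Gamma> (n + 1). c xs \<in> lp_space \<Gamma> p \<and>
        (\<forall>g\<in>carrier \<Gamma>. c (map (\<lambda>x. g \<otimes>\<^bsub>\<Gamma>\<^esub> x) xs) = lp_action \<Gamma> g (c xs)))}"

definition bounded_cochains ::
  "('g, 'm) monoid_scheme \<Rightarrow> real \<Rightarrow> nat \<Rightarrow> 'g cochain set" where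
  "bounded_cochains \<Gamma> p n =
     {c \<in> cochains \<Gamma> p n. \<exists>B. \<forall>xs\<in>tuples \<Gamma> (n + 1). lp_norm \<Gamma> p (c xs) \<le> B}"

definition coboundary :: "('g, 'm) monoid_scheme \<Rightarrow> nat \<Rightarrow> 'g cochain \<Rightarrow> 'g cochain" where
  "coboundary \<Gamma> n c = (\<lambda>xs h. if xs \<in> tuples \<Gamma> (n + 2)
     then \<Sum>i\<le>n + 1. (- 1) ^ i * c (take i xs @ drop (Suc i) xs) h else 0)"

definition cochain_module :: "'g cochain set \<Rightarrow> (real, 'g cochain) module" where
  "cochain_module A = \<lparr>carrier = A, mult = undefined, one = undefined,
     zero = (\<lambda>_ _. 0), add = (\<lambda>c d xs h. c xs h + d xs h), smult = (\<lambda>r c xs h. r * c xs h)\<rparr>"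

definition quotient_module ::
  "('r, 'v, 'm) module_scheme \<Rightarrow> 'v set \<Rightarrow> ('r, 'v set) module" where
  "quotient_module M W = \<lparr>carrier = a_rcosets\<^bsub>M\<^esub> W, mult = undefined, one = undefined,
     zero = W, add = (\<lambda>X Y. X <+>\<^bsub>M\<^esub> Y), smult = (\<lambda>r X. \<Union>x\<in>X. W +>\<^bsub>M\<^esub> (r \<odot>\<^bsub>M\<^esub> x))\<rparr>"

text \<open>
  Cohomology in degree \<open>n\<close> of the complex whose spaces of cochains are \<open>C 0, C 1, \<dots>\<close>.
\<close>

definition cocycles ::
  "('g, 'm) monoid_scheme \<Rightarrow> (nat \<Rightarrow> 'g cochain set) \<Rightarrow> nat \<Rightarrow> 'g cochain set" where
  "cocycles \<Gamma> C n = {c \<in> C n. coboundary \<Gamma> n c = (\<lambda>_ _. 0)}"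

definition coboundaries ::
  "('g, 'm) monoid_scheme \<Rightarrow> (nat \<Rightarrow> 'g cochain set) \<Rightarrow> nat \<Rightarrow> 'g cochain set" where
  "coboundaries \<Gamma> C n =
     (case n of 0 \<Rightarrow> {\<lambda>_ _. 0} | Suc k \<Rightarrow> coboundary \<Gamma> k ` C k)"

definition cohomology ::
  "('g, 'm) monoid_scheme \<Rightarrow> (nat \<Rightarrow> 'g cochain set) \<Rightarrow> nat \<Rightarrow> (real, 'g cochain set) module" where
  "cohomology \<Gamma> C n = quotient_module (cochain_module (cocycles \<Gamma> C n)) (coboundaries \<Gamma> C n)"

text \<open>
  All members of a bounded class \<open>X\<close> have the same class in ordinary cohomology, so the
  union below is just that class.
\<close>

definition comparison_map ::
  "('g, 'm) monoid_scheme \<Rightarrow> real \<Rightarrow> nat \<Rightarrow> 'g cochain set \<Rightarrow> 'g cochain set" where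
  "comparison_map \<Gamma> p n X =
     (\<Union>c\<in>X. a_r_coset (cochain_module (cocycles \<Gamma> (cochains \<Gamma> p) n))
              (coboundaries \<Gamma> (cochains \<Gamma> p) n) c)"

definition comparison_kernel ::
  "('g, 'm) monoid_scheme \<Rightarrow> real \<Rightarrow> nat \<Rightarrow> (real, 'g cochain set) module" where
  "comparison_kernel \<Gamma> p n =
     (cohomology \<Gamma> (bounded_cochains \<Gamma> p) n)\<lparr>carrier :=
        a_kernel (cohomology \<Gamma> (bounded_cochains \<Gamma> p) n) (cohomology \<Gamma> (cochains \<Gamma> p) n)
          (comparison_map \<Gamma> p n)\<rparr>"

end

theory Submission
  imports Defs "HOL-Complex_Analysis.Great_Picard"
begin

text \<open>
  Choose \<open>s\<close> and \<open>g\<close> among the given elements, with (attracting, repelling) fixed points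
  \<open>(c, d)\<close> and \<open>(a, b)\<close>. Let \<open>\<chi>(x, y)\<close> be an antisymmetric Lipschitz function on \<open>X \<times> X\<close>
  supported on small neighbourhoods of \<open>(a, b)\<close> and \<open>(b, a)\<close>, and consider the cochain
  \<open>F(x, y)(h) = \<chi>(h x c, h y c)\<close>. Metric properness and weak hyperbolicity bound the
  \<open>\<ell>\<^sup>p\<close>-norm of \<open>h \<mapsto> \<chi>(h x, h y) + \<chi>(h y, h z) + \<chi>(h z, h x)\<close> uniformly over all points,
  so the coboundary of \<open>F\<close> is bounded. The orbit of \<open>(c, d)\<close> stays away from \<open>(a, b)\<close> and
  \<open>(b, a)\<close>, so \<open>\<chi>(h c, h d) = 0\<close> for all \<open>h\<close>; this is what makes \<open>F\<close> take values in
  \<open>\<ell>\<^sup>p\<close>, although its base point \<open>c\<close> lies in \<open>X\<close>.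

  Suppose that a linear combination \<open>F\<close> of such cochains, all for the same \<open>s\<close>, is the sum
  of a bounded cochain and a cocycle \<open>N\<close>. As \<open>F(h, h s) = 0\<close>, the cocycle is bounded on
  the powers of \<open>s\<close>, so after subtracting the coboundary of an element of \<open>\<ell>\<^sup>p\<close> it vanishes
  there. Now \<open>F - N\<close> is bounded, but inserting a high power of \<open>s\<close> into a product puts
  independent contributions of the two factors at distant places of \<open>\<Gamma>\<close>. Comparing with the
  supremum of the norms gives \<open>N(h, h f) = \<chi>(h d, h f c)\<close> exactly, and the cocycle
  identity along powers of \<open>g\<close> yields \<open>\<chi>(b, c) + \<chi>(d, a) = \<chi>(b, a)\<close> in the limit. The left side
  is zero, the right side is not.
\<close>

section \<open>Counting group elements by scale\<close>

text \<open>The hypothesis on orbits concerns ordered pairs, but the final limit needs single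
  points: \<open>\<chi>(b, c)\<close> and \<open>\<chi>(d, a)\<close> can be made to vanish only if
  \<open>c\<close> and \<open>d\<close> differ from both \<open>a\<close> and \<open>b\<close>.
  Metric properness bridges this gap: if two of the chosen elements or their inverses had a common
  repelling point, finiteness would yield an element of \<open>\<Gamma>\<close> carrying one fixed
  pair to the other.

  Independence is triangular. Each cut-off vanishes at the fixed points of \<open>s\<close> and of
  all earlier elements, so rigidity for the \<open>g\<close> of least index in a linear combination
  isolates one coefficient.

  The comparison with the supremum rests on \<open>p\<close> being finite: an element of
  \<open>l^p\<close> tends to zero along injective sequences, so distant contributions decouple, and
  \<open>p\<close>-th powers over disjoint finite sets add without loss. The element of
  \<open>l^p\<close> that normalises the cocycle is a pointwise limit of its values from
  \<open>h\<close> to \<open>h s^n\<close>; countability of \<open>\<Gamma>\<close> supplies the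
  convergent subsequence.\<close>

lemma sum_fibre_geometric:
  fixes \<kappa> :: "'i \<Rightarrow> nat" and q m :: real
  assumes "finite H" "\<And>n. real (card {h \<in> H. \<kappa> h = n}) \<le> m" "0 \<le> q" "q < 1"
  shows "(\<Sum>h\<in>H. q ^ \<kappa> h) \<le> m / (1 - q)"
proof -
  have m: "0 \<le> m" using assms(2) of_nat_0_le_iff order_trans by blast
  have "(\<Sum>h\<in>H. q ^ \<kappa> h) = (\<Sum>n\<in>\<kappa> ` H. \<Sum>h\<in>{h \<in> H. \<kappa> h = n}. q ^ \<kappa> h)"
    by (rule sum.image_gen[OF assms(1)])
  also have "\<dots> = (\<Sum>n\<in>\<kappa> ` H. real (card {h \<in> H. \<kappa> h = n}) * q ^ n)"
    by (intro sum.cong refl) simp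
  also have "\<dots> \<le> (\<Sum>n\<in>\<kappa> ` H. m * q ^ n)"
    using assms by (intro sum_mono mult_right_mono) auto
  also have "\<dots> = m * (\<Sum>n\<in>\<kappa> ` H. q ^ n)" by (simp add: sum_distrib_left)
  also have "\<dots> \<le> m * (\<Sum>n. q ^ n)"
    using assms m by (intro mult_left_mono sum_le_suminf) auto
  also have "\<dots> = m / (1 - q)" using assms by (simp add: suminf_geometric)
  finally show ?thesis .
qed

locale hyperbolic_action = group \<Gamma> for \<Gamma> :: "('g, 'm) monoid_scheme" (structure) +
  fixes \<phi> :: "'g \<Rightarrow> 'x::metric_space \<Rightarrow> 'x"
  assumes act_one: "\<phi> \<one> x = x"
    and act_mult: "g \<in> carrier \<Gamma> \<Longrightarrow> h \<in> carrier \<Gamma> \<Longrightarrow> \<phi> (g \<otimes> h) x = \<phi> g (\<phi> h x)"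
    and act_cont: "g \<in> carrier \<Gamma> \<Longrightarrow> continuous_on UNIV (\<phi> g)"
    and bounded_UNIV: "bounded (UNIV :: 'x set)"
    and hyperbolic: "weakly_hyperbolic \<Gamma> \<phi>"
    and proper: "metrically_proper \<Gamma> \<phi>"
begin

lemma act_inv_left [simp]: "g \<in> carrier \<Gamma> \<Longrightarrow> \<phi> (inv g) (\<phi> g x) = x"
  by (metis act_mult act_one inv_closed l_inv)

lemma act_inv_right [simp]: "g \<in> carrier \<Gamma> \<Longrightarrow> \<phi> g (\<phi> (inv g) x) = x"
  by (metis act_mult act_one inv_closed r_inv)

lemma act_eq_iff [simp]: "g \<in> carrier \<Gamma> \<Longrightarrow> \<phi> g x = \<phi> g y \<longleftrightarrow> x = y"
  by (metis act_inv_left)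

lemma act_tendsto: "g \<in> carrier \<Gamma> \<Longrightarrow> (f \<longlongrightarrow> l) F \<Longrightarrow> ((\<lambda>n. \<phi> g (f n)) \<longlongrightarrow> \<phi> g l) F"
  using act_cont[of g] continuous_on_tendsto_compose[of UNIV "\<phi> g" f l F] by simp

lemma dist_bound: "\<exists>D>0. \<forall>x y::'x. dist x y \<le> D"
proof -
  obtain c :: 'x and e where ce: "\<And>y::'x. dist c y \<le> e"
    using bounded_UNIV unfolding bounded_def by auto
  have "dist x y \<le> 2 * e + 1" for x y :: 'x
    using dist_triangle2[of x y c] ce[of x] ce[of y] by (simp add: dist_commute)
  moreover have "2 * e + 1 > 0" using ce[of c] by simp
  ultimately show ?thesis by blast
qed

section \<open>Metric properness for balls\<close>

text \<open>The first clause of metric properness for \<open>W = {w}\<close>, with balls as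
  \<open>U\<close> and \<open>V\<close>. The condition \<open>x0 \<noteq> y0\<close> is left to
  \<open>\<nu> \<le> dist x0 y0\<close>, since \<open>\<nu>\<close> is positive in
  \<open>proper_balls\<close>.\<close>

definition scale_bounded :: "real \<Rightarrow> real \<Rightarrow> real \<Rightarrow> 'x \<Rightarrow> 'x \<Rightarrow> 'x \<Rightarrow> bool" where
  "scale_bounded \<nu> m \<rho> a b w \<longleftrightarrow> (\<forall>(k::int) x0 y0. \<nu> \<le> dist x0 y0 \<longrightarrow>
     at_most m {g \<in> carrier \<Gamma>. (\<exists>u\<in>ball a \<rho>. \<exists>v\<in>ball b \<rho>. \<phi> g u = x0 \<and> \<phi> g v = y0) \<and>
         exp (- of_int k) \<le> min (dist (\<phi> g w) x0) (dist (\<phi> g w) y0) \<and>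
         min (dist (\<phi> g w) x0) (dist (\<phi> g w) y0) \<le> exp (- of_int k + 1)})"

text \<open>The second clause of metric properness for balls. Distance \<open>2 * \<nu>\<close> from
  the centres replaces distance more than \<open>\<nu>\<close> from the balls, so that later only
  centres have to be estimated.\<close>

definition far_triples :: "real \<Rightarrow> real \<Rightarrow> 'x \<Rightarrow> 'x \<Rightarrow> 'x \<Rightarrow> 'x \<Rightarrow> 'g set" where
  "far_triples \<nu> \<rho> a b a' b' = {g \<in> carrier \<Gamma>. \<exists>u\<in>ball a \<rho>. \<exists>v\<in>ball b \<rho>. \<exists>z.
     2 * \<nu> \<le> dist z a \<and> 2 * \<nu> \<le> dist z b \<and> \<phi> g u \<in> ball a' \<rho> \<and> \<phi> g v \<in> ball b' \<rho> \<and>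
     2 * \<nu> \<le> dist (\<phi> g z) a' \<and> 2 * \<nu> \<le> dist (\<phi> g z) b'}"

lemma far_triplesI:
  assumes "g \<in> carrier \<Gamma>" "u \<in> ball a \<rho>" "v \<in> ball b \<rho>" "2 * \<nu> \<le> dist z a" "2 * \<nu> \<le> dist z b"
    "\<phi> g u \<in> ball a' \<rho>" "\<phi> g v \<in> ball b' \<rho>" "2 * \<nu> \<le> dist (\<phi> g z) a'" "2 * \<nu> \<le> dist (\<phi> g z) b'"
  shows "g \<in> far_triples \<nu> \<rho> a b a' b'"
  using assms unfolding far_triples_def by blast

text \<open>The numbers \<open>m\<close> and \<open>\<rho>\<close> depend on \<open>\<nu>\<close>
  alone and serve all centres at once; in particular the pairs \<open>(a, b)\<close> and
  \<open>(b, a)\<close> can share one radius.\<close>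

lemma proper_balls:
  assumes "0 < \<nu>" "\<nu> < 1/2"
  shows "\<exists>m \<rho>. 0 < \<rho> \<and> 8 * \<rho> < \<nu> \<and> 0 < m \<and>
    (\<forall>a b w. 2 * \<nu> \<le> dist a b \<longrightarrow> 2 * \<nu> \<le> dist w a \<longrightarrow> 2 * \<nu> \<le> dist w b \<longrightarrow> scale_bounded \<nu> m \<rho> a b w) \<and>
    (\<forall>a b a' b'. 2 * \<nu> \<le> dist a b \<longrightarrow> 2 * \<nu> \<le> dist a' b' \<longrightarrow> at_most m (far_triples \<nu> \<rho> a b a' b'))"
proof -
  from proper[unfolded metrically_proper_def, rule_format, OF conjI, OF assms]
  obtain m R where m: "m > 0" and R: "R > - ln (\<nu> / 4)" and
    P: "\<And>U V. separated_small \<nu> R U V \<Longrightarrow>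
          (\<forall>W. diameter W \<le> exp (- R) \<and> setdist W (U \<union> V) \<ge> \<nu> \<longrightarrow>
             (\<forall>(k::int) x0 y0. x0 \<noteq> y0 \<and> dist x0 y0 \<ge> \<nu> \<longrightarrow>
                at_most m {g \<in> carrier \<Gamma>.
                  triple_map (\<phi> g) ` (U \<times> V \<times> W) \<inter>
                  {(x, y, z) \<in> distinct_triples. x = x0 \<and> y = y0 \<and>
                     exp (- of_int k) \<le> min (dist z x0) (dist z y0) \<and>
                     min (dist z x0) (dist z y0) \<le> exp (- of_int k + 1)} \<noteq> {}})) \<and>
          (\<forall>U' V'. separated_small \<nu> R U' V' \<longrightarrow>
             (let Z = {z. infdist z (U \<union> V) > \<nu>}; Z' = {z. infdist z (U' \<union> V') > \<nu>}
              in at_most m {g \<in> carrier \<Gamma>.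
                   triple_map (\<phi> g) ` (U \<times> V \<times> Z) \<inter> (U' \<times> V' \<times> Z') \<noteq> {}}))"
    by blast
  \<comment> \<open>Half of \<open>exp (- R)\<close>, so that balls of radius \<open>\<rho>\<close>
    have diameter at most \<open>exp (- R)\<close>. The bound \<open>R > - ln (\<nu> / 4)\<close>
    becomes \<open>8 * \<rho> < \<nu>\<close>.\<close>
  define \<rho> where "\<rho> = exp (- R) / 2"
  have \<rho>: "0 < \<rho>" by (simp add: \<rho>_def)
  have "exp (- R) < exp (ln (\<nu> / 4))" using R by simp
  then have \<rho>\<nu>: "8 * \<rho> < \<nu>" using assms by (simp add: \<rho>_def)
  have diam: "diameter (ball (a::'x) \<rho>) \<le> exp (- R)" for a
  proof -
    have "dist x y \<le> exp (- R)" if "x \<in> ball a \<rho>" "y \<in> ball a \<rho>" for x y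
      using that dist_triangle2[of x y a] by (auto simp: \<rho>_def dist_commute)
    then show ?thesis
      unfolding diameter_def using \<rho> by (auto intro!: cSUP_least)
  qed
  have sd: "\<nu> \<le> setdist A B" if "A \<noteq> {}" "B \<noteq> {}" "\<And>x y. x \<in> A \<Longrightarrow> y \<in> B \<Longrightarrow> \<nu> \<le> dist x y"
    for A B :: "'x set"
    using that by (intro le_setdistI)
  have far: "\<nu> < dist z u" if "2 * \<nu> \<le> dist z a" "u \<in> ball a \<rho>" for z u a :: 'x
    using that dist_triangle[of z a u] \<rho>\<nu> \<rho> by (auto simp: dist_commute)
  have far': "\<nu> \<le> dist u v" if "2 * \<nu> \<le> dist a b" "u \<in> ball a \<rho>" "v \<in> ball b \<rho>" for u v a b :: 'x
    using that dist_triangle[of a b u] dist_triangle[of u b v] \<rho>\<nu> \<rho> by (auto simp: dist_commute)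
  have ss: "separated_small \<nu> R (ball a \<rho>) (ball b \<rho>)" if "2 * \<nu> \<le> dist a b" for a b :: 'x
  proof -
    have "ball a \<rho> \<inter> ball b \<rho> = {}"
      using far'[OF that] assms(1) by fastforce
    then show ?thesis
      unfolding separated_small_def using diam sd far'[OF that] \<rho> by (auto intro!: sd)
  qed
  have inf: "\<nu> < infdist z (ball a \<rho> \<union> ball b \<rho>)" if "2 * \<nu> \<le> dist z a" "2 * \<nu> \<le> dist z b" for z a b :: 'x
  proof -
    have ne: "ball a \<rho> \<union> ball b \<rho> \<noteq> {}" using \<rho> by auto
    have "2 * \<nu> - \<rho> \<le> infdist z (ball a \<rho> \<union> ball b \<rho>)"
      unfolding infdist_notempty[OF ne]
    proof (rule cINF_greatest[OF ne])
      fix u assume "u \<in> ball a \<rho> \<union> ball b \<rho>"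
      then show "2 * \<nu> - \<rho> \<le> dist z u"
        using that dist_triangle[of z a u] dist_triangle[of z b u] by (auto simp: dist_commute)
    qed
    then show ?thesis using \<rho>\<nu> assms \<rho> by linarith
  qed
  have mono: "at_most m A" if "at_most m B" "A \<subseteq> B" for A B :: "'g set"
    using that unfolding at_most_def
    by (meson card_mono finite_subset of_nat_le_iff order_trans)
  have meet: "A \<inter> B \<noteq> {}" if "p \<in> A" "p \<in> B" for p :: "'x \<times> 'x \<times> 'x" and A B
    using that by auto
  show ?thesis
  proof (intro exI conjI allI impI)
    show "0 < \<rho>" "8 * \<rho> < \<nu>" "0 < m" by fact+
  next
    fix a b w :: 'x
    assume h0: "2 * \<nu> \<le> dist a b" "2 * \<nu> \<le> dist w a" "2 * \<nu> \<le> dist w b"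
    show "scale_bounded \<nu> m \<rho> a b w" unfolding scale_bounded_def
    proof (intro allI impI)
      fix x0 y0 :: 'x and k :: int
      assume "\<nu> \<le> dist x0 y0"
      note h = h0 this
      have 1: "diameter {w} \<le> exp (- R) \<and> setdist {w} (ball a \<rho> \<union> ball b \<rho>) \<ge> \<nu>"
        using less_imp_le[OF far[of w a]] less_imp_le[OF far[of w b]] h \<rho> by (auto intro!: sd)
      have 2: "x0 \<noteq> y0 \<and> dist x0 y0 \<ge> \<nu>" using h(4) assms(1) by auto
      show "at_most m {g \<in> carrier \<Gamma>. (\<exists>u\<in>ball a \<rho>. \<exists>v\<in>ball b \<rho>. \<phi> g u = x0 \<and> \<phi> g v = y0) \<and>
           exp (- of_int k) \<le> min (dist (\<phi> g w) x0) (dist (\<phi> g w) y0) \<and>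
           min (dist (\<phi> g w) x0) (dist (\<phi> g w) y0) \<le> exp (- of_int k + 1)}" (is "at_most m ?S")
      proof (rule mono[OF P[OF ss[OF h(1)], THEN conjunct1, rule_format, OF 1 2, of k]], rule subsetI)
        fix g assume "g \<in> ?S"
        then obtain u v where g: "g \<in> carrier \<Gamma>" and uv: "u \<in> ball a \<rho>" "v \<in> ball b \<rho>" "\<phi> g u = x0" "\<phi> g v = y0"
          and e: "exp (- of_int k) \<le> min (dist (\<phi> g w) x0) (dist (\<phi> g w) y0)"
           "min (dist (\<phi> g w) x0) (dist (\<phi> g w) y0) \<le> exp (- of_int k + 1)" by blast
        have "0 < min (dist (\<phi> g w) x0) (dist (\<phi> g w) y0)"
          using e(1) exp_gt_zero[of "- of_int k :: real"] by linarith
        then have ne: "\<phi> g w \<noteq> x0" "\<phi> g w \<noteq> y0" by auto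
        have mem: "(u, v, w) \<in> ball a \<rho> \<times> ball b \<rho> \<times> {w}" using uv by simp
        have m1: "triple_map (\<phi> g) (u, v, w) \<in> triple_map (\<phi> g) ` (ball a \<rho> \<times> ball b \<rho> \<times> {w})"
          by (rule imageI[OF mem])
        have m2: "triple_map (\<phi> g) (u, v, w) \<in> {(x, y, z) \<in> distinct_triples. x = x0 \<and> y = y0 \<and>
                       exp (- of_int k) \<le> min (dist z x0) (dist z y0) \<and>
                       min (dist z x0) (dist z y0) \<le> exp (- of_int k + 1)}"
        proof -
          have "triple_map (\<phi> g) (u, v, w) = (x0, y0, \<phi> g w)"
            by (simp only: triple_map_def prod.case uv)
          moreover have "(x0, y0, \<phi> g w) \<in> distinct_triples"
            unfolding distinct_triples_def using ne 2 by simp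
          ultimately show ?thesis using e by simp
        qed
        show "g \<in> {g \<in> carrier \<Gamma>.
                    triple_map (\<phi> g) ` (ball a \<rho> \<times> ball b \<rho> \<times> {w}) \<inter>
                    {(x, y, z) \<in> distinct_triples. x = x0 \<and> y = y0 \<and>
                       exp (- of_int k) \<le> min (dist z x0) (dist z y0) \<and>
                       min (dist z x0) (dist z y0) \<le> exp (- of_int k + 1)} \<noteq> {}}"
          by (rule CollectI, rule conjI[OF g meet[OF m1 m2]])
      qed
    qed
  next
    fix a b a' b' :: 'x
    assume h: "2 * \<nu> \<le> dist a b" "2 * \<nu> \<le> dist a' b'"
    show "at_most m (far_triples \<nu> \<rho> a b a' b')" (is "at_most m ?S")
    proof (rule mono[OF P[OF ss[OF h(1)], THEN conjunct2, rule_format, OF ss[OF h(2)], unfolded Let_def]],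
        rule subsetI)
      fix g assume "g \<in> ?S"
      then obtain u v z where g: "g \<in> carrier \<Gamma>" and uv: "u \<in> ball a \<rho>" "v \<in> ball b \<rho>"
        "2 * \<nu> \<le> dist z a" "2 * \<nu> \<le> dist z b" "\<phi> g u \<in> ball a' \<rho>" "\<phi> g v \<in> ball b' \<rho>"
         "2 * \<nu> \<le> dist (\<phi> g z) a'" "2 * \<nu> \<le> dist (\<phi> g z) b'" unfolding far_triples_def by blast
      have mem: "(u, v, z) \<in> ball a \<rho> \<times> ball b \<rho> \<times> {z. \<nu> < infdist z (ball a \<rho> \<union> ball b \<rho>)}"
        using uv inf by simp
      have m1: "triple_map (\<phi> g) (u, v, z) \<in> triple_map (\<phi> g) ` (ball a \<rho> \<times> ball b \<rho> \<times> {z. \<nu> < infdist z (ball a \<rho> \<union> ball b \<rho>)})"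
        by (rule imageI[OF mem])
      have m2: "triple_map (\<phi> g) (u, v, z) \<in> ball a' \<rho> \<times> ball b' \<rho> \<times> {z. \<nu> < infdist z (ball a' \<rho> \<union> ball b' \<rho>)}"
        using uv inf by (simp add: triple_map_def)
      show "g \<in> {g \<in> carrier \<Gamma>.
                   triple_map (\<phi> g) ` (ball a \<rho> \<times> ball b \<rho> \<times> {z. \<nu> < infdist z (ball a \<rho> \<union> ball b \<rho>)}) \<inter>
                   (ball a' \<rho> \<times> ball b' \<rho> \<times> {z. \<nu> < infdist z (ball a' \<rho> \<union> ball b' \<rho>)}) \<noteq> {}}"
        by (rule CollectI, rule conjI[OF g meet[OF m1 m2]])
    qed
  qed
qed

section \<open>Summing powers of scales\<close>

text \<open>For \<open>h \<in> H\<close> the element \<open>h0 \<otimes> inv h\<close> carries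
  \<open>(\<phi> h x, \<phi> h y, w)\<close> to a triple whose first two entries
  \<open>\<phi> h0 x\<close> and \<open>\<phi> h0 y\<close> no longer depend on \<open>h\<close>.
  Hence each scale of the distance from the third entry to these two occurs at most \<open>m\<close>
  times, and the \<open>q\<close>-th powers are dominated by a geometric series of ratio
  \<open>exp (- q)\<close>.\<close>

lemma scale_sum:
  assumes P: "scale_bounded \<nu> m \<rho> a b w"
    and w: "w \<notin> ball a \<rho>" "w \<notin> ball b \<rho>" and q: "0 < q"
  shows "\<exists>C. \<forall>x y h0 H. finite H \<and> h0 \<in> carrier \<Gamma> \<and> \<nu> \<le> dist (\<phi> h0 x) (\<phi> h0 y) \<and>
      H \<subseteq> {h \<in> carrier \<Gamma>. \<phi> h x \<in> ball a \<rho> \<and> \<phi> h y \<in> ball b \<rho>} \<longrightarrow>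
      (\<Sum>h\<in>H. min (dist (\<phi> (h0 \<otimes> inv h) w) (\<phi> h0 x)) (dist (\<phi> (h0 \<otimes> inv h) w) (\<phi> h0 y)) powr q) \<le> C"
proof -
  obtain D where D: "D > 0" "\<And>x y::'x. dist x y \<le> D" using dist_bound by blast
  \<comment> \<open>No distance exceeds \<open>D\<close>, so no scale index lies below
    \<open>k0\<close>; \<open>A\<close> bounds the \<open>q\<close>-th powers at index
    \<open>k0\<close>.\<close>
  define k0 where "k0 = \<lceil>- ln D\<rceil>"
  define A where "A = exp (q * (1 - of_int k0))"
  show ?thesis
  proof (intro exI[of _ "A * (m / (1 - exp (- q)))"] allI impI, elim conjE)
    fix x y h0 H
    assume H: "finite H" and h0: "h0 \<in> carrier \<Gamma>" and d: "\<nu> \<le> dist (\<phi> h0 x) (\<phi> h0 y)"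
      and HS: "H \<subseteq> {h \<in> carrier \<Gamma>. \<phi> h x \<in> ball a \<rho> \<and> \<phi> h y \<in> ball b \<rho>}"
    define t where "t h = min (dist (\<phi> (h0 \<otimes> inv h) w) (\<phi> h0 x)) (dist (\<phi> (h0 \<otimes> inv h) w) (\<phi> h0 y))" for h
    \<comment> \<open>Rounding up places \<open>t h\<close> between \<open>exp (- k h)\<close> and
      \<open>exp (- k h + 1)\<close>, the window counted by \<open>scale_bounded\<close>.\<close>
    define k where "k h = \<lceil>- ln (t h)\<rceil>" for h
    have t0: "0 < t h" if "h \<in> H" for h
    proof -
      have hc: "h \<in> carrier \<Gamma>" and hb: "\<phi> h x \<in> ball a \<rho>" "\<phi> h y \<in> ball b \<rho>" using that HS by auto
      have "w = \<phi> h u" if "\<phi> (h0 \<otimes> inv h) w = \<phi> h0 u" for u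
        using that hc h0 by (simp add: act_mult) (metis act_inv_right hc)
      then have "\<phi> (h0 \<otimes> inv h) w \<noteq> \<phi> h0 x" "\<phi> (h0 \<otimes> inv h) w \<noteq> \<phi> h0 y"
        using w hb by blast+
      then show ?thesis by (simp add: t_def)
    qed
    have tk: "exp (- of_int (k h)) \<le> t h \<and> t h \<le> exp (- of_int (k h) + 1)" if "h \<in> H" for h
    proof -
      have "- ln (t h) \<le> of_int (k h)" "of_int (k h) < - ln (t h) + 1"
        unfolding k_def by linarith+
      then have "- of_int (k h) \<le> ln (t h)" "ln (t h) \<le> - of_int (k h) + 1" by linarith+
      then have "exp (- of_int (k h)) \<le> exp (ln (t h))" "exp (ln (t h)) \<le> exp (- of_int (k h) + 1)"
        by simp_all
      then show ?thesis using t0[OF that] by simp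
    qed
    have kk: "k0 \<le> k h" if "h \<in> H" for h
    proof -
      have "ln (t h) \<le> ln D" using t0[OF that] D by (simp add: t_def min_le_iff_disj)
      then show ?thesis unfolding k0_def k_def by (intro ceiling_mono) simp
    qed
    have tA: "t h powr q \<le> A * exp (- q) ^ nat (k h - k0)" if "h \<in> H" for h
    proof -
      have "ln (t h) \<le> - of_int (k h) + 1"
        unfolding k_def by linarith
      then have "q * ln (t h) \<le> q * (- of_int (k h) + 1)" using q by simp
      then have "t h powr q \<le> exp (q * (- of_int (k h) + 1))"
        using t0[OF that] by (simp add: powr_def)
      also have "\<dots> = A * exp (- q) ^ nat (k h - k0)"
        using kk[OF that] by (simp add: A_def exp_of_nat_mult[symmetric] exp_add[symmetric] algebra_simps)
      finally show ?thesis .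
    qed
    have card: "real (card {h \<in> H. nat (k h - k0) = n}) \<le> m" for n
    proof -
      define S where "S = {g \<in> carrier \<Gamma>. (\<exists>u\<in>ball a \<rho>. \<exists>v\<in>ball b \<rho>. \<phi> g u = \<phi> h0 x \<and> \<phi> g v = \<phi> h0 y) \<and>
         exp (- of_int (k0 + int n)) \<le> min (dist (\<phi> g w) (\<phi> h0 x)) (dist (\<phi> g w) (\<phi> h0 y)) \<and>
         min (dist (\<phi> g w) (\<phi> h0 x)) (dist (\<phi> g w) (\<phi> h0 y)) \<le> exp (- of_int (k0 + int n) + 1)}"
      have S: "finite S" "real (card S) \<le> m"
        using P[unfolded scale_bounded_def, rule_format, OF d, of "k0 + int n"]
        unfolding at_most_def S_def by blast+
      have "card {h \<in> H. nat (k h - k0) = n} \<le> card S"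
      proof (rule card_inj_on_le[where f = "\<lambda>h. h0 \<otimes> inv h"])
        show "inj_on (\<lambda>h. h0 \<otimes> inv h) {h \<in> H. nat (k h - k0) = n}"
        proof (rule inj_onI)
          fix h h' assume *: "h \<in> {h \<in> H. nat (k h - k0) = n}" "h' \<in> {h \<in> H. nat (k h - k0) = n}"
            and e: "h0 \<otimes> inv h = h0 \<otimes> inv h'"
          have "h \<in> carrier \<Gamma>" "h' \<in> carrier \<Gamma>" using * HS by auto
          then show "h = h'" using e h0 inj_onD[OF inv_inj, of h h'] by simp
        qed
        show "(\<lambda>h. h0 \<otimes> inv h) ` {h \<in> H. nat (k h - k0) = n} \<subseteq> S"
        proof safe
          fix h assume h: "h \<in> H" "n = nat (k h - k0)"
          then have kn: "k h = k0 + int n" using kk by simp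
          have hc: "h \<in> carrier \<Gamma>" "\<phi> h x \<in> ball a \<rho>" "\<phi> h y \<in> ball b \<rho>" using h HS by auto
          have "\<phi> (h0 \<otimes> inv h) (\<phi> h x) = \<phi> h0 x" "\<phi> (h0 \<otimes> inv h) (\<phi> h y) = \<phi> h0 y"
            using hc h0 by (simp_all add: act_mult)
          then show "h0 \<otimes> inv h \<in> S"
            unfolding S_def using hc h0 tk[OF h(1)] unfolding kn t_def by blast
        qed
      qed fact
      then show ?thesis using S by linarith
    qed
    have "(\<Sum>h\<in>H. t h powr q) \<le> (\<Sum>h\<in>H. A * exp (- q) ^ nat (k h - k0))"
      by (rule sum_mono) (rule tA)
    also have "\<dots> = A * (\<Sum>h\<in>H. exp (- q) ^ nat (k h - k0))" by (simp add: sum_distrib_left)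
    also have "\<dots> \<le> A * (m / (1 - exp (- q)))"
      using sum_fibre_geometric[OF H card, of "exp (- q)"] q
      by (intro mult_left_mono) (auto simp: A_def)
    finally show "(\<Sum>h\<in>H. min (dist (\<phi> (h0 \<otimes> inv h) w) (\<phi> h0 x)) (dist (\<phi> (h0 \<otimes> inv h) w) (\<phi> h0 y)) powr q)
        \<le> A * (m / (1 - exp (- q)))" unfolding t_def .
  qed
qed

text \<open>
  Everything is measured from the \<open>h0 \<in> H\<close> for which \<open>\<delta> = dist (\<phi> h0 y) (\<phi> h0 z)\<close> is largest,
  by the position of \<open>\<phi> (h0 \<otimes> inv h) w\<close>: close to \<open>\<phi> h0 x\<close>, weak hyperbolicity contracts
  \<open>y\<close> and \<open>z\<close>; otherwise \<open>\<delta>\<close> itself is at most twice the scale seen from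
  \<open>(\<phi> h0 x, \<phi> h0 y)\<close> or from \<open>(\<phi> h0 x, \<phi> h0 z)\<close>. In each case the scales are summable.
\<close>

lemma near_sum:
  assumes P: "scale_bounded \<nu> m \<rho> a b w"
    and \<nu>: "2 * \<nu> \<le> dist a b" "2 * \<nu> \<le> dist w a" "2 * \<nu> \<le> dist w b"
    and \<rho>: "0 < \<rho>" "8 * \<rho> < \<nu>" and p: "0 < p"
  shows "\<exists>C. \<forall>x y z H. finite H \<and>
      H \<subseteq> {h \<in> carrier \<Gamma>. \<phi> h x \<in> ball a \<rho> \<and> \<phi> h y \<in> ball b \<rho> \<and> \<phi> h z \<in> ball b \<rho>} \<longrightarrow>
      (\<Sum>h\<in>H. dist (\<phi> h y) (\<phi> h z) powr p) \<le> C"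
proof -
  \<comment> \<open>Weak hyperbolicity is used at \<open>\<nu> / 2\<close>: the two balls are at
    least \<open>\<nu>\<close> apart, and \<open>w\<close> stays at least \<open>\<nu> / 2\<close>
    away from them.\<close>
  have "\<nu> / 2 > 0" using \<rho> by simp
  then obtain c where c: "0 < c" "c < 1" and
    wh0: "\<forall>g\<in>carrier \<Gamma>. \<forall>x y z. dist x y \<ge> 2 * (\<nu> / 2) \<and> dist (\<phi> g x) (\<phi> g y) \<ge> 2 * (\<nu> / 2) \<and> z \<notin> {x, y} \<and>
           min (dist (\<phi> g z) (\<phi> g x)) (dist (\<phi> g z) (\<phi> g y)) \<ge> \<nu> / 2 \<longrightarrow>
           (\<forall>w. dist w x \<le> \<nu> / 2 \<longrightarrow> dist (\<phi> g w) (\<phi> g x) \<le> dist z y powr c / c)"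
    using hyperbolic[unfolded weakly_hyperbolic_def, THEN spec, THEN mp, OF \<open>\<nu> / 2 > 0\<close>]
    by (elim exE conjE) (rule that)
  have wh: "dist (\<phi> g v) (\<phi> g x) \<le> dist z y powr c / c"
    if "g \<in> carrier \<Gamma>" "\<nu> \<le> dist x y" "\<nu> \<le> dist (\<phi> g x) (\<phi> g y)" "z \<notin> {x, y}"
       "\<nu> / 2 \<le> min (dist (\<phi> g z) (\<phi> g x)) (dist (\<phi> g z) (\<phi> g y))" "dist v x \<le> \<nu> / 2" for g x y z v
    using wh0[rule_format, of g x y z v] that by simp
  have w: "w \<notin> ball a \<rho>" "w \<notin> ball b \<rho>" using \<nu> \<rho> by (auto simp: dist_commute)
  obtain C1 where C1': "\<forall>x y h0 H. finite H \<and> h0 \<in> carrier \<Gamma> \<and> \<nu> \<le> dist (\<phi> h0 x) (\<phi> h0 y) \<and>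
      H \<subseteq> {h \<in> carrier \<Gamma>. \<phi> h x \<in> ball a \<rho> \<and> \<phi> h y \<in> ball b \<rho>} \<longrightarrow>
      (\<Sum>h\<in>H. min (dist (\<phi> (h0 \<otimes> inv h) w) (\<phi> h0 x)) (dist (\<phi> (h0 \<otimes> inv h) w) (\<phi> h0 y)) powr (c * p)) \<le> C1"
    using scale_sum[OF P w mult_pos_pos[OF c(1) p]] by (elim exE) (rule that)
  obtain C2 where C2': "\<forall>x y h0 H. finite H \<and> h0 \<in> carrier \<Gamma> \<and> \<nu> \<le> dist (\<phi> h0 x) (\<phi> h0 y) \<and>
      H \<subseteq> {h \<in> carrier \<Gamma>. \<phi> h x \<in> ball a \<rho> \<and> \<phi> h y \<in> ball b \<rho>} \<longrightarrow>
      (\<Sum>h\<in>H. min (dist (\<phi> (h0 \<otimes> inv h) w) (\<phi> h0 x)) (dist (\<phi> (h0 \<otimes> inv h) w) (\<phi> h0 y)) powr p) \<le> C2"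
    using scale_sum[OF P w p] by (elim exE) (rule that)
  note C1 = C1'[rule_format, OF conjI[OF _ conjI[OF _ conjI]]]
    and C2 = C2'[rule_format, OF conjI[OF _ conjI[OF _ conjI]]]
  have sep: "\<nu> \<le> dist u v" if "u \<in> ball a \<rho>" "v \<in> ball b \<rho>" for u v
    using that \<nu>(1) dist_triangle[of a b u] dist_triangle[of u b v] \<rho> by (auto simp: dist_commute)
  have farw: "\<nu> / 2 \<le> dist w u" if "u \<in> ball a \<rho> \<or> u \<in> ball b \<rho>" for u
    using that \<nu> dist_triangle[of w a u] dist_triangle[of w b u] \<rho> by (auto simp: dist_commute)
  show ?thesis
  \<comment> \<open>Without an admissible \<open>h0\<close> nothing fixes the sign of
    \<open>C1\<close> and \<open>C2\<close>; \<open>max 0\<close> covers the empty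
    \<open>H\<close>.\<close>
  proof (intro exI[of _ "max 0 (C1 / c powr p + 2 powr p * C2 + 2 powr p * C2)"] allI impI, elim conjE)
    fix x y z H
    assume H: "finite H" and
      HS: "H \<subseteq> {h \<in> carrier \<Gamma>. \<phi> h x \<in> ball a \<rho> \<and> \<phi> h y \<in> ball b \<rho> \<and> \<phi> h z \<in> ball b \<rho>}"
    show "(\<Sum>h\<in>H. dist (\<phi> h y) (\<phi> h z) powr p) \<le> max 0 (C1 / c powr p + 2 powr p * C2 + 2 powr p * C2)"
    proof (cases "H = {}")
      case False
      have "Max ((\<lambda>h. dist (\<phi> h y) (\<phi> h z)) ` H) \<in> (\<lambda>h. dist (\<phi> h y) (\<phi> h z)) ` H"
        using H False by (intro Max_in) auto
      then obtain h0 where h0: "h0 \<in> H"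
        and h0_max: "Max ((\<lambda>h. dist (\<phi> h y) (\<phi> h z)) ` H) = dist (\<phi> h0 y) (\<phi> h0 z)"
        by (elim imageE) (rule that)
      have mx: "dist (\<phi> h y) (\<phi> h z) \<le> dist (\<phi> h0 y) (\<phi> h0 z)" if "h \<in> H" for h
        unfolding h0_max[symmetric] using H that by (intro Max_ge) auto
      have h0c: "h0 \<in> carrier \<Gamma>" and h0b: "\<phi> h0 x \<in> ball a \<rho>" "\<phi> h0 y \<in> ball b \<rho>" "\<phi> h0 z \<in> ball b \<rho>"
        using h0 HS by auto
      define W where "W h = \<phi> (h0 \<otimes> inv h) w" for h
      define t where "t h = min (dist (W h) (\<phi> h0 x)) (dist (W h) (\<phi> h0 y))" for h
      define t' where "t' h = min (dist (W h) (\<phi> h0 x)) (dist (W h) (\<phi> h0 z))" for h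
      define \<delta> where "\<delta> = dist (\<phi> h0 y) (\<phi> h0 z)"
      have \<delta>: "\<delta> \<le> 2 * \<rho>"
        using h0b dist_triangle2[of "\<phi> h0 y" "\<phi> h0 z" b] by (auto simp: \<delta>_def dist_commute)
      have yz: "dist (\<phi> h0 z) (\<phi> h0 y) \<le> \<nu> / 2" using \<delta> \<rho> by (simp add: \<delta>_def dist_commute)
      have s0: "\<nu> \<le> dist (\<phi> h0 x) (\<phi> h0 y)" "\<nu> \<le> dist (\<phi> h0 x) (\<phi> h0 z)" using sep h0b by auto
      have ptw: "dist (\<phi> h y) (\<phi> h z) powr p \<le>
          t h powr (c * p) / c powr p + 2 powr p * t h powr p + 2 powr p * t' h powr p" if h: "h \<in> H" for h
      proof -
        have hc: "h \<in> carrier \<Gamma>" and hb: "\<phi> h x \<in> ball a \<rho>" "\<phi> h y \<in> ball b \<rho>" "\<phi> h z \<in> ball b \<rho>"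
          using h HS by auto
        have d\<delta>: "dist (\<phi> h y) (\<phi> h z) \<le> \<delta>" using mx[OF h] by (simp add: \<delta>_def)
        consider "dist (W h) (\<phi> h0 x) \<le> dist (W h) (\<phi> h0 y)"
          | "dist (W h) (\<phi> h0 y) < dist (W h) (\<phi> h0 x)" "\<delta> / 2 \<le> dist (W h) (\<phi> h0 y)"
          | "dist (W h) (\<phi> h0 y) < dist (W h) (\<phi> h0 x)" "dist (W h) (\<phi> h0 y) < \<delta> / 2"
          by linarith
        then show ?thesis
        proof cases
          case 1
          \<comment> \<open>Weak hyperbolicity is applied to \<open>h \<otimes> inv h0\<close> with
            \<open>\<phi> h0 y\<close> as its \<open>x\<close>, \<open>\<phi> h0 x\<close> as its
            \<open>y\<close>, and \<open>W h\<close>, which is sent to \<open>w\<close>, as its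
            \<open>z\<close>. The bound is then a power of the distance from \<open>W h\<close> to
            \<open>\<phi> h0 x\<close>, which is \<open>t h\<close> in this case.\<close>
          have g: "h \<otimes> inv h0 \<in> carrier \<Gamma>" using hc h0c by simp
          have gy: "\<phi> (h \<otimes> inv h0) (\<phi> h0 y) = \<phi> h y" "\<phi> (h \<otimes> inv h0) (\<phi> h0 x) = \<phi> h x"
            "\<phi> (h \<otimes> inv h0) (\<phi> h0 z) = \<phi> h z" "\<phi> (h \<otimes> inv h0) (W h) = w"
            using hc h0c by (simp_all add: act_mult W_def)
          have nz: "W h \<notin> {\<phi> h0 y, \<phi> h0 x}"
            using gy hb w by auto
          have fw: "\<nu> / 2 \<le> dist w (\<phi> h x)" "\<nu> / 2 \<le> dist w (\<phi> h y)" using farw hb by blast+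
          have "dist (\<phi> (h \<otimes> inv h0) (\<phi> h0 z)) (\<phi> (h \<otimes> inv h0) (\<phi> h0 y)) \<le> dist (W h) (\<phi> h0 x) powr c / c"
            by (rule wh[OF g _ _ nz])
              (use s0 sep[OF hb(1,2)] fw yz in \<open>simp_all add: gy dist_commute\<close>)
          then have "dist (\<phi> h y) (\<phi> h z) \<le> t h powr c / c"
            using 1 by (simp add: gy t_def dist_commute)
          then have "dist (\<phi> h y) (\<phi> h z) powr p \<le> (t h powr c / c) powr p"
            using p by (intro powr_mono2) auto
          also have "\<dots> = t h powr (c * p) / c powr p"
            using c by (simp add: powr_divide powr_powr)
          finally show ?thesis by (smt (verit) mult_nonneg_nonneg powr_ge_zero)
        next
          case 2
          then have "dist (\<phi> h y) (\<phi> h z) \<le> 2 * t h" using d\<delta> by (simp add: t_def)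
          then have "dist (\<phi> h y) (\<phi> h z) powr p \<le> (2 * t h) powr p"
            using p by (intro powr_mono2) auto
          also have "\<dots> = 2 powr p * t h powr p" by (simp add: powr_mult)
          finally show ?thesis by (smt (verit) mult_nonneg_nonneg powr_ge_zero divide_nonneg_nonneg)
        next
          case 3
          \<comment> \<open>\<open>W h\<close> is within \<open>\<delta> / 2\<close> of
            \<open>\<phi> h0 y\<close>, hence at least \<open>\<delta> / 2\<close> from
            \<open>\<phi> h0 z\<close> and from the remote point \<open>\<phi> h0 x\<close>. So
            \<open>t'\<close> is the scale to use here.\<close>
          have "\<delta> / 2 \<le> dist (W h) (\<phi> h0 z)"
            using 3 dist_triangle[of "\<phi> h0 y" "\<phi> h0 z" "W h"] by (simp add: \<delta>_def dist_commute)
          moreover have "\<delta> / 2 \<le> dist (W h) (\<phi> h0 x)"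
            using 3 dist_triangle[of "\<phi> h0 x" "\<phi> h0 y" "W h"] s0 \<delta> \<rho> by (simp add: dist_commute)
          ultimately have "dist (\<phi> h y) (\<phi> h z) \<le> 2 * t' h" using d\<delta> by (simp add: t'_def)
          then have "dist (\<phi> h y) (\<phi> h z) powr p \<le> (2 * t' h) powr p"
            using p by (intro powr_mono2) auto
          also have "\<dots> = 2 powr p * t' h powr p" by (simp add: powr_mult)
          finally show ?thesis by (smt (verit) mult_nonneg_nonneg powr_ge_zero divide_nonneg_nonneg)
        qed
      qed
      have "(\<Sum>h\<in>H. dist (\<phi> h y) (\<phi> h z) powr p) \<le>
          (\<Sum>h\<in>H. t h powr (c * p) / c powr p + 2 powr p * t h powr p + 2 powr p * t' h powr p)"
        by (rule sum_mono) (rule ptw)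
      also have "\<dots> = (\<Sum>h\<in>H. t h powr (c * p)) / c powr p + 2 powr p * (\<Sum>h\<in>H. t h powr p) +
          2 powr p * (\<Sum>h\<in>H. t' h powr p)"
        by (simp add: sum.distrib sum_distrib_left sum_divide_distrib)
      also have "\<dots> \<le> C1 / c powr p + 2 powr p * C2 + 2 powr p * C2"
        unfolding t_def t'_def W_def
        by (intro add_mono divide_right_mono mult_left_mono C1 C2) (use H h0c s0 HS in auto)
      finally show ?thesis by simp
    qed simp
  qed
qed

end

section \<open>A bounded cocycle supported near a pair of points\<close>

definition bump :: "'x::metric_space \<Rightarrow> real \<Rightarrow> 'x \<Rightarrow> real" where
  "bump a r x = max 0 (1 - dist x a / r)"

lemma bump_bounds: "0 < r \<Longrightarrow> 0 \<le> bump a r x \<and> bump a r x \<le> 1"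
  by (simp add: bump_def)

lemma bump_pos_iff: "0 < r \<Longrightarrow> 0 < bump a r x \<longleftrightarrow> x \<in> ball a r"
  by (simp add: bump_def dist_commute less_max_iff_disj)

lemma bump_eq_0_iff: "0 < r \<Longrightarrow> bump a r x = 0 \<longleftrightarrow> x \<notin> ball a r"
  using bump_pos_iff[of r a x] bump_bounds[of r a x] by linarith

lemma bump_center [simp]: "bump a r a = 1"
  by (simp add: bump_def)

lemma bump_lipschitz: "0 < r \<Longrightarrow> \<bar>bump a r x - bump a r y\<bar> \<le> dist x y / r"
proof -
  assume r: "0 < r"
  have "\<bar>dist x a - dist y a\<bar> \<le> dist x y" by (metis abs_dist_diff_le dist_commute)
  then have "\<bar>dist x a / r - dist y a / r\<bar> \<le> dist x y / r"
    using r by (simp add: diff_divide_distrib[symmetric] divide_right_mono)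
  then show ?thesis unfolding bump_def by linarith
qed

lemma bump_tendsto: "0 < r \<Longrightarrow> (f \<longlongrightarrow> l) F \<Longrightarrow> ((\<lambda>n. bump a r (f n)) \<longlongrightarrow> bump a r l) F"
  unfolding bump_def by (intro tendsto_intros) auto

definition chi :: "'x::metric_space \<Rightarrow> 'x \<Rightarrow> real \<Rightarrow> 'x \<Rightarrow> 'x \<Rightarrow> real" where
  "chi a b r x y = bump a r x * bump b r y - bump b r x * bump a r y"

lemma chi_same [simp]: "chi a b r x x = 0"
  by (simp add: chi_def)

lemma chi_swap: "chi a b r y x = - chi a b r x y"
  by (simp add: chi_def)

lemma chi_tendsto:
  "0 < r \<Longrightarrow> (f \<longlongrightarrow> l) F \<Longrightarrow> (g \<longlongrightarrow> k) F \<Longrightarrow> ((\<lambda>n. chi a b r (f n) (g n)) \<longlongrightarrow> chi a b r l k) F"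
  unfolding chi_def by (intro tendsto_intros bump_tendsto)

lemma abs_chi_le: assumes "0 < r" shows "\<bar>chi a b r x y\<bar> \<le> 1"
proof -
  have "0 \<le> bump a r x * bump b r y" "bump a r x * bump b r y \<le> 1"
       "0 \<le> bump b r x * bump a r y" "bump b r x * bump a r y \<le> 1"
    using bump_bounds[OF assms, of a x] bump_bounds[OF assms, of a y]
      bump_bounds[OF assms, of b x] bump_bounds[OF assms, of b y] by (auto intro!: mult_le_one)
  then show ?thesis unfolding chi_def by linarith
qed

text \<open>The homogeneous coboundary of \<open>chi\<close>, in cyclic form: by antisymmetry the
  middle term \<open>- chi a b r x z\<close> is \<open>chi a b r z x\<close>.\<close>

definition Phi :: "'x::metric_space \<Rightarrow> 'x \<Rightarrow> real \<Rightarrow> 'x \<Rightarrow> 'x \<Rightarrow> 'x \<Rightarrow> real" where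
  "Phi a b r x y z = chi a b r x y + chi a b r y z + chi a b r z x"

lemma abs_Phi_le: "0 < r \<Longrightarrow> \<bar>Phi a b r x y z\<bar> \<le> 3"
  using abs_chi_le[of r a b x y] abs_chi_le[of r a b y z] abs_chi_le[of r a b z x]
  unfolding Phi_def by linarith

lemma chi_nonzero:
  assumes "0 < r" "chi a b r x y \<noteq> 0"
  shows "x \<in> ball a r \<and> y \<in> ball b r \<or> x \<in> ball b r \<and> y \<in> ball a r"
proof -
  have "bump a r x \<noteq> 0 \<and> bump b r y \<noteq> 0 \<or> bump b r x \<noteq> 0 \<and> bump a r y \<noteq> 0"
    using assms(2) by (auto simp: chi_def)
  then show ?thesis using assms(1) by (simp add: bump_eq_0_iff)
qed

context hyperbolic_action
begin

text \<open>The point \<open>W h\<close> cannot be close to both \<open>\<phi> h0 x\<close> and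
  \<open>\<phi> h0 x'\<close>, nor to both \<open>\<phi> h0 y\<close> and
  \<open>\<phi> h0 y'\<close>. So one of the four scales formed with the pairs
  \<open>(x, y)\<close>, \<open>(x, y')\<close>, \<open>(x', y)\<close>, \<open>(x', y')\<close> is
  at least \<open>c\<close>, while \<open>scale_sum\<close> bounds the total of each over any finite
  \<open>H\<close>. As \<open>c\<close> depends on the points, this gives finiteness but no uniform
  estimate.\<close>

lemma finite_pairs:
  assumes P: "scale_bounded \<nu> m \<rho> a b w"
    and \<nu>: "2 * \<nu> \<le> dist a b" "2 * \<nu> \<le> dist w a" "2 * \<nu> \<le> dist w b"
    and \<rho>: "0 < \<rho>" "8 * \<rho> < \<nu>" and ne: "x \<noteq> x'" "y \<noteq> y'"
  shows "finite {h \<in> carrier \<Gamma>. \<phi> h x \<in> ball a \<rho> \<and> \<phi> h x' \<in> ball a \<rho> \<and> \<phi> h y \<in> ball b \<rho> \<and> \<phi> h y' \<in> ball b \<rho>}"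
    (is "finite ?S")
proof (cases "?S = {}")
  case False
  then obtain h0 where h0: "h0 \<in> ?S" by blast
  have w: "w \<notin> ball a \<rho>" "w \<notin> ball b \<rho>" using \<nu> \<rho> by (auto simp: dist_commute)
  have one: "(0::real) < 1" by simp
  obtain C where C': "\<forall>x y h0 H. finite H \<and> h0 \<in> carrier \<Gamma> \<and> \<nu> \<le> dist (\<phi> h0 x) (\<phi> h0 y) \<and>
      H \<subseteq> {h \<in> carrier \<Gamma>. \<phi> h x \<in> ball a \<rho> \<and> \<phi> h y \<in> ball b \<rho>} \<longrightarrow>
      (\<Sum>h\<in>H. min (dist (\<phi> (h0 \<otimes> inv h) w) (\<phi> h0 x)) (dist (\<phi> (h0 \<otimes> inv h) w) (\<phi> h0 y)) powr 1) \<le> C"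
    using scale_sum[OF P w one] by (elim exE) (rule that)
  note C = C'[rule_format, OF conjI[OF _ conjI[OF _ conjI]]]
  have h0c: "h0 \<in> carrier \<Gamma>" using h0 by simp
  have sep: "\<nu> \<le> dist u v" if "u \<in> ball a \<rho>" "v \<in> ball b \<rho>" for u v
    using that \<nu>(1) dist_triangle[of a b u] dist_triangle[of u b v] \<rho> by (auto simp: dist_commute)
  have s0: "\<nu> \<le> dist (\<phi> h0 x) (\<phi> h0 y)" "\<nu> \<le> dist (\<phi> h0 x) (\<phi> h0 y')"
    "\<nu> \<le> dist (\<phi> h0 x') (\<phi> h0 y)" "\<nu> \<le> dist (\<phi> h0 x') (\<phi> h0 y')"
    using h0 by (auto intro!: sep)
  define c where "c = min (dist (\<phi> h0 x) (\<phi> h0 x')) (dist (\<phi> h0 y) (\<phi> h0 y')) / 2"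
  have c: "0 < c" using ne h0c by (simp add: c_def)
  define W where "W h = \<phi> (h0 \<otimes> inv h) w" for h
  define t where "t u v h = min (dist (W h) (\<phi> h0 u)) (dist (W h) (\<phi> h0 v))" for u v h
  have t0: "0 \<le> t u v h" for u v h by (simp add: t_def)
  have key: "c \<le> t x y h + t x y' h + t x' y h + t x' y' h" for h
  proof -
    have "c \<le> dist (W h) (\<phi> h0 x) \<or> c \<le> dist (W h) (\<phi> h0 x')"
      using dist_triangle3[of "\<phi> h0 x" "\<phi> h0 x'" "W h"] unfolding c_def by linarith
    moreover have "c \<le> dist (W h) (\<phi> h0 y) \<or> c \<le> dist (W h) (\<phi> h0 y')"
      using dist_triangle3[of "\<phi> h0 y" "\<phi> h0 y'" "W h"] unfolding c_def by linarith
    ultimately have "c \<le> t x y h \<or> c \<le> t x y' h \<or> c \<le> t x' y h \<or> c \<le> t x' y' h"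
      unfolding t_def by auto
    then show ?thesis using t0[of x y h] t0[of x y' h] t0[of x' y h] t0[of x' y' h] by linarith
  qed
  have "card H \<le> nat \<lceil>4 * C / c\<rceil>" if H: "H \<subseteq> ?S" "finite H" for H
  proof -
    have "real (card H) * c = (\<Sum>h\<in>H. c)" by simp
    also have "\<dots> \<le> (\<Sum>h\<in>H. t x y h + t x y' h + t x' y h + t x' y' h)"
      by (intro sum_mono key)
    also have "\<dots> = (\<Sum>h\<in>H. t x y h powr 1) + (\<Sum>h\<in>H. t x y' h powr 1) +
        (\<Sum>h\<in>H. t x' y h powr 1) + (\<Sum>h\<in>H. t x' y' h powr 1)"
      by (simp add: sum.distrib t0)
    also have "\<dots> \<le> C + C + C + C"
      unfolding t_def W_def by (intro add_mono C) (use H h0c s0 in auto)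
    finally have "real (card H) \<le> 4 * C / c" using c by (simp add: field_simps)
    then show ?thesis by linarith
  qed
  then show ?thesis using finite_if_finite_subsets_card_bdd by blast
qed (metis finite.emptyI)

text \<open>\<open>Phi\<close> is nonzero only if one of the three points is sent near
  \<open>a\<close> and another near \<open>b\<close>. A third point far from both occurs for
  boundedly many \<open>h\<close>, by the second clause of metric properness. A third point close to
  one of them makes \<open>Phi\<close> a difference of two bumps times a factor at most 1, and
  \<open>near_sum\<close> controls this.\<close>

lemma bounded_cocycle:
  fixes a b w :: 'x
  assumes ab: "a \<noteq> b" and w: "w \<notin> {a, b}" and p: "0 < p"
  shows "\<exists>r0>0. \<forall>r. 0 < r \<and> r \<le> r0 \<longrightarrow>
     (\<forall>x x' y y'. x \<noteq> x' \<and> y \<noteq> y' \<longrightarrow>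
        finite {h \<in> carrier \<Gamma>. \<phi> h x \<in> ball a r \<and> \<phi> h x' \<in> ball a r \<and> \<phi> h y \<in> ball b r \<and> \<phi> h y' \<in> ball b r}) \<and>
     (\<exists>C. \<forall>x y z H. finite H \<and> H \<subseteq> carrier \<Gamma> \<longrightarrow>
        (\<Sum>h\<in>H. \<bar>Phi a b r (\<phi> h x) (\<phi> h y) (\<phi> h z)\<bar> powr p) \<le> C)"
proof -
  define \<nu> where "\<nu> = min (1/3) (min (dist a b) (min (dist w a) (dist w b)) / 2)"
  have \<nu>: "0 < \<nu>" "\<nu> < 1/2" using ab w by (auto simp: \<nu>_def)
  have \<nu>d: "2 * \<nu> \<le> dist a b" "2 * \<nu> \<le> dist w a" "2 * \<nu> \<le> dist w b" by (auto simp: \<nu>_def)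
  obtain m \<rho> where \<rho>: "0 < \<rho>" "8 * \<rho> < \<nu>" and
    sb: "\<forall>a b w. 2 * \<nu> \<le> dist a b \<longrightarrow> 2 * \<nu> \<le> dist w a \<longrightarrow> 2 * \<nu> \<le> dist w b \<longrightarrow> scale_bounded \<nu> m \<rho> a b w"
    using proper_balls[OF \<nu>] by (elim exE conjE) (rule that)
  note sb1 = sb[rule_format, OF \<nu>d]
  have \<nu>d': "2 * \<nu> \<le> dist b a" using \<nu>d by (simp add: dist_commute)
  note sb2 = sb[rule_format, OF \<nu>d' \<nu>d(3,2)]
  obtain C1 where C1: "\<forall>x y z H. finite H \<and>
      H \<subseteq> {h \<in> carrier \<Gamma>. \<phi> h x \<in> ball a \<rho> \<and> \<phi> h y \<in> ball b \<rho> \<and> \<phi> h z \<in> ball b \<rho>} \<longrightarrow>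
      (\<Sum>h\<in>H. dist (\<phi> h y) (\<phi> h z) powr p) \<le> C1"
    using near_sum[OF sb1 \<nu>d \<rho> p] by (elim exE) (rule that)
  \<comment> \<open>The mirror image, with the two centres exchanged, is for a third point near
    \<open>a\<close>.\<close>
  obtain C2 where C2: "\<forall>x y z H. finite H \<and>
      H \<subseteq> {h \<in> carrier \<Gamma>. \<phi> h x \<in> ball b \<rho> \<and> \<phi> h y \<in> ball a \<rho> \<and> \<phi> h z \<in> ball a \<rho>} \<longrightarrow>
      (\<Sum>h\<in>H. dist (\<phi> h y) (\<phi> h z) powr p) \<le> C2"
    using near_sum[OF sb2 \<nu>d' \<nu>d(3,2) \<rho> p] by (elim exE) (rule that)
  \<comment> \<open>With this choice \<open>2 * \<nu>'\<close> is \<open>\<rho> / 2\<close>, so a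
    point outside both balls of radius \<open>\<rho>\<close> is far in the sense of
    \<open>far_triples\<close>. The final radius \<open>\<rho>'\<close> belongs to
    \<open>\<nu>'\<close>.\<close>
  define \<nu>' where "\<nu>' = \<rho> / 4"
  have \<nu>': "0 < \<nu>'" "\<nu>' < 1/2" using \<rho> \<nu> by (auto simp: \<nu>'_def)
  have \<nu>d1: "2 * \<nu>' \<le> dist a b" using \<nu>d \<rho> by (simp add: \<nu>'_def)
  obtain m' \<rho>' where \<rho>': "0 < \<rho>'" "8 * \<rho>' < \<nu>'" "0 < m'" and
    fb: "\<forall>a b a' b'. 2 * \<nu>' \<le> dist a b \<longrightarrow> 2 * \<nu>' \<le> dist a' b' \<longrightarrow> at_most m' (far_triples \<nu>' \<rho>' a b a' b')"
    using proper_balls[OF \<nu>'] by (elim exE conjE) (rule that)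
  define K where "K = far_triples \<nu>' \<rho>' a b a b"
  have K: "finite K" "real (card K) \<le> m'"
    using fb[rule_format, OF \<nu>d1 \<nu>d1] unfolding at_most_def K_def by blast+
  show ?thesis
  proof (rule exI[of _ \<rho>'], intro conjI allI impI)
    show "0 < \<rho>'" by fact
  next
    fix r and x x' y y' :: 'x
    assume "0 < r \<and> r \<le> \<rho>'" and ne: "x \<noteq> x' \<and> y \<noteq> y'"
    then have r: "r \<le> \<rho>" using \<rho>' \<rho> by (simp add: \<nu>'_def)
    show "finite {h \<in> carrier \<Gamma>. \<phi> h x \<in> ball a r \<and> \<phi> h x' \<in> ball a r \<and> \<phi> h y \<in> ball b r \<and> \<phi> h y' \<in> ball b r}"
      by (rule finite_subset[OF _ finite_pairs[OF sb1 \<nu>d \<rho>, of x x' y y']]) (use r ne in auto)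
  next
    fix r assume r: "0 < r \<and> r \<le> \<rho>'"
    define B where "B = m' * 3 powr p + C1 / r powr p + C2 / r powr p"
    have r\<rho>: "r \<le> \<rho>" using r \<rho>' \<rho> by (simp add: \<nu>'_def)
    \<comment> \<open>The part in which \<open>x\<close> is the point near \<open>a\<close> and
      \<open>y\<close> the point near \<open>b\<close>; the six orderings of the three points
      exhaust all \<open>h\<close> with \<open>Phi\<close> nonzero.\<close>
    define f where "f x y z h = (if \<phi> h x \<in> ball a r \<and> \<phi> h y \<in> ball b r
        then \<bar>Phi a b r (\<phi> h x) (\<phi> h y) (\<phi> h z)\<bar> powr p else 0)" for x y z h
    have core: "(\<Sum>h\<in>H. f x y z h) \<le> B" if H: "finite H" "H \<subseteq> carrier \<Gamma>" for x y z H
    proof -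
      define H0 where "H0 = {h \<in> H. \<phi> h x \<in> ball a r \<and> \<phi> h y \<in> ball b r}"
      define Hf where "Hf = {h \<in> H0. 2 * \<nu>' \<le> dist (\<phi> h z) a \<and> 2 * \<nu>' \<le> dist (\<phi> h z) b}"
      define Hb where "Hb = {h \<in> H0. \<phi> h z \<in> ball b \<rho>}"
      define Ha where "Ha = {h \<in> H0. \<phi> h z \<in> ball a \<rho>}"
      have fin: "finite Hf" "finite Hb" "finite Ha" using H by (auto simp: Hf_def Hb_def Ha_def H0_def)
      have sub: "Hf \<subseteq> H" "Hb \<subseteq> H" "Ha \<subseteq> H" by (auto simp: Hf_def Hb_def Ha_def H0_def)
      have ptw: "f x y z h \<le> (if h \<in> Hf then 3 powr p else 0) +
          (if h \<in> Hb then dist (\<phi> h y) (\<phi> h z) powr p / r powr p else 0) +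
          (if h \<in> Ha then dist (\<phi> h x) (\<phi> h z) powr p / r powr p else 0)" if h: "h \<in> H" for h
      proof (cases "h \<in> H0")
        case False
        then show ?thesis using h unfolding f_def H0_def by auto
      next
        case True
        then have hx: "\<phi> h x \<in> ball a r" and hy: "\<phi> h y \<in> ball b r" by (auto simp: H0_def)
        have f: "f x y z h = \<bar>Phi a b r (\<phi> h x) (\<phi> h y) (\<phi> h z)\<bar> powr p" using hx hy by (simp add: f_def)
        have sep: "u \<notin> ball a r" if "u \<in> ball b \<rho>" for u
          using that \<nu>d \<rho> r\<rho> dist_triangle2[of a b u] by (auto simp: dist_commute)
        have sep': "u \<notin> ball b r" if "u \<in> ball a \<rho>" for u
          using that \<nu>d \<rho> r\<rho> dist_triangle2[of a b u] by (auto simp: dist_commute)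
        have nn: "0 \<le> dist u v powr p / r powr p" for u v :: 'x by simp
        have bx: "bump b r (\<phi> h x) = 0" using sep'[of "\<phi> h x"] hx r r\<rho> by (simp add: bump_eq_0_iff)
        have ay: "bump a r (\<phi> h y) = 0" using sep[of "\<phi> h y"] hy r r\<rho> by (simp add: bump_eq_0_iff)
        have bd: "\<bar>s * t\<bar> powr p \<le> dist u v powr p / r powr p"
          if "0 \<le> s" "s \<le> 1" "\<bar>t\<bar> \<le> dist u v / r" for s t and u v :: 'x
        proof -
          have "\<bar>s * t\<bar> \<le> 1 * (dist u v / r)"
            unfolding abs_mult using that by (intro mult_mono) auto
          then have "\<bar>s * t\<bar> powr p \<le> (dist u v / r) powr p" using p by (intro powr_mono2) auto
          then show ?thesis using r by (simp add: powr_divide)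
        qed
        consider "h \<in> Hf" | "h \<in> Hb" | "h \<in> Ha"
          using True \<rho>(1) unfolding Hf_def Hb_def Ha_def \<nu>'_def
          by (cases "dist (\<phi> h z) a < \<rho> / 2"; cases "dist (\<phi> h z) b < \<rho> / 2") (auto simp: dist_commute)
        then show ?thesis
        proof cases
          case 1
          have "f x y z h \<le> 3 powr p"
            unfolding f using p r by (intro powr_mono2 abs_Phi_le) auto
          then show ?thesis using 1 nn by (simp add: add_increasing2)
        next
          case 2
          then have "bump a r (\<phi> h z) = 0" using r sep by (auto simp: Hb_def bump_eq_0_iff)
          \<comment> \<open>Three of the six bumps vanish and the rest factors, so the Lipschitz
            bound for a single bump applies.\<close>
          then have eq: "Phi a b r (\<phi> h x) (\<phi> h y) (\<phi> h z) = bump a r (\<phi> h x) * (bump b r (\<phi> h y) - bump b r (\<phi> h z))"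
            using bx ay by (simp add: Phi_def chi_def algebra_simps)
          have "f x y z h \<le> dist (\<phi> h y) (\<phi> h z) powr p / r powr p"
            unfolding f eq by (rule bd) (use bump_bounds bump_lipschitz r in auto)
          then show ?thesis using 2 nn by (simp add: add_increasing add_increasing2)
        next
          case 3
          then have "bump b r (\<phi> h z) = 0" using r sep' by (auto simp: Ha_def bump_eq_0_iff)
          then have eq: "Phi a b r (\<phi> h x) (\<phi> h y) (\<phi> h z) = bump b r (\<phi> h y) * (bump a r (\<phi> h x) - bump a r (\<phi> h z))"
            using bx ay by (simp add: Phi_def chi_def algebra_simps)
          have "f x y z h \<le> dist (\<phi> h x) (\<phi> h z) powr p / r powr p"
            unfolding f eq by (rule bd) (use bump_bounds bump_lipschitz r in auto)
          then show ?thesis using 3 nn by (simp add: add_increasing add_increasing2)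
        qed
      qed
      have "card Hf \<le> card K"
      proof (cases "Hf = {}")
        case False
        then obtain h0 where h0: "h0 \<in> Hf" by blast
        then have h0c: "h0 \<in> carrier \<Gamma>" using sub H by blast
        show ?thesis
        \<comment> \<open>\<open>h \<otimes> inv h0\<close> carries the triple of images under
          \<open>h0\<close> to the triple of images under \<open>h\<close>. Both are far, so it lies
          in \<open>K\<close>.\<close>
        proof (rule card_inj_on_le[where f = "\<lambda>h. h \<otimes> inv h0"])
          show "inj_on (\<lambda>h. h \<otimes> inv h0) Hf"
          proof (rule inj_onI)
            fix h h' assume "h \<in> Hf" "h' \<in> Hf" and e: "h \<otimes> inv h0 = h' \<otimes> inv h0"
            then have "h \<in> carrier \<Gamma>" "h' \<in> carrier \<Gamma>" using sub H by auto
            then show "h = h'" using e h0c by simp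
          qed
          show "(\<lambda>h. h \<otimes> inv h0) ` Hf \<subseteq> K"
          proof safe
            fix h assume h: "h \<in> Hf"
            then have hc: "h \<in> carrier \<Gamma>" using sub H by blast
            have e: "\<phi> (h \<otimes> inv h0) (\<phi> h0 u) = \<phi> h u" for u using hc h0c by (simp add: act_mult)
            show "h \<otimes> inv h0 \<in> K"
              unfolding K_def
              by (rule far_triplesI[where u = "\<phi> h0 x" and v = "\<phi> h0 y" and z = "\<phi> h0 z"])
                (use h h0 hc h0c r in \<open>auto simp: Hf_def H0_def e\<close>)
          qed
        qed (rule K)
      qed simp
      then have cardf: "real (card Hf) \<le> m'" using K by linarith
      have "(\<Sum>h\<in>H. f x y z h) \<le> (\<Sum>h\<in>H. (if h \<in> Hf then 3 powr p else 0) +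
          (if h \<in> Hb then dist (\<phi> h y) (\<phi> h z) powr p / r powr p else 0) +
          (if h \<in> Ha then dist (\<phi> h x) (\<phi> h z) powr p / r powr p else 0))"
        by (rule sum_mono) (rule ptw)
      also have "\<dots> = (\<Sum>h\<in>Hf. 3 powr p) + (\<Sum>h\<in>Hb. dist (\<phi> h y) (\<phi> h z) powr p / r powr p) +
          (\<Sum>h\<in>Ha. dist (\<phi> h x) (\<phi> h z) powr p / r powr p)"
        using sub by (simp add: sum.distrib sum.inter_restrict[OF H(1), symmetric] Int_absorb1)
      also have "\<dots> = real (card Hf) * 3 powr p + (\<Sum>h\<in>Hb. dist (\<phi> h y) (\<phi> h z) powr p) / r powr p +
          (\<Sum>h\<in>Ha. dist (\<phi> h x) (\<phi> h z) powr p) / r powr p"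
        by (simp add: sum_divide_distrib)
      also have "\<dots> \<le> B"
        unfolding B_def
      proof (intro add_mono mult_right_mono divide_right_mono)
        show "(\<Sum>h\<in>Hb. dist (\<phi> h y) (\<phi> h z) powr p) \<le> C1"
          by (rule C1[rule_format, of _ x]) (use fin H r\<rho> in \<open>auto simp: Hb_def H0_def\<close>)
        show "(\<Sum>h\<in>Ha. dist (\<phi> h x) (\<phi> h z) powr p) \<le> C2"
          by (rule C2[rule_format, of _ y]) (use fin H r\<rho> in \<open>auto simp: Ha_def H0_def\<close>)
      qed (use cardf in auto)
      finally show ?thesis .
    qed
    show "\<exists>C. \<forall>x y z H. finite H \<and> H \<subseteq> carrier \<Gamma> \<longrightarrow>
        (\<Sum>h\<in>H. \<bar>Phi a b r (\<phi> h x) (\<phi> h y) (\<phi> h z)\<bar> powr p) \<le> C"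
    proof (intro exI[of _ "B + B + B + B + B + B"] allI impI)
      fix x y z H assume H: "finite H \<and> H \<subseteq> carrier \<Gamma>"
      have f0: "0 \<le> f u v t h" for u v t h by (simp add: f_def)
      have "\<bar>Phi a b r (\<phi> h x) (\<phi> h y) (\<phi> h z)\<bar> powr p \<le>
          f x y z h + f y x z h + f y z x h + f z y x h + f z x y h + f x z y h" for h
      proof (cases "Phi a b r (\<phi> h x) (\<phi> h y) (\<phi> h z) = 0")
        case True
        then show ?thesis using f0 by (simp add: add_nonneg_nonneg)
      next
        case False
        have e: "\<bar>Phi a b r (\<phi> h y) (\<phi> h x) (\<phi> h z)\<bar> = \<bar>Phi a b r (\<phi> h x) (\<phi> h y) (\<phi> h z)\<bar>"
          "\<bar>Phi a b r (\<phi> h y) (\<phi> h z) (\<phi> h x)\<bar> = \<bar>Phi a b r (\<phi> h x) (\<phi> h y) (\<phi> h z)\<bar>"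
          "\<bar>Phi a b r (\<phi> h z) (\<phi> h y) (\<phi> h x)\<bar> = \<bar>Phi a b r (\<phi> h x) (\<phi> h y) (\<phi> h z)\<bar>"
          "\<bar>Phi a b r (\<phi> h z) (\<phi> h x) (\<phi> h y)\<bar> = \<bar>Phi a b r (\<phi> h x) (\<phi> h y) (\<phi> h z)\<bar>"
          "\<bar>Phi a b r (\<phi> h x) (\<phi> h z) (\<phi> h y)\<bar> = \<bar>Phi a b r (\<phi> h x) (\<phi> h y) (\<phi> h z)\<bar>"
          using chi_swap[of a b r "\<phi> h x" "\<phi> h y"] chi_swap[of a b r "\<phi> h y" "\<phi> h z"]
            chi_swap[of a b r "\<phi> h z" "\<phi> h x"] unfolding Phi_def by linarith+
        have "chi a b r (\<phi> h x) (\<phi> h y) \<noteq> 0 \<or> chi a b r (\<phi> h y) (\<phi> h z) \<noteq> 0 \<or> chi a b r (\<phi> h z) (\<phi> h x) \<noteq> 0"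
          using False by (auto simp: Phi_def)
        then have "(\<phi> h x \<in> ball a r \<and> \<phi> h y \<in> ball b r) \<or> (\<phi> h y \<in> ball a r \<and> \<phi> h x \<in> ball b r) \<or>
           (\<phi> h y \<in> ball a r \<and> \<phi> h z \<in> ball b r) \<or> (\<phi> h z \<in> ball a r \<and> \<phi> h y \<in> ball b r) \<or>
           (\<phi> h z \<in> ball a r \<and> \<phi> h x \<in> ball b r) \<or> (\<phi> h x \<in> ball a r \<and> \<phi> h z \<in> ball b r)"
          using chi_nonzero r by blast
        then have "\<bar>Phi a b r (\<phi> h x) (\<phi> h y) (\<phi> h z)\<bar> powr p \<in>
            {f x y z h, f y x z h, f y z x h, f z y x h, f z x y h, f x z y h}"
          unfolding f_def e by (elim disjE) simp_all
        then show ?thesis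
          using f0[of x y z h] f0[of y x z h] f0[of y z x h] f0[of z y x h] f0[of z x y h] f0[of x z y h]
          by (elim insertE emptyE) linarith+
      qed
      then have "(\<Sum>h\<in>H. \<bar>Phi a b r (\<phi> h x) (\<phi> h y) (\<phi> h z)\<bar> powr p) \<le>
          (\<Sum>h\<in>H. f x y z h + f y x z h + f y z x h + f z y x h + f z x y h + f x z y h)"
        by (rule sum_mono)
      also have "\<dots> \<le> B + B + B + B + B + B"
        unfolding sum.distrib using H by (intro add_mono core) auto
      finally show "(\<Sum>h\<in>H. \<bar>Phi a b r (\<phi> h x) (\<phi> h y) (\<phi> h z)\<bar> powr p) \<le> B + B + B + B + B + B" .
    qed
  qed
qed

end

section \<open>North-south dynamics\<close>

lemma small_scale:
  assumes "\<forall>d\<in>set ds. 0 < (d::real)"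
  shows "\<exists>\<nu>>0. \<nu> < 1/2 \<and> (\<forall>d\<in>set ds. 2 * \<nu> \<le> d)"
  using assms
proof (induction ds)
  case Nil
  show ?case by (intro exI[of _ "1/3"]) simp
next
  case (Cons d ds)
  then obtain \<nu> where "0 < \<nu>" "\<nu> < 1/2" "\<forall>d\<in>set ds. 2 * \<nu> \<le> d" by auto
  then show ?case using Cons.prems by (intro exI[of _ "min \<nu> (d / 2)"]) (auto simp: min_le_iff_disj min_less_iff_disj)
qed

text \<open>The definition gives only one exponent for each \<open>\<epsilon>\<close>. To reach all
  large \<open>n\<close>, write \<open>n = j * k + (k * k' + r)\<close> with \<open>r < k\<close>.
  The finitely many points \<open>(f ^^ r) x\<close> avoid a ball \<open>ball b e'\<close>, for
  which \<open>k'\<close> is chosen; iterating by the multiple \<open>k * k'\<close> of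
  \<open>k'\<close> takes them near \<open>a\<close>, and the multiple \<open>j * k\<close> of
  \<open>k\<close> puts them into \<open>ball a e\<close>.\<close>

lemma north_south_tendsto:
  assumes ns: "north_south f a b" and x: "x \<noteq> b"
  shows "(\<lambda>n. (f ^^ n) x) \<longlonglongrightarrow> a"
proof -
  have hom: "homeomorphism UNIV UNIV f (inv_into UNIV f)" and fb: "f b = b" and ab: "a \<noteq> b"
    using ns by (auto simp: north_south_def)
  have inj: "inj f" 
    by (rule inj_on_inverseI[where g = "inv_into UNIV f"]) (rule homeomorphism_apply1[OF hom])
  have neb: "(f ^^ n) x \<noteq> b" for n
  proof (induction n)
    case (Suc n)
    then show ?case using injD[OF inj, of "(f ^^ n) x" b] fb by auto
  qed (use x in simp)
  have "\<exists>N. \<forall>n\<ge>N. dist ((f ^^ n) x) a < \<epsilon>" if "0 < \<epsilon>" for \<epsilon>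
  proof -
    define e where "e = min \<epsilon> (dist a b / 2)"
    have e: "0 < e" "2 * e \<le> dist a b" using that ab by (auto simp: e_def)
    obtain k where k: "0 < k" "(f ^^ k) ` (UNIV - ball b e) \<subseteq> ball a e"
      by (rule north_south_iterate[OF ns e(1)])
    define e' where "e' = min e (Min ((\<lambda>r. dist ((f ^^ r) x) b) ` {..<k}))"
    have "0 < Min ((\<lambda>r. dist ((f ^^ r) x) b) ` {..<k})"
      using k neb by (subst Min_gr_iff) auto
    then have e': "0 < e'" "e' \<le> e" using e by (auto simp: e'_def)
    have out: "(f ^^ r) x \<notin> ball b e'" if "r < k" for r
    proof -
      have "e' \<le> dist ((f ^^ r) x) b" unfolding e'_def using that by (intro min.coboundedI2 Min_le) auto
      then show ?thesis by (simp add: dist_commute)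
    qed
    obtain k' where k': "0 < k'" "(f ^^ k') ` (UNIV - ball b e') \<subseteq> ball a e'"
      by (rule north_south_iterate[OF ns e'(1)])
    have "dist ((f ^^ n) x) a < \<epsilon>" if n: "k * k' + k \<le> n" for n
    proof -
      define n' where "n' = n - k * k'"
      define r where "r = n' mod k"
      define j where "j = n' div k"
      have n'1: "n' = j * k + r" unfolding r_def j_def by (rule div_mult_mod_eq[symmetric])
      have n'3: "r < k" unfolding r_def using k(1) by (rule mod_less_divisor)
      have n'2: "n = j * k + (k * k' + r)" using n'1 n unfolding n'_def by linarith
      have "k \<le> n'" using n unfolding n'_def by linarith
      then have j: "0 < j" unfolding j_def using k(1) by (simp add: div_greater_zero_iff)
      have "(f ^^ (k * k')) ((f ^^ r) x) \<in> ball a e'"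
        by (rule north_south_mult_iterate[OF k'(2)]) (use e e' k out[OF n'3] in simp_all)
      then have "dist a ((f ^^ (k * k' + r)) x) < e" using e' by (simp add: funpow_add)
      then have "(f ^^ (k * k' + r)) x \<notin> ball b e"
        using e dist_triangle2[of a b "(f ^^ (k * k' + r)) x"] by simp
      then have "(f ^^ (j * k)) ((f ^^ (k * k' + r)) x) \<in> ball a e"
        by (intro north_south_mult_iterate[OF k(2) e(2)]) (use j in auto)
      then have "(f ^^ n) x \<in> ball a e" unfolding n'2 by (simp add: funpow_add)
      then show ?thesis by (simp add: e_def dist_commute)
    qed
    then show ?thesis by blast
  qed
  then show ?thesis by (simp add: lim_sequentially)
qed

context hyperbolic_action
begin

lemma act_pow: "g \<in> carrier \<Gamma> \<Longrightarrow> \<phi> (g [^] n) x = (\<phi> g ^^ n) x" for n :: nat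
proof (induction n arbitrary: x)
  case (Suc n)
  then show ?case by (simp add: act_mult funpow_swap1)
qed (simp add: act_one)

lemma act_homeomorphism: "g \<in> carrier \<Gamma> \<Longrightarrow> homeomorphism UNIV UNIV (\<phi> g) (\<phi> (inv g))"
  by (auto intro!: homeomorphismI act_cont)

lemma inv_into_act: "g \<in> carrier \<Gamma> \<Longrightarrow> inv_into UNIV (\<phi> g) = \<phi> (inv g)"
  by (rule ext) (metis act_eq_iff act_inv_right f_inv_into_f rangeI)

lemma north_south_inv:
  assumes "g \<in> carrier \<Gamma>" "north_south (\<phi> g) a b"
  shows "north_south (\<phi> (inv g)) b a"
proof -
  have it: "int_iterate (\<phi> (inv g)) m = int_iterate (\<phi> g) (- m)" for m
    using assms(1) by (auto simp: int_iterate_def inv_into_act)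
  have fx: "\<phi> g a = a" "\<phi> g b = b" using assms(2) by (auto simp: north_south_def)
  have fx': "\<phi> (inv g) a = a" "\<phi> (inv g) b = b" using assms(1) fx by (metis act_inv_left)+
  have hom: "homeomorphism UNIV UNIV (\<phi> (inv g)) (inv_into UNIV (\<phi> (inv g)))"
    using act_homeomorphism[of "inv g"] assms(1) by (simp add: inv_into_act)
  obtain \<delta> where \<delta>: "\<delta> > 0" "(\<Union>m. int_iterate (\<phi> g) m ` (UNIV - ball a \<delta> - ball b \<delta>)) = UNIV - {a, b}"
    using assms(2) unfolding north_south_def by (elim conjE exE) (rule that)
  have neg: "(\<Union>m. f (- m)) = (\<Union>m. f m)" for f :: "int \<Rightarrow> 'x set"
    by auto
  have "(\<Union>m. int_iterate (\<phi> (inv g)) m ` (UNIV - ball b \<delta> - ball a \<delta>)) =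
      (\<Union>m. int_iterate (\<phi> g) (- m) ` (UNIV - ball a \<delta> - ball b \<delta>))"
    unfolding it by (simp add: Diff_eq Int_ac)
  also have "\<dots> = (\<Union>m. int_iterate (\<phi> g) m ` (UNIV - ball a \<delta> - ball b \<delta>))"
    by (rule neg)
  finally have U: "(\<Union>m. int_iterate (\<phi> (inv g)) m ` (UNIV - ball b \<delta> - ball a \<delta>)) = UNIV - {b, a}"
    using \<delta> by auto
  show ?thesis
    unfolding north_south_def
  proof (intro conjI hom fx' exI[of _ \<delta>] \<delta> U)
    show "b \<noteq> a" using assms(2) by (auto simp: north_south_def)
    show "\<forall>\<epsilon>>0. \<exists>m>0. int_iterate (\<phi> (inv g)) m ` (UNIV - ball a \<epsilon>) \<subseteq> ball b \<epsilon> \<and>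
       int_iterate (\<phi> (inv g)) (- m) ` (UNIV - ball b \<epsilon>) \<subseteq> ball a \<epsilon>"
    proof (intro allI impI)
      fix \<epsilon> :: real assume "0 < \<epsilon>"
      moreover have "\<forall>\<epsilon>>0. \<exists>m>0. int_iterate (\<phi> g) m ` (UNIV - ball b \<epsilon>) \<subseteq> ball a \<epsilon> \<and>
          int_iterate (\<phi> g) (- m) ` (UNIV - ball a \<epsilon>) \<subseteq> ball b \<epsilon>"
        using assms(2) unfolding north_south_def by (elim conjE)
      ultimately obtain m where "m > 0" "int_iterate (\<phi> g) m ` (UNIV - ball b \<epsilon>) \<subseteq> ball a \<epsilon>"
          "int_iterate (\<phi> g) (- m) ` (UNIV - ball a \<epsilon>) \<subseteq> ball b \<epsilon>" by (elim allE impE exE conjE)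
      then show "\<exists>m>0. int_iterate (\<phi> (inv g)) m ` (UNIV - ball a \<epsilon>) \<subseteq> ball b \<epsilon> \<and>
          int_iterate (\<phi> (inv g)) (- m) ` (UNIV - ball b \<epsilon>) \<subseteq> ball a \<epsilon>"
        unfolding it by (intro exI[of _ m]) simp
    qed
  qed
qed

lemma north_south_attract:
  assumes "g \<in> carrier \<Gamma>" "north_south (\<phi> g) a b" "x \<noteq> b"
  shows "(\<lambda>n. \<phi> (g [^] (n::nat)) x) \<longlonglongrightarrow> a"
  using north_south_tendsto[OF assms(2,3)] assms(1) by (simp add: act_pow)

lemma north_south_repel:
  assumes "g \<in> carrier \<Gamma>" "north_south (\<phi> g) a b" "x \<noteq> a"
  shows "(\<lambda>n. \<phi> (inv (g [^] (n::nat))) x) \<longlonglongrightarrow> b"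
  using north_south_attract[OF _ north_south_inv[OF assms(1,2)] assms(3)] assms(1)
  by (simp add: nat_pow_inv)

lemma north_south_fix:
  assumes "g \<in> carrier \<Gamma>" "north_south (\<phi> g) a b"
  shows "\<phi> (g [^] (n::nat)) a = a" "\<phi> (g [^] n) b = b"
    "\<phi> (inv (g [^] n)) a = a" "\<phi> (inv (g [^] n)) b = b"
proof -
  have "\<phi> g a = a" "\<phi> g b = b" using assms(2) by (auto simp: north_south_def)
  then have "(\<phi> g ^^ n) a = a" "(\<phi> g ^^ n) b = b" by (induction n) auto
  then show *: "\<phi> (g [^] n) a = a" "\<phi> (g [^] n) b = b" using assms by (simp_all add: act_pow)
  show "\<phi> (inv (g [^] n)) a = a" "\<phi> (inv (g [^] n)) b = b"
    using * assms(1) by (metis act_inv_left nat_pow_closed)+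
qed

lemma int_iterate_act:
  assumes g: "g \<in> carrier \<Gamma>" and ns: "north_south (\<phi> g) a b"
  shows "\<exists>k\<in>carrier \<Gamma>. int_iterate (\<phi> g) m = \<phi> k \<and> \<phi> k a = a \<and> \<phi> k b = b"
proof (cases "m \<ge> 0")
  case True
  define n where "n = nat m"
  have "int_iterate (\<phi> g) m = \<phi> (g [^] n)"
    using g True by (auto simp: int_iterate_def act_pow n_def[symmetric])
  then show ?thesis using north_south_fix[OF g ns] g by (intro bexI[of _ "g [^] n"]) auto
next
  case False
  define n where "n = nat (- m)"
  have "int_iterate (\<phi> g) m = \<phi> (inv g [^] n)"
    using g False by (auto simp: int_iterate_def act_pow inv_into_act n_def[symmetric])
  then show ?thesis
    using north_south_fix[OF _ north_south_inv[OF g ns]] g by (intro bexI[of _ "inv g [^] n"]) auto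
qed

section \<open>Finiteness applied to fixed points\<close>

text \<open>Multiplying \<open>h\<close> on the right by a power of \<open>s\<close> keeps the
  images of \<open>c\<close> and \<open>d\<close> and, by the covering condition in north-south
  dynamics, allows \<open>\<phi> (inv h) w\<close> to be replaced by a point \<open>z\<close> far
  from \<open>c\<close> and \<open>d\<close>. The elements so obtained lie in a finite set of far
  triples, and finitely many positive distances have a positive minimum.\<close>

lemma avoid_orbit:
  fixes a b w :: 'x
  assumes s: "s \<in> carrier \<Gamma>" and ns: "north_south (\<phi> s) c d"
    and ab: "a \<noteq> b" and w: "w \<notin> {a, b}"
    and orb: "\<forall>k\<in>carrier \<Gamma>. (\<phi> k c, \<phi> k d) \<noteq> (a, b)"
  shows "\<exists>r>0. \<forall>h\<in>carrier \<Gamma>. \<not> (\<phi> h c \<in> ball a r \<and> \<phi> h d \<in> ball b r)"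
proof -
  have cd: "c \<noteq> d" using ns by (auto simp: north_south_def)
  obtain \<delta> where \<delta>: "\<delta> > 0"
    and cover: "(\<Union>m. int_iterate (\<phi> s) m ` (UNIV - ball c \<delta> - ball d \<delta>)) = UNIV - {c, d}"
    using ns unfolding north_south_def by (elim conjE exE) (rule that)
  obtain \<nu> where \<nu>: "0 < \<nu>" "\<nu> < 1/2" and
    "\<forall>e\<in>set [dist a b, dist w a, dist w b, dist c d, \<delta>]. 2 * \<nu> \<le> e"
    using small_scale[of "[dist a b, dist w a, dist w b, dist c d, \<delta>]"] ab w cd \<delta> by auto
  then have \<nu>d: "2 * \<nu> \<le> dist a b" "2 * \<nu> \<le> dist w a" "2 * \<nu> \<le> dist w b" "2 * \<nu> \<le> dist c d" "2 * \<nu> \<le> \<delta>"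
    by simp_all
  obtain m \<rho> where \<rho>: "0 < \<rho>" "8 * \<rho> < \<nu>" and
    fb: "\<forall>a b a' b'. 2 * \<nu> \<le> dist a b \<longrightarrow> 2 * \<nu> \<le> dist a' b' \<longrightarrow> at_most m (far_triples \<nu> \<rho> a b a' b')"
    using proper_balls[OF \<nu>] by (elim exE conjE) (rule that)
  define K where "K = far_triples \<nu> \<rho> c d a b"
  have fin: "finite K" using fb[rule_format, OF \<nu>d(4,1)] by (simp add: at_most_def K_def)
  have KG: "K \<subseteq> carrier \<Gamma>" by (auto simp: K_def far_triples_def)
  define q where "q k = max (dist (\<phi> k c) a) (dist (\<phi> k d) b)" for k
  have q0: "0 < q k" if "k \<in> K" for k
    using orb[rule_format, of k] that KG by (auto simp: q_def less_max_iff_disj)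
  define r where "r = Min (insert \<rho> (q ` K))"
  have r: "0 < r" "r \<le> \<rho>" using q0 fin \<rho> by (auto simp: r_def)
  have rq: "r \<le> q k" if "k \<in> K" for k using that fin by (simp add: r_def)
  have False if h: "h \<in> carrier \<Gamma>" "\<phi> h c \<in> ball a r" "\<phi> h d \<in> ball b r" for h
  proof -
    have "w \<notin> ball a r" "w \<notin> ball b r" using \<nu>d r \<rho> by (simp_all add: dist_commute)
    moreover have "\<phi> h (\<phi> (inv h) w) = w" using h(1) by simp
    ultimately have "\<phi> (inv h) w \<noteq> c" "\<phi> (inv h) w \<noteq> d" using h(2,3) by auto
    then have "\<phi> (inv h) w \<in> (\<Union>m. int_iterate (\<phi> s) m ` (UNIV - ball c \<delta> - ball d \<delta>))"
      unfolding cover by simp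
    then obtain n z where z: "\<phi> (inv h) w = int_iterate (\<phi> s) n z" "z \<notin> ball c \<delta>" "z \<notin> ball d \<delta>"
      by blast
    obtain k where k: "k \<in> carrier \<Gamma>" "int_iterate (\<phi> s) n = \<phi> k" "\<phi> k c = c" "\<phi> k d = d"
      using int_iterate_act[OF s ns] by blast
    have "\<phi> k z = \<phi> (inv h) w" using z(1) k(2) by simp
    then have hk: "\<phi> (h \<otimes> k) c = \<phi> h c" "\<phi> (h \<otimes> k) d = \<phi> h d" "\<phi> (h \<otimes> k) z = w"
      using h(1) k by (simp_all add: act_mult)
    have "h \<otimes> k \<in> K"
      unfolding K_def
      by (rule far_triplesI[where u = c and v = d and z = z])
        (use h k(1) hk z(2,3) r \<rho> \<nu>d in \<open>simp_all add: dist_commute\<close>)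
    then have "r \<le> q (h \<otimes> k)" by (rule rq)
    then show False using h(2,3) unfolding q_def hk by (simp add: dist_commute)
  qed
  then show ?thesis using r by blast
qed

text \<open>The products \<open>g [^] n \<otimes> inv (s [^] j n)\<close> fix \<open>b\<close>. With
  \<open>j n\<close> an exit time they also carry a point far from \<open>b\<close> and
  \<open>c\<close> to \<open>w\<close>, and a point converging to \<open>c\<close> to
  \<open>a\<close>. They eventually lie in a finite set of far triples, so one of them recurs and
  sends \<open>c\<close> to \<open>a\<close> by continuity.\<close>

lemma common_repelling_point:
  fixes a b c w :: 'x
  assumes g: "g \<in> carrier \<Gamma>" "north_south (\<phi> g) a b" and s: "s \<in> carrier \<Gamma>" "north_south (\<phi> s) c b"
    and w: "w \<notin> {a, b}"
  shows "\<exists>k\<in>carrier \<Gamma>. \<phi> k c = a \<and> \<phi> k b = b"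
proof -
  have ab: "a \<noteq> b" and cb: "c \<noteq> b" using g s by (auto simp: north_south_def)
  define x where "x n = \<phi> (inv (g [^] n)) w" for n :: nat
  have xb: "x \<longlonglongrightarrow> b" unfolding x_def using north_south_repel[OF g, of w] w by simp
  have xne: "x n \<noteq> b" for n
    using north_south_fix(4)[OF g, of n] w g(1) unfolding x_def
    by (metis act_eq_iff insertCI inv_closed nat_pow_closed)
  define \<delta> where "\<delta> = dist c b / 2"
  have \<delta>: "0 < \<delta>" using cb by (simp add: \<delta>_def)
  have "\<exists>j::nat. \<phi> (s [^] j) (x n) \<notin> ball b \<delta>" for n
  proof -
    have "(\<lambda>j. \<phi> (s [^] (j::nat)) (x n)) \<longlonglongrightarrow> c"
      by (rule north_south_attract[OF s xne])
    then have "eventually (\<lambda>j. dist (\<phi> (s [^] (j::nat)) (x n)) c < \<delta>) sequentially"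
      using \<delta> by (rule tendstoD)
    then obtain j :: nat where "dist (\<phi> (s [^] j) (x n)) c < \<delta>" by (auto simp: eventually_sequentially)
    then have "\<phi> (s [^] j) (x n) \<notin> ball b \<delta>"
      using dist_triangle3[of c b "\<phi> (s [^] j) (x n)"] by (auto simp: \<delta>_def dist_commute)
    then show ?thesis ..
  qed
  \<comment> \<open>the first time the orbit of \<open>x n\<close> leaves the neighbourhood of \<open>b\<close>\<close>
  define j where "j n = (LEAST j::nat. \<phi> (s [^] j) (x n) \<notin> ball b \<delta>)" for n
  have j1: "\<phi> (s [^] j n) (x n) \<notin> ball b \<delta>" for n
    unfolding j_def by (rule LeastI_ex[of "\<lambda>j::nat. \<phi> (s [^] j) (x n) \<notin> ball b \<delta>"]) fact
  have j2: "\<phi> (s [^] i) (x n) \<in> ball b \<delta>" if "i < j n" for i n :: nat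
    using not_less_Least[of i "\<lambda>j::nat. \<phi> (s [^] j) (x n) \<notin> ball b \<delta>"] that unfolding j_def by blast
  have jinf: "filterlim j at_top sequentially"
    unfolding filterlim_at_top
  proof
    fix J :: nat
    have "eventually (\<lambda>n. \<phi> (s [^] i) (x n) \<in> ball b \<delta>) sequentially" for i :: nat
    proof -
      have "(\<lambda>n. \<phi> (s [^] i) (x n)) \<longlonglongrightarrow> \<phi> (s [^] i) b" using s xb by (intro act_tendsto) auto
      then have "(\<lambda>n. \<phi> (s [^] i) (x n)) \<longlonglongrightarrow> b" by (simp add: north_south_fix[OF s])
      then show ?thesis using tendstoD[OF _ \<delta>] by (fastforce simp: dist_commute)
    qed
    then have "eventually (\<lambda>n. \<forall>i\<in>{..<J}. \<phi> (s [^] i) (x n) \<in> ball b \<delta>) sequentially"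
      by (simp add: eventually_ball_finite del: mem_ball)
    then show "eventually (\<lambda>n. J \<le> j n) sequentially"
    proof eventually_elim
      case (elim n)
      then show ?case using j1[of n] by (meson lessThan_iff not_le)
    qed
  qed
  have "(\<phi> (inv s) \<longlongrightarrow> \<phi> (inv s) c) (nhds c)"
    using act_tendsto[of "inv s" "\<lambda>x. x"] s(1) filterlim_ident by blast
  then have "eventually (\<lambda>y. dist (\<phi> (inv s) y) (\<phi> (inv s) c) < \<delta>) (nhds c)"
    using \<delta> by (rule tendstoD)
  \<comment> \<open>If \<open>y\<close> is within \<open>\<kappa>\<close> of \<open>c\<close>, its
    preimage under \<open>s\<close> is within \<open>\<delta>\<close> of \<open>c\<close>, hence
    outside \<open>ball b \<delta>\<close>. At the time of first exit this is impossible, which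
    keeps \<open>y n\<close> away from \<open>c\<close>.\<close>
  then obtain \<kappa> where \<kappa>: "0 < \<kappa>" "\<And>y. dist y c < \<kappa> \<Longrightarrow> dist (\<phi> (inv s) y) c < \<delta>"
    using north_south_fix(3)[OF s, of 1] s(1) by (auto simp: eventually_nhds_metric)
  define y where "y n = \<phi> (s [^] j n) (x n)" for n
  have yb: "\<delta> \<le> dist (y n) b" for n using j1[of n] by (simp add: y_def dist_commute)
  have yc: "eventually (\<lambda>n. \<kappa> \<le> dist (y n) c) sequentially"
  proof -
    have "eventually (\<lambda>n. 1 \<le> j n) sequentially" using jinf by (simp add: filterlim_at_top)
    then show ?thesis
    proof eventually_elim
      case (elim n)
      then obtain i where i: "j n = Suc i" by (cases "j n") auto
      have "\<phi> (inv s) (y n) = \<phi> (s [^] i) (x n)"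
      proof -
        have "s [^] Suc i = s \<otimes> s [^] i" using s(1) by (metis nat_pow_Suc2)
        then show ?thesis using s(1) by (simp add: y_def i act_mult del: nat_pow_Suc)
      qed
      then have "\<phi> (inv s) (y n) \<in> ball b \<delta>" using j2[of i n] i by simp
      then have "\<not> dist (\<phi> (inv s) (y n)) c < \<delta>"
        using dist_triangle3[of c b "\<phi> (inv s) (y n)"] by (auto simp: \<delta>_def dist_commute)
      then show ?case using \<kappa>(2)[of "y n"] by linarith
    qed
  qed
  define u where "u n = \<phi> (s [^] j n) a" for n
  have uc: "u \<longlonglongrightarrow> c"
    unfolding u_def
    by (rule filterlim_compose[OF north_south_attract[OF s ab] jinf])
  define k where "k n = g [^] n \<otimes> inv (s [^] j n)" for n :: nat
  have kc: "k n \<in> carrier \<Gamma>" for n using g s by (simp add: k_def)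
  have ku: "\<phi> (k n) (u n) = a" "\<phi> (k n) b = b" "\<phi> (k n) (y n) = w" for n
    using g(1) s(1) north_south_fix[OF g, of n] north_south_fix[OF s, of "j n"]
    by (simp_all add: k_def u_def y_def x_def act_mult)
  obtain \<nu> where \<nu>: "0 < \<nu>" "\<nu> < 1/2" and
    "\<forall>e\<in>set [dist a b, dist w a, dist w b, dist c b, \<delta>, \<kappa>]. 2 * \<nu> \<le> e"
    using small_scale[of "[dist a b, dist w a, dist w b, dist c b, \<delta>, \<kappa>]"] ab w cb \<delta> \<kappa> by auto
  then have \<nu>d: "2 * \<nu> \<le> dist a b" "2 * \<nu> \<le> dist w a" "2 * \<nu> \<le> dist w b" "2 * \<nu> \<le> dist c b"
      "2 * \<nu> \<le> \<delta>" "2 * \<nu> \<le> \<kappa>"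
    by simp_all
  obtain m \<rho> where \<rho>: "0 < \<rho>" "8 * \<rho> < \<nu>" and
    fb: "\<forall>a b a' b'. 2 * \<nu> \<le> dist a b \<longrightarrow> 2 * \<nu> \<le> dist a' b' \<longrightarrow> at_most m (far_triples \<nu> \<rho> a b a' b')"
    using proper_balls[OF \<nu>] by (elim exE conjE) (rule that)
  define K where "K = {k \<in> far_triples \<nu> \<rho> c b a b. \<phi> k b = b}"
  have fin: "finite K" using fb[rule_format, OF \<nu>d(4,1)] by (simp add: at_most_def K_def)
  have KG: "K \<subseteq> carrier \<Gamma>" by (auto simp: K_def far_triples_def)
  have "eventually (\<lambda>n. dist (u n) c < \<rho>) sequentially" using uc \<rho>(1) by (rule tendstoD)
  with yc have kK: "eventually (\<lambda>n. k n \<in> K) sequentially"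
  proof eventually_elim
    case (elim n)
    have "k n \<in> far_triples \<nu> \<rho> c b a b"
      by (rule far_triplesI[where u = "u n" and v = b and z = "y n"])
        (use elim kc ku yb[of n] \<rho> \<nu>d in \<open>simp_all add: dist_commute\<close>)
    then show ?case using ku by (simp add: K_def)
  qed
  have "\<exists>k\<in>K. \<phi> k c = a"
  proof (rule ccontr)
    assume no: "\<not> ?thesis"
    have "eventually (\<lambda>n. \<phi> k (u n) \<noteq> a) sequentially" if "k \<in> K" for k
    proof -
      have "(\<lambda>n. \<phi> k (u n)) \<longlonglongrightarrow> \<phi> k c" using that KG uc by (intro act_tendsto) auto
      moreover have "\<phi> k c \<noteq> a" using no that by blast
      ultimately show ?thesis by (rule tendsto_imp_eventually_ne)
    qed
    then have "eventually (\<lambda>n. \<forall>k\<in>K. \<phi> k (u n) \<noteq> a) sequentially"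
      using fin by (simp add: eventually_ball_finite)
    with kK have "eventually (\<lambda>n. False) sequentially"
      by eventually_elim (use ku in blast)
    then show False by simp
  qed
  then show ?thesis using KG by (auto simp: K_def)
qed

end

section \<open>Cocycles with values in \<open>\<ell>\<^sup>p\<close>\<close>

text \<open>\<open>C\<close> bounds the \<open>p\<close>-th power of the norm, not the norm. Working
  with finite partial sums avoids side conditions on summability and gives exact additivity over
  disjoint finite sets.\<close>

definition p_sum_le :: "'a set \<Rightarrow> real \<Rightarrow> ('a \<Rightarrow> real) \<Rightarrow> real \<Rightarrow> bool" where
  "p_sum_le A p f C \<longleftrightarrow> (\<forall>H. finite H \<and> H \<subseteq> A \<longrightarrow> (\<Sum>h\<in>H. \<bar>f h\<bar> powr p) \<le> C)"

lemma p_sum_leD: "p_sum_le A p f C \<Longrightarrow> finite H \<Longrightarrow> H \<subseteq> A \<Longrightarrow> (\<Sum>h\<in>H. \<bar>f h\<bar> powr p) \<le> C"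
  by (simp add: p_sum_le_def)

lemma p_sum_leI: "(\<And>H. finite H \<Longrightarrow> H \<subseteq> A \<Longrightarrow> (\<Sum>h\<in>H. \<bar>f h\<bar> powr p) \<le> C) \<Longrightarrow> p_sum_le A p f C"
  by (simp add: p_sum_le_def)

lemma p_sum_le_cong:
  assumes "p_sum_le A p g C" and eq: "\<And>h. h \<in> A \<Longrightarrow> \<bar>f h\<bar> = \<bar>g h\<bar>"
  shows "p_sum_le A p f C"
proof (rule p_sum_leI)
  fix H assume H: "finite H" "H \<subseteq> A"
  then have "(\<Sum>h\<in>H. \<bar>f h\<bar> powr p) = (\<Sum>h\<in>H. \<bar>g h\<bar> powr p)"
    by (intro sum.cong refl) (simp add: eq subsetD)
  then show "(\<Sum>h\<in>H. \<bar>f h\<bar> powr p) \<le> C" using p_sum_leD[OF assms(1) H] by simp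
qed

lemma p_sum_le_mono: "p_sum_le A p f C \<Longrightarrow> C \<le> D \<Longrightarrow> p_sum_le A p f D"
  unfolding p_sum_le_def by (auto intro: order_trans)

lemma p_sum_le_point: "p_sum_le A p f C \<Longrightarrow> h \<in> A \<Longrightarrow> \<bar>f h\<bar> powr p \<le> C"
  using p_sum_leD[of A p f C "{h}"] by simp

lemma powr_add_le:
  fixes x y :: real assumes "0 < p"
  shows "\<bar>x + y\<bar> powr p \<le> 2 powr p * (\<bar>x\<bar> powr p + \<bar>y\<bar> powr p)"
proof -
  have "\<bar>x + y\<bar> powr p \<le> (2 * max \<bar>x\<bar> \<bar>y\<bar>) powr p"
    using assms by (intro powr_mono2) auto
  also have "\<dots> = 2 powr p * max \<bar>x\<bar> \<bar>y\<bar> powr p" by (simp add: powr_mult)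
  also have "\<dots> \<le> 2 powr p * (\<bar>x\<bar> powr p + \<bar>y\<bar> powr p)"
    by (intro mult_left_mono) (auto simp: max_def)
  finally show ?thesis .
qed

lemma p_sum_le_add:
  assumes "0 < p" "p_sum_le A p f C" "p_sum_le A p g D"
  shows "p_sum_le A p (\<lambda>h. f h + g h) (2 powr p * (C + D))"
proof (rule p_sum_leI)
  fix H assume H: "finite H" "H \<subseteq> A"
  have "(\<Sum>h\<in>H. \<bar>f h + g h\<bar> powr p) \<le> (\<Sum>h\<in>H. 2 powr p * (\<bar>f h\<bar> powr p + \<bar>g h\<bar> powr p))"
    using assms(1) by (intro sum_mono powr_add_le)
  also have "\<dots> = 2 powr p * ((\<Sum>h\<in>H. \<bar>f h\<bar> powr p) + (\<Sum>h\<in>H. \<bar>g h\<bar> powr p))"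
    by (simp add: sum_distrib_left[symmetric] sum.distrib)
  also have "\<dots> \<le> 2 powr p * (C + D)"
    using p_sum_leD[OF assms(2) H] p_sum_leD[OF assms(3) H] by (intro mult_left_mono) auto
  finally show "(\<Sum>h\<in>H. \<bar>f h + g h\<bar> powr p) \<le> 2 powr p * (C + D)" .
qed

lemma p_sum_le_cmult:
  assumes "p_sum_le A p f C"
  shows "p_sum_le A p (\<lambda>h. c * f h) (\<bar>c\<bar> powr p * C)"
proof (rule p_sum_leI)
  fix H assume H: "finite H" "H \<subseteq> A"
  have "(\<Sum>h\<in>H. \<bar>c * f h\<bar> powr p) = \<bar>c\<bar> powr p * (\<Sum>h\<in>H. \<bar>f h\<bar> powr p)"
    by (simp add: abs_mult powr_mult sum_distrib_left)
  also have "\<dots> \<le> \<bar>c\<bar> powr p * C" using p_sum_leD[OF assms H] by (intro mult_left_mono) auto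
  finally show "(\<Sum>h\<in>H. \<bar>c * f h\<bar> powr p) \<le> \<bar>c\<bar> powr p * C" .
qed

text \<open>Fatou's lemma in finite form: each partial sum has finitely many terms, so pointwise
  convergence suffices.\<close>

lemma p_sum_le_limit:
  assumes p: "0 < p" and "\<And>n. p_sum_le A p (f n) C" and lim: "\<And>h. h \<in> A \<Longrightarrow> (\<lambda>n. f n h) \<longlonglongrightarrow> l h"
  shows "p_sum_le A p l C"
proof (rule p_sum_leI)
  fix H assume H: "finite H" "H \<subseteq> A"
  have "(\<lambda>n. \<Sum>h\<in>H. \<bar>f n h\<bar> powr p) \<longlonglongrightarrow> (\<Sum>h\<in>H. \<bar>l h\<bar> powr p)"
    using H p lim by (intro tendsto_sum tendsto_powr' tendsto_rabs) auto
  then show "(\<Sum>h\<in>H. \<bar>l h\<bar> powr p) \<le> C"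
    by (rule LIMSEQ_le_const2) (use p_sum_leD[OF assms(2) H] in blast)
qed

text \<open>The values along an injective sequence have summable \<open>p\<close>-th powers. This
  decay is the source of all vanishing limits of cocycles in \<open>cocycle_rigidity\<close>; merely
  bounded functions do not have it.\<close>

lemma p_sum_le_tendsto_0:
  fixes f :: "'a \<Rightarrow> real" and k :: "nat \<Rightarrow> 'a"
  assumes p: "0 < p" and f: "p_sum_le A p f C" and k: "inj k" "range k \<subseteq> A"
  shows "(\<lambda>n. f (k n)) \<longlonglongrightarrow> 0"
proof -
  have "(\<Sum>i<n. \<bar>f (k i)\<bar> powr p) \<le> C" for n
  proof -
    have "(\<Sum>i<n. \<bar>f (k i)\<bar> powr p) = (\<Sum>h\<in>k ` {..<n}. \<bar>f h\<bar> powr p)"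
      by (subst sum.reindex) (use k in \<open>auto intro: inj_on_subset\<close>)
    also have "\<dots> \<le> C" by (rule p_sum_leD[OF f]) (use k in auto)
    finally show ?thesis .
  qed
  then have "summable (\<lambda>n. \<bar>f (k n)\<bar> powr p)"
    by (intro summableI_nonneg_bounded[where x = C]) auto
  then have "(\<lambda>n. \<bar>f (k n)\<bar> powr p) \<longlonglongrightarrow> 0" by (rule summable_LIMSEQ_zero)
  then have "(\<lambda>n. (\<bar>f (k n)\<bar> powr p) powr (1 / p)) \<longlonglongrightarrow> 0 powr (1 / p)"
    using p by (intro tendsto_powr') auto
  then have "(\<lambda>n. \<bar>f (k n)\<bar>) \<longlonglongrightarrow> 0" using p by (simp add: powr_powr)
  then show ?thesis by (simp add: tendsto_rabs_zero_iff)
qed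

section \<open>Rigidity of cocycles\<close>

context hyperbolic_action
begin

lemma p_sum_le_translate:
  assumes "p_sum_le (carrier \<Gamma>) p f C" "x \<in> carrier \<Gamma>"
  shows "p_sum_le (carrier \<Gamma>) p (\<lambda>h. f (h \<otimes> x)) C"
proof (rule p_sum_leI)
  fix H assume H: "finite H" "H \<subseteq> carrier \<Gamma>"
  have "inj_on (\<lambda>h. h \<otimes> x) H" using H assms(2) by (auto simp: inj_on_def subset_iff)
  then have "(\<Sum>h\<in>H. \<bar>f (h \<otimes> x)\<bar> powr p) = (\<Sum>h\<in>(\<lambda>h. h \<otimes> x) ` H. \<bar>f h\<bar> powr p)"
    by (simp add: sum.reindex)
  also have "\<dots> \<le> C" by (rule p_sum_leD[OF assms(1)]) (use H assms(2) in auto)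
  finally show "(\<Sum>h\<in>H. \<bar>f (h \<otimes> x)\<bar> powr p) \<le> C" .
qed

text \<open>If two powers agreed, some \<open>s [^] k\<close> with \<open>k > 0\<close> would be
  trivial and the orbit of \<open>w\<close> would return to \<open>w\<close> along the multiples of
  \<open>k\<close>, whereas it converges to \<open>c\<close>.\<close>

lemma north_south_pow_inj:
  assumes "s \<in> carrier \<Gamma>" "north_south (\<phi> s) c d" "w \<notin> {c, d}"
  shows "inj (\<lambda>n::nat. s [^] n)"
proof (rule linorder_injI)
  fix i j :: nat assume ij: "i < j"
  show "s [^] i \<noteq> s [^] j"
  proof
    assume e: "s [^] i = s [^] j"
    define k where "k = j - i"
    have ik: "i + k = j" using ij by (simp add: k_def)
    have "s [^] i \<otimes> s [^] k = s [^] j" using assms(1) by (simp add: nat_pow_mult ik)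
    then have "s [^] i \<otimes> s [^] k = s [^] i \<otimes> \<one>" using e assms(1) by simp
    then have k: "s [^] k = \<one>" using assms(1) by simp
    have "filterlim (\<lambda>n. k * n) at_top sequentially"
      using ij by (intro filterlim_subseq strict_monoI) (simp add: k_def)
    moreover have "(\<lambda>n. \<phi> (s [^] (n::nat)) w) \<longlonglongrightarrow> c"
      by (rule north_south_attract) (use assms in auto)
    ultimately have "(\<lambda>n. \<phi> (s [^] (k * n)) w) \<longlonglongrightarrow> c"
      by (rule filterlim_compose[rotated])
    moreover have "\<phi> (s [^] (k * n)) w = w" for n
      using assms(1) k by (simp add: nat_pow_pow[symmetric] act_one)
    ultimately have "w = c" by (simp add: LIMSEQ_const_iff)
    then show False using assms(3) by simp
  qed
qed

text \<open>An equivariant 1-cochain is determined by its values at \<open>\<one>\<close>.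
  \<open>\<beta> x y\<close> and \<open>\<psi> x y\<close> stand for such values, and the value at
  \<open>h\<close> is recovered by replacing \<open>x\<close>, \<open>y\<close> with
  \<open>h \<otimes> x\<close>, \<open>h \<otimes> y\<close>. Note that \<open>bdd\<close> asks for
  one constant for all pairs, \<open>lp\<close> for one constant per pair.\<close>

lemma cocycle_rigidity:
  fixes X :: "'x \<Rightarrow> 'x \<Rightarrow> real" and \<beta> \<psi> :: "'g \<Rightarrow> 'g \<Rightarrow> real"
  assumes count: "countable (carrier \<Gamma>)" and p: "0 < p"
    and s: "s \<in> carrier \<Gamma>" "north_south (\<phi> s) c d"
    and g: "g \<in> carrier \<Gamma>" "north_south (\<phi> g) a b"
    and ne: "a \<noteq> c" "a \<noteq> d" "b \<noteq> c" "b \<noteq> d"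
    and X0: "\<And>x. X x x = 0"
    and X: "\<And>f g l k. f \<longlonglongrightarrow> l \<Longrightarrow> g \<longlonglongrightarrow> k \<Longrightarrow> (\<lambda>n::nat. X (f n) (g n)) \<longlonglongrightarrow> X l k"
    and dec: "\<And>x y. x \<in> carrier \<Gamma> \<Longrightarrow> y \<in> carrier \<Gamma> \<Longrightarrow> X (\<phi> x c) (\<phi> y c) = \<beta> x y + \<psi> x y"
    and bdd: "\<And>x y. x \<in> carrier \<Gamma> \<Longrightarrow> y \<in> carrier \<Gamma> \<Longrightarrow>
        p_sum_le (carrier \<Gamma>) p (\<lambda>h. \<beta> (h \<otimes> x) (h \<otimes> y)) B"
    and coc: "\<And>x y z. x \<in> carrier \<Gamma> \<Longrightarrow> y \<in> carrier \<Gamma> \<Longrightarrow> z \<in> carrier \<Gamma> \<Longrightarrow> \<psi> x y + \<psi> y z = \<psi> x z"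
    and lp: "\<And>x y. x \<in> carrier \<Gamma> \<Longrightarrow> y \<in> carrier \<Gamma> \<Longrightarrow>
        \<exists>C. p_sum_le (carrier \<Gamma>) p (\<lambda>h. \<psi> (h \<otimes> x) (h \<otimes> y)) C"
  shows "X b c + X d a = X b a"
proof -
  have cd: "c \<noteq> d" and ab: "a \<noteq> b" using s g by (auto simp: north_south_def)
  have sn [simp]: "s [^] (n::nat) \<in> carrier \<Gamma>" "g [^] n \<in> carrier \<Gamma>" for n using s g by auto
  have inj: "inj (\<lambda>n::nat. s [^] n)" by (rule north_south_pow_inj[OF s, of a]) (use ne in auto)
  have injl: "inj (\<lambda>n::nat. x \<otimes> s [^] n)" if x: "x \<in> carrier \<Gamma>" for x
  proof (rule injI)
    fix m n :: nat assume "x \<otimes> s [^] m = x \<otimes> s [^] n"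
    then have "s [^] m = s [^] n" using x Units_l_cancel[of x "s [^] m" "s [^] n"] by simp
    then show "m = n" using injD[OF inj, of m n] by simp
  qed
  have injr: "inj (\<lambda>n::nat. x \<otimes> inv (s [^] n) \<otimes> y)" if x: "x \<in> carrier \<Gamma>" "y \<in> carrier \<Gamma>" for x y
  proof (rule injI)
    fix m n :: nat assume "x \<otimes> inv (s [^] m) \<otimes> y = x \<otimes> inv (s [^] n) \<otimes> y"
    then have "inv (s [^] m) = inv (s [^] n)"
      using x Units_l_cancel[of x "inv (s [^] m)" "inv (s [^] n)"] by simp
    then have "s [^] m = s [^] n" using inj_onD[OF inv_inj, of "s [^] m" "s [^] n"] by simp
    then show "m = n" using injD[OF inj, of m n] by simp
  qed
  \<comment> \<open>As \<open>s\<close> fixes \<open>c\<close>, \<open>X\<close> vanishes on the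
    pair belonging to \<open>h\<close> and \<open>h \<otimes> s [^] n\<close>; so \<open>V n\<close>
    is the negative of a value of \<open>\<beta>\<close> and obeys the bound \<open>B\<close> for
    every \<open>n\<close>.\<close>
  define V where "V n h = \<psi> h (h \<otimes> s [^] n)" for n :: nat and h
  have Vb: "p_sum_le (carrier \<Gamma>) p (V n) B" for n
  proof -
    have e: "V n h = - \<beta> h (h \<otimes> s [^] n)" if "h \<in> carrier \<Gamma>" for h
      using dec[of h "h \<otimes> s [^] n"] that north_south_fix(1)[OF s, of n] by (simp add: V_def act_mult X0)
    have "p_sum_le (carrier \<Gamma>) p (\<lambda>h. \<beta> (h \<otimes> \<one>) (h \<otimes> s [^] n)) B" by (rule bdd) auto
    then show ?thesis by (rule p_sum_le_cong) (simp add: e)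
  qed
  have Vn: "norm (V n h) \<le> B powr (1 / p)" if "h \<in> carrier \<Gamma>" for n h
  proof -
    have "(\<bar>V n h\<bar> powr p) powr (1 / p) \<le> B powr (1 / p)"
      using p p_sum_le_point[OF Vb that] by (intro powr_mono2) auto
    then show ?thesis using p by (simp add: powr_powr)
  qed
  obtain k :: "nat \<Rightarrow> nat" where k: "strict_mono k"
    and kl: "\<forall>h\<in>carrier \<Gamma>. \<exists>l. (\<lambda>n::nat. V (k n) h) \<longlonglongrightarrow> l"
  proof (rule function_convergent_subsequence[OF count, where f = V and M = "B powr (1 / p)"])
    fix k :: "nat \<Rightarrow> nat"
    assume "strict_mono k" "\<And>h. h \<in> carrier \<Gamma> \<Longrightarrow> \<exists>l. (\<lambda>n::nat. V (k n) h) \<longlonglongrightarrow> l"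
    then show thesis by (intro that ballI)
  qed (rule Vn)
  define L where "L h = lim (\<lambda>n::nat. V (k n) h)" for h
  have L: "(\<lambda>n::nat. V (k n) h) \<longlonglongrightarrow> L h" if "h \<in> carrier \<Gamma>" for h
    unfolding L_def using bspec[OF kl that] by (simp add: convergent_LIMSEQ_iff[symmetric] convergent_def)
  have Lb: "p_sum_le (carrier \<Gamma>) p L B" by (rule p_sum_le_limit[OF p Vb L])
  \<comment> \<open>The path from \<open>h\<close> to
    \<open>h \<otimes> s [^] k n \<otimes> s\<close> is split after \<open>s [^] k n\<close> and
    after \<open>s\<close>. In the first splitting the last piece tends to zero, since
    \<open>h \<otimes> s [^] k n\<close> leaves every finite set.\<close>
  have Ls: "\<psi> h (h \<otimes> s) = L h - L (h \<otimes> s)" if h: "h \<in> carrier \<Gamma>" for h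
  proof -
    obtain C where C: "p_sum_le (carrier \<Gamma>) p (\<lambda>h. \<psi> (h \<otimes> \<one>) (h \<otimes> s)) C"
      using lp[of \<one> s] s by auto
    have "(\<lambda>n::nat. \<psi> (h \<otimes> s [^] n \<otimes> \<one>) (h \<otimes> s [^] n \<otimes> s)) \<longlonglongrightarrow> 0"
      by (rule p_sum_le_tendsto_0[OF p C injl[OF h]]) (use h in auto)
    then have "(\<lambda>n::nat. \<psi> (h \<otimes> s [^] k n \<otimes> \<one>) (h \<otimes> s [^] k n \<otimes> s)) \<longlonglongrightarrow> 0"
      using LIMSEQ_subseq_LIMSEQ[OF _ k] by (fastforce simp: comp_def)
    then have "(\<lambda>n::nat. V (k n) h + \<psi> (h \<otimes> s [^] k n \<otimes> \<one>) (h \<otimes> s [^] k n \<otimes> s) - \<psi> h (h \<otimes> s))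
        \<longlonglongrightarrow> L h + 0 - \<psi> h (h \<otimes> s)"
      by (intro tendsto_intros L h)
    moreover have "V (k n) h + \<psi> (h \<otimes> s [^] k n \<otimes> \<one>) (h \<otimes> s [^] k n \<otimes> s) - \<psi> h (h \<otimes> s) = V (k n) (h \<otimes> s)" for n
    proof -
      have "h \<otimes> s [^] k n \<otimes> s = h \<otimes> s \<otimes> s [^] k n"
        using h s(1) by (simp add: m_assoc nat_pow_comm[of s "k n" 1, simplified])
      then show ?thesis
        using coc[of h "h \<otimes> s [^] k n" "h \<otimes> s [^] k n \<otimes> s"] coc[of h "h \<otimes> s" "h \<otimes> s \<otimes> s [^] k n"] h s(1)
        by (simp add: V_def)
    qed
    ultimately have "(\<lambda>n::nat. V (k n) (h \<otimes> s)) \<longlonglongrightarrow> L h - \<psi> h (h \<otimes> s)" by simp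
    then have "L (h \<otimes> s) = L h - \<psi> h (h \<otimes> s)" using L[of "h \<otimes> s"] h s(1) LIMSEQ_unique by blast
    then show ?thesis by simp
  qed
  \<comment> \<open>\<open>\<psi>\<close> normalised by a bounded coboundary so as to be invariant under \<open>s\<close> from the right\<close>
  define N where "N x y = \<psi> x y + L y - L x" for x y
  define E where "E x y = \<beta> x y - L y + L x" for x y
  have XEN: "X (\<phi> x c) (\<phi> y c) = E x y + N x y" if "x \<in> carrier \<Gamma>" "y \<in> carrier \<Gamma>" for x y
    using dec[OF that] by (simp add: E_def N_def)
  have Ncoc: "N x z = N x y + N y z" if "x \<in> carrier \<Gamma>" "y \<in> carrier \<Gamma>" "z \<in> carrier \<Gamma>" for x y z
    using coc[OF that] by (simp add: N_def)
  have Ns: "N x (x \<otimes> s [^] n) = 0" if x: "x \<in> carrier \<Gamma>" for x and n :: nat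
  proof (induction n)
    case 0
    then show ?case using x coc[of x x x] by (simp add: N_def)
  next
    case (Suc n)
    have "N (x \<otimes> s [^] n) (x \<otimes> s [^] n \<otimes> s) = 0"
      using Ls[of "x \<otimes> s [^] n"] x by (simp add: N_def)
    then show ?case
      using Suc Ncoc[of x "x \<otimes> s [^] n" "x \<otimes> s [^] n \<otimes> s"] x s(1) by (simp add: m_assoc)
  qed
  define B' where "B' = 2 powr p * (B + 2 powr p * (B + B))"
  have Lt: "p_sum_le (carrier \<Gamma>) p (\<lambda>h. L (h \<otimes> x)) B" "p_sum_le (carrier \<Gamma>) p (\<lambda>h. - L (h \<otimes> x)) B"
    if "x \<in> carrier \<Gamma>" for x
    using p_sum_le_translate[OF Lb that] by (simp_all add: p_sum_le_def)
  have LL: "p_sum_le (carrier \<Gamma>) p (\<lambda>h. L (h \<otimes> y) + - L (h \<otimes> x)) (2 powr p * (B + B))"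
    if "x \<in> carrier \<Gamma>" "y \<in> carrier \<Gamma>" for x y
    by (intro p_sum_le_add p Lt that)
  have Eb: "p_sum_le (carrier \<Gamma>) p (\<lambda>h. E (h \<otimes> x) (h \<otimes> y)) B'"
    if "x \<in> carrier \<Gamma>" "y \<in> carrier \<Gamma>" for x y
    using p_sum_le_add[OF p bdd[OF that] LL[OF that(2,1)]] by (simp add: E_def B'_def algebra_simps)
  have Ninf: "(\<lambda>n::nat. N (k n \<otimes> x) (k n \<otimes> y)) \<longlonglongrightarrow> 0"
    if xy: "x \<in> carrier \<Gamma>" "y \<in> carrier \<Gamma>" and k: "inj k" "range k \<subseteq> carrier \<Gamma>" for x y and k :: "nat \<Rightarrow> 'g"
  proof -
    obtain C where C: "p_sum_le (carrier \<Gamma>) p (\<lambda>h. \<psi> (h \<otimes> x) (h \<otimes> y)) C" using lp[OF xy] by blast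
    have "p_sum_le (carrier \<Gamma>) p (\<lambda>h. N (h \<otimes> x) (h \<otimes> y)) (2 powr p * (C + 2 powr p * (B + B)))"
      using p_sum_le_add[OF p C LL[OF xy]] by (simp add: N_def algebra_simps)
    then show ?thesis by (rule p_sum_le_tendsto_0[OF p _ k])
  qed
  \<comment> \<open>One \<open>f\<close> serves all of \<open>K\<close>. The condition
    \<open>\<phi> f c \<noteq> c\<close> ensures that inverse powers of \<open>s\<close> push
    \<open>\<phi> (inv f) c\<close> to \<open>d\<close>.\<close>
  define \<S> where "\<S> = {\<Sum>h\<in>K. \<bar>E h (h \<otimes> f)\<bar> powr p |K f. finite K \<and> K \<subseteq> carrier \<Gamma> \<and> f \<in> carrier \<Gamma> \<and> \<phi> f c \<noteq> c}"
  have Sb: "t \<le> B'" if "t \<in> \<S>" for t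
  proof -
    obtain K f where K: "finite K" "K \<subseteq> carrier \<Gamma>" "f \<in> carrier \<Gamma>" and t: "t = (\<Sum>h\<in>K. \<bar>E h (h \<otimes> f)\<bar> powr p)"
      using \<open>t \<in> \<S>\<close> unfolding \<S>_def by blast
    have "(\<Sum>h\<in>K. \<bar>E (h \<otimes> \<one>) (h \<otimes> f)\<bar> powr p) \<le> B'" by (rule p_sum_leD[OF Eb]) (use K in auto)
    also have "(\<Sum>h\<in>K. \<bar>E (h \<otimes> \<one>) (h \<otimes> f)\<bar> powr p) = t"
      unfolding t using K by (intro sum.cong refl) auto
    finally show ?thesis .
  qed
  have bddS: "bdd_above \<S>" using Sb by (rule bdd_aboveI)
  have "\<phi> g c \<noteq> c" using north_south_fixed[OF g(2), of c] ne by auto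
  then have "(\<Sum>h\<in>{}. \<bar>E h (h \<otimes> g)\<bar> powr p) \<in> \<S>" unfolding \<S>_def using g(1) by blast
  then have neS: "\<S> \<noteq> {}" by blast
  \<comment> \<open>If the sides differed, a nearly optimal sum \<open>t\<close> could be improved:
    replacing \<open>f\<close> by \<open>F n\<close> hardly changes the terms over \<open>K\<close>,
    while the new element \<open>k n\<close> adds almost \<open>D\<close>. The total would exceed
    the supremum.\<close>
  have key: "X (\<phi> h' d) (\<phi> (h' \<otimes> f') c) = N h' (h' \<otimes> f')"
    if h': "h' \<in> carrier \<Gamma>" and f': "f' \<in> carrier \<Gamma>" "\<phi> f' c \<noteq> d" for h' f'
  proof (rule ccontr)
    assume nk: "\<not> ?thesis"
    define D where "D = \<bar>X (\<phi> h' d) (\<phi> (h' \<otimes> f') c) - N h' (h' \<otimes> f')\<bar> powr p"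
    have D: "0 < D" using nk by (simp add: D_def)
    then obtain t where t: "t \<in> \<S>" "Sup \<S> - D < t" using less_cSupE[of "Sup \<S> - D" \<S>] neS by auto
    obtain K f where K: "finite K" "K \<subseteq> carrier \<Gamma>" and f: "f \<in> carrier \<Gamma>" "\<phi> f c \<noteq> c"
      and tK: "t = (\<Sum>h\<in>K. \<bar>E h (h \<otimes> f)\<bar> powr p)"
      using \<open>t \<in> \<S>\<close> unfolding \<S>_def by blast
    \<comment> \<open>\<open>k n\<close> is chosen so that \<open>k n \<otimes> F n\<close> is
      \<open>h' \<otimes> f'\<close> for every \<open>n\<close>: in the limit it sees only the
      factor \<open>f'\<close>, while the elements of \<open>K\<close> see only
      \<open>f\<close>.\<close>
    define F where "F n = f \<otimes> s [^] n \<otimes> f'" for n :: nat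
    define k where "k n = h' \<otimes> inv (s [^] n) \<otimes> inv f" for n :: nat
    have Fc: "F n \<in> carrier \<Gamma>" and kc: "k n \<in> carrier \<Gamma>" for n
      using h' f' f s by (simp_all add: F_def k_def)
    have kF: "k n \<otimes> F n = h' \<otimes> f'" for n
      using h' f' f s by (simp add: F_def k_def m_assoc inv_solve_left')
    have sf': "(\<lambda>n::nat. \<phi> (s [^] n) (\<phi> f' c)) \<longlonglongrightarrow> c"
      by (rule north_south_attract[OF s f'(2)])
    \<comment> \<open>\<open>N\<close> from \<open>h\<close> to \<open>h \<otimes> F n\<close>
      consists of a part over \<open>f\<close>, a part over \<open>s [^] n\<close> that is zero, and
      a part over \<open>f'\<close> that starts ever farther away and tends to zero.
      \<open>X\<close> converges because \<open>s [^] n\<close> attracts \<open>\<phi> f' c\<close>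
      to \<open>c\<close>.\<close>
    have lim1: "(\<lambda>n::nat. E h (h \<otimes> F n)) \<longlonglongrightarrow> E h (h \<otimes> f)" if h: "h \<in> carrier \<Gamma>" for h
    proof -
      have "inj (\<lambda>n::nat. h \<otimes> f \<otimes> s [^] n)" using h f by (intro injl) auto
      then have "(\<lambda>n::nat. N (h \<otimes> f \<otimes> s [^] n \<otimes> \<one>) (h \<otimes> f \<otimes> s [^] n \<otimes> f')) \<longlonglongrightarrow> 0"
        using h f f' by (intro Ninf) auto
      moreover have "(\<lambda>n::nat. X (\<phi> h c) (\<phi> h (\<phi> f (\<phi> (s [^] n) (\<phi> f' c))))) \<longlonglongrightarrow> X (\<phi> h c) (\<phi> h (\<phi> f c))"
        using h f by (intro X act_tendsto sf' tendsto_const)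
      ultimately have "(\<lambda>n::nat. X (\<phi> h c) (\<phi> h (\<phi> f (\<phi> (s [^] n) (\<phi> f' c)))) - N h (h \<otimes> f) -
          N (h \<otimes> f \<otimes> s [^] n \<otimes> \<one>) (h \<otimes> f \<otimes> s [^] n \<otimes> f')) \<longlonglongrightarrow> X (\<phi> h c) (\<phi> h (\<phi> f c)) - N h (h \<otimes> f) - 0"
        by (intro tendsto_intros)
      moreover have "X (\<phi> h c) (\<phi> h (\<phi> f c)) - N h (h \<otimes> f) - 0 = E h (h \<otimes> f)"
        using XEN[of h "h \<otimes> f"] h f by (simp add: act_mult)
      moreover have "X (\<phi> h c) (\<phi> h (\<phi> f (\<phi> (s [^] n) (\<phi> f' c)))) - N h (h \<otimes> f) -
          N (h \<otimes> f \<otimes> s [^] n \<otimes> \<one>) (h \<otimes> f \<otimes> s [^] n \<otimes> f') = E h (h \<otimes> F n)" for n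
        using XEN[of h "h \<otimes> F n"] Ncoc[of h "h \<otimes> f" "h \<otimes> F n"] Ns[of "h \<otimes> f" n]
          Ncoc[of "h \<otimes> f" "h \<otimes> f \<otimes> s [^] n" "h \<otimes> F n"] h f f' Fc[of n] s(1)
        by (simp add: act_mult F_def m_assoc)
      ultimately show ?thesis by simp
    qed
    \<comment> \<open>Now the part of \<open>N\<close> over \<open>f\<close> is the one that
      escapes, and \<open>\<phi> (k n) c\<close> converges to \<open>\<phi> h' d\<close>; this is
      how the repelling point \<open>d\<close> enters.\<close>
    have lim2: "(\<lambda>n::nat. E (k n) (h' \<otimes> f')) \<longlonglongrightarrow> X (\<phi> h' d) (\<phi> (h' \<otimes> f') c) - N h' (h' \<otimes> f')"
    proof -
      have fc: "\<phi> (inv f) c \<noteq> c" using f by (metis act_inv_right)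
      have "inj (\<lambda>n::nat. h' \<otimes> inv (s [^] n))" using injr[OF h' one_closed] h' s(1) by simp
      then have "(\<lambda>n::nat. N (h' \<otimes> inv (s [^] n) \<otimes> inv f) (h' \<otimes> inv (s [^] n) \<otimes> \<one>)) \<longlonglongrightarrow> 0"
        using h' f by (intro Ninf) auto
      moreover have "(\<lambda>n::nat. X (\<phi> h' (\<phi> (inv (s [^] n)) (\<phi> (inv f) c))) (\<phi> (h' \<otimes> f') c)) \<longlonglongrightarrow>
          X (\<phi> h' d) (\<phi> (h' \<otimes> f') c)"
        using h' by (intro X act_tendsto north_south_repel[OF s fc] tendsto_const)
      ultimately have "(\<lambda>n::nat. X (\<phi> h' (\<phi> (inv (s [^] n)) (\<phi> (inv f) c))) (\<phi> (h' \<otimes> f') c) -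
          N (h' \<otimes> inv (s [^] n) \<otimes> inv f) (h' \<otimes> inv (s [^] n) \<otimes> \<one>) - N h' (h' \<otimes> f')) \<longlonglongrightarrow>
          X (\<phi> h' d) (\<phi> (h' \<otimes> f') c) - 0 - N h' (h' \<otimes> f')"
        by (intro tendsto_intros)
      moreover have "X (\<phi> h' (\<phi> (inv (s [^] n)) (\<phi> (inv f) c))) (\<phi> (h' \<otimes> f') c) -
          N (h' \<otimes> inv (s [^] n) \<otimes> inv f) (h' \<otimes> inv (s [^] n) \<otimes> \<one>) - N h' (h' \<otimes> f') = E (k n) (h' \<otimes> f')" for n
        using XEN[of "k n" "h' \<otimes> f'"] Ncoc[of "k n" "h' \<otimes> inv (s [^] n)" "h' \<otimes> f'"]
          Ncoc[of "h' \<otimes> inv (s [^] n)" h' "h' \<otimes> f'"] Ns[of "h' \<otimes> inv (s [^] n)" n] h' f f' s(1) kc[of n]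
        by (simp add: k_def act_mult m_assoc)
      ultimately show ?thesis by simp
    qed
    have "(\<lambda>n::nat. (\<Sum>h\<in>K. \<bar>E h (h \<otimes> F n)\<bar> powr p) + \<bar>E (k n) (h' \<otimes> f')\<bar> powr p) \<longlonglongrightarrow> t + D"
      unfolding tK D_def using K p
      by (intro tendsto_add tendsto_sum tendsto_powr' tendsto_rabs lim1 lim2 tendsto_const) auto
    moreover have "eventually (\<lambda>n::nat. (\<Sum>h\<in>K. \<bar>E h (h \<otimes> F n)\<bar> powr p) + \<bar>E (k n) (h' \<otimes> f')\<bar> powr p \<le> Sup \<S>) sequentially"
    proof -
      have injk: "inj k" using injr[OF h', of "inv f"] f unfolding k_def by simp
      have "finite (k -` K)" using injk K(1) by (simp add: finite_vimageI)
      then have "eventually (\<lambda>n::nat. n \<notin> k -` K) sequentially"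
        by (simp add: cofinite_eq_sequentially[symmetric] eventually_cofinite vimage_def)
      moreover have "eventually (\<lambda>n::nat. \<phi> (F n) c \<noteq> c) sequentially"
      proof -
        have "(\<lambda>n::nat. \<phi> f (\<phi> (s [^] n) (\<phi> f' c))) \<longlonglongrightarrow> \<phi> f c" using f by (intro act_tendsto sf')
        then have "(\<lambda>n::nat. \<phi> (F n) c) \<longlonglongrightarrow> \<phi> f c" using f f' s(1) by (simp add: F_def act_mult)
        then show ?thesis using f(2) by (rule tendsto_imp_eventually_ne)
      qed
      ultimately show ?thesis
      proof eventually_elim
        case (elim n)
        have "(\<Sum>h\<in>K. \<bar>E h (h \<otimes> F n)\<bar> powr p) + \<bar>E (k n) (h' \<otimes> f')\<bar> powr p =
            (\<Sum>h\<in>insert (k n) K. \<bar>E h (h \<otimes> F n)\<bar> powr p)"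
          using elim K by (simp add: kF)
        also have "\<dots> \<in> \<S>" unfolding \<S>_def using elim K kc Fc by blast
        finally show ?case using bddS by (rule cSup_upper)
      qed
    qed
    ultimately have "t + D \<le> Sup \<S>" by (rule tendsto_upperbound) simp
    then show False using t by simp
  qed
  have gc: "(\<lambda>m. \<phi> (g [^] (m::nat)) c) \<longlonglongrightarrow> a" by (rule north_south_attract[OF g]) (use ne in auto)
  have gd: "(\<lambda>m. \<phi> (inv (g [^] (m::nat))) d) \<longlonglongrightarrow> b" by (rule north_south_repel[OF g]) (use ne in auto)
  have "eventually (\<lambda>m. \<phi> (g [^] (m::nat)) c \<noteq> d) sequentially"
    using gc ne(2) by (rule tendsto_imp_eventually_ne)
  \<comment> \<open>\<open>key\<close> will be used from \<open>inv (g [^] m)\<close> to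
    \<open>\<one>\<close>, from \<open>\<one>\<close> to \<open>g [^] m\<close>, and from
    \<open>inv (g [^] m)\<close> to \<open>g [^] m\<close>. The last step has
    \<open>f' = g [^] m \<otimes> g [^] m\<close>, whence the condition at
    \<open>m + m\<close>.\<close>
  then have "eventually (\<lambda>m. \<phi> (g [^] (m::nat)) c \<noteq> d \<and> \<phi> (g [^] (m + m)) c \<noteq> d) sequentially"
    unfolding eventually_sequentially by (meson order_trans le_add1)
  then have "eventually (\<lambda>m::nat. X (\<phi> (inv (g [^] m)) d) c + X d (\<phi> (g [^] m) c) =
      X (\<phi> (inv (g [^] m)) d) (\<phi> (g [^] m) c)) sequentially"
  proof eventually_elim
    case (elim m)
    have e: "inv (g [^] m) \<otimes> (g [^] m \<otimes> g [^] m) = g [^] m"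
      using g(1) by (simp add: m_assoc[symmetric])
    have m1: "g [^] m \<otimes> g [^] m \<in> carrier \<Gamma>" "\<phi> (g [^] m \<otimes> g [^] m) c \<noteq> d"
      using elim g(1) by (simp_all add: nat_pow_mult)
    have "X (\<phi> (inv (g [^] m)) d) c = N (inv (g [^] m)) \<one>"
      using key[of "inv (g [^] m)" "g [^] m"] elim g(1) by (simp add: act_one)
    moreover have "X d (\<phi> (g [^] m) c) = N \<one> (g [^] m)"
      using key[of \<one> "g [^] m"] elim g(1) by (simp add: act_one)
    moreover have "X (\<phi> (inv (g [^] m)) d) (\<phi> (g [^] m) c) = N (inv (g [^] m)) (g [^] m)"
      using key[OF _ m1, of "inv (g [^] m)"] g(1) unfolding e by simp
    ultimately show ?case using Ncoc[of "inv (g [^] m)" \<one> "g [^] m"] g(1) by simp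
  qed
  moreover have "(\<lambda>m. X (\<phi> (inv (g [^] (m::nat))) d) c + X d (\<phi> (g [^] m) c)) \<longlonglongrightarrow> X b c + X d a"
    by (intro tendsto_add X gc gd tendsto_const)
  ultimately have "(\<lambda>m. X (\<phi> (inv (g [^] (m::nat))) d) (\<phi> (g [^] m) c)) \<longlonglongrightarrow> X b c + X d a"
    by (rule Lim_transform_eventually[rotated])
  moreover have "(\<lambda>m. X (\<phi> (inv (g [^] (m::nat))) d) (\<phi> (g [^] m) c)) \<longlonglongrightarrow> X b a"
    by (intro X gc gd)
  ultimately show ?thesis by (rule LIMSEQ_unique)
qed

end

section \<open>Localised cochains with values in \<open>l^p\<close>\<close>

context hyperbolic_action
begin

text \<open>As \<open>chi\<close> vanishes on the orbit of \<open>(c, d)\<close>, replacing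
  \<open>c\<close> by \<open>d\<close> in one argument changes the value by a \<open>Phi\<close>,
  whose norm is bounded. So the sum is controlled except for those \<open>h\<close> where the value
  stays nonzero after either replacement, and these form a finite set by
  \<open>finite_pairs\<close>. \<open>Q\<close> collects points where the cut-off has to
  vanish.\<close>

lemma localized_chi:
  fixes a b w :: 'x
  assumes s: "s \<in> carrier \<Gamma>" "north_south (\<phi> s) c d"
    and ab: "a \<noteq> b" and w: "w \<notin> {a, b}" and p: "0 < p"
    and fin: "finite Q" and Q: "a \<notin> Q" "b \<notin> Q"
    and orb: "\<forall>k\<in>carrier \<Gamma>. (\<phi> k c, \<phi> k d) \<noteq> (a, b)"
      "\<forall>k\<in>carrier \<Gamma>. (\<phi> k c, \<phi> k d) \<noteq> (b, a)"
  shows "\<exists>r>0. (\<forall>x\<in>carrier \<Gamma>. \<forall>y\<in>carrier \<Gamma>. \<exists>C.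
        p_sum_le (carrier \<Gamma>) p (\<lambda>h. chi a b r (\<phi> (h \<otimes> x) c) (\<phi> (h \<otimes> y) c)) C) \<and>
     (\<exists>C. \<forall>x y z. p_sum_le (carrier \<Gamma>) p (\<lambda>h. Phi a b r (\<phi> h x) (\<phi> h y) (\<phi> h z)) C) \<and>
     (\<forall>q\<in>Q. bump a r q = 0 \<and> bump b r q = 0)"
proof -
  have cd: "c \<noteq> d" using s by (auto simp: north_south_def)
  obtain r0 where r0: "0 < r0" and main: "\<forall>r. 0 < r \<and> r \<le> r0 \<longrightarrow>
     (\<forall>x x' y y'. x \<noteq> x' \<and> y \<noteq> y' \<longrightarrow>
        finite {h \<in> carrier \<Gamma>. \<phi> h x \<in> ball a r \<and> \<phi> h x' \<in> ball a r \<and> \<phi> h y \<in> ball b r \<and> \<phi> h y' \<in> ball b r}) \<and>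
     (\<exists>C. \<forall>x y z H. finite H \<and> H \<subseteq> carrier \<Gamma> \<longrightarrow>
        (\<Sum>h\<in>H. \<bar>Phi a b r (\<phi> h x) (\<phi> h y) (\<phi> h z)\<bar> powr p) \<le> C)"
    using bounded_cocycle[OF ab w p] by (elim exE conjE) (rule that)
  obtain r1 where r1: "0 < r1" "\<forall>h\<in>carrier \<Gamma>. \<not> (\<phi> h c \<in> ball a r1 \<and> \<phi> h d \<in> ball b r1)"
    using avoid_orbit[OF s ab w orb(1)] by (elim exE conjE) (rule that)
  have w': "w \<notin> {b, a}" using w by auto
  obtain r2 where r2: "0 < r2" "\<forall>h\<in>carrier \<Gamma>. \<not> (\<phi> h c \<in> ball b r2 \<and> \<phi> h d \<in> ball a r2)"
    using avoid_orbit[OF s ab[symmetric] w' orb(2)] by (elim exE conjE) (rule that)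
  \<comment> \<open>\<open>r1\<close> and \<open>r2\<close> keep the orbit of \<open>(c, d)\<close>
    off both orders of \<open>(a, b)\<close>, \<open>dist a b / 2\<close> makes the two balls
    disjoint, and the last distances leave \<open>Q\<close> outside of them.\<close>
  define r where "r = Min (insert r0 (insert r1 (insert r2 (insert (dist a b / 2)
      ((\<lambda>q. dist q a) ` Q \<union> (\<lambda>q. dist q b) ` Q)))))"
  have r: "0 < r" unfolding r_def using r0 r1 r2 ab Q fin by (subst Min_gr_iff) auto
  have rl: "r \<le> r0" "r \<le> r1" "r \<le> r2" "r \<le> dist a b / 2"
    unfolding r_def using fin by (intro Min_le; simp)+
  have rQ: "r \<le> dist q a" "r \<le> dist q b" if "q \<in> Q" for q
    unfolding r_def using fin that by (intro Min_le; simp)+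
  have disj: "\<not> (x \<in> ball a r \<and> x \<in> ball b r)" for x
    using rl(4) dist_triangle2[of a b x] by auto
  have ns: "chi a b r (\<phi> h c) (\<phi> h d) = 0" if "h \<in> carrier \<Gamma>" for h
  proof (rule ccontr)
    assume "chi a b r (\<phi> h c) (\<phi> h d) \<noteq> 0"
    from chi_nonzero[OF r this] show False
      using r1(2) r2(2) that rl by (meson ball_subset_cball subset_ball subsetD)
  qed
  obtain C where C: "\<forall>x y z H. finite H \<and> H \<subseteq> carrier \<Gamma> \<longrightarrow>
        (\<Sum>h\<in>H. \<bar>Phi a b r (\<phi> h x) (\<phi> h y) (\<phi> h z)\<bar> powr p) \<le> C"
    using main[rule_format, OF conjI[OF r rl(1)], THEN conjunct2] by (elim exE) (rule that)
  have PC: "p_sum_le (carrier \<Gamma>) p (\<lambda>h. Phi a b r (\<phi> h x) (\<phi> h y) (\<phi> h z)) C" for x y z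
    using C by (intro p_sum_leI) blast
  have lp: "\<exists>C. p_sum_le (carrier \<Gamma>) p (\<lambda>h. chi a b r (\<phi> (h \<otimes> x) c) (\<phi> (h \<otimes> y) c)) C"
    if xy: "x \<in> carrier \<Gamma>" "y \<in> carrier \<Gamma>" for x y
  proof (cases "\<phi> x c = \<phi> y c")
    case True
    have "p_sum_le (carrier \<Gamma>) p (\<lambda>h. chi a b r (\<phi> (h \<otimes> x) c) (\<phi> (h \<otimes> y) c)) 0"
    proof (rule p_sum_leI)
      fix H assume "finite H" "H \<subseteq> carrier \<Gamma>"
      then have "(\<Sum>h\<in>H. \<bar>chi a b r (\<phi> (h \<otimes> x) c) (\<phi> (h \<otimes> y) c)\<bar> powr p) = (\<Sum>h\<in>H. 0)"
        using xy True by (intro sum.cong refl) (auto simp: act_mult)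
      then show "(\<Sum>h\<in>H. \<bar>chi a b r (\<phi> (h \<otimes> x) c) (\<phi> (h \<otimes> y) c)\<bar> powr p) \<le> 0" by simp
    qed
    then show ?thesis by blast
  next
    case False
    define x0 x1 y0 y1 where "x0 = \<phi> x c" and "x1 = \<phi> x d" and "y0 = \<phi> y c" and "y1 = \<phi> y d"
    have ne: "x0 \<noteq> x1" "y0 \<noteq> y1" using xy cd by (simp_all add: x0_def x1_def y0_def y1_def)
    define S where "S = {h \<in> carrier \<Gamma>. \<phi> h x0 \<in> ball a r \<and> \<phi> h x1 \<in> ball a r \<and> \<phi> h y0 \<in> ball b r \<and> \<phi> h y1 \<in> ball b r} \<union>
       {h \<in> carrier \<Gamma>. \<phi> h y0 \<in> ball a r \<and> \<phi> h y1 \<in> ball a r \<and> \<phi> h x0 \<in> ball b r \<and> \<phi> h x1 \<in> ball b r}"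
    have S: "finite S"
      unfolding S_def using main[rule_format, OF conjI[OF r rl(1)], THEN conjunct1, rule_format] ne by blast
    have ptw: "\<bar>chi a b r (\<phi> h x0) (\<phi> h y0)\<bar> powr p \<le>
        \<bar>Phi a b r (\<phi> h x0) (\<phi> h y0) (\<phi> h x1)\<bar> powr p + \<bar>Phi a b r (\<phi> h x0) (\<phi> h y0) (\<phi> h y1)\<bar> powr p +
        (if h \<in> S then 1 else 0)" if h: "h \<in> carrier \<Gamma>" for h
    proof -
      define f f1 f2 where "f = chi a b r (\<phi> h x0) (\<phi> h y0)" and "f1 = chi a b r (\<phi> h x1) (\<phi> h y0)"
        and "f2 = chi a b r (\<phi> h x0) (\<phi> h y1)"
      have z: "chi a b r (\<phi> h x0) (\<phi> h x1) = 0" "chi a b r (\<phi> h y0) (\<phi> h y1) = 0"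
        using ns[of "h \<otimes> x"] ns[of "h \<otimes> y"] h xy by (simp_all add: x0_def x1_def y0_def y1_def act_mult)
      have P1: "Phi a b r (\<phi> h x0) (\<phi> h y0) (\<phi> h x1) = f - f1"
        using z chi_swap[of a b r "\<phi> h x0" "\<phi> h x1"] chi_swap[of a b r "\<phi> h x1" "\<phi> h y0"]
        by (simp add: Phi_def f_def f1_def)
      have P2: "Phi a b r (\<phi> h x0) (\<phi> h y0) (\<phi> h y1) = f - f2"
        using z chi_swap[of a b r "\<phi> h x0" "\<phi> h y1"] by (simp add: Phi_def f_def f2_def)
      have f_le: "\<bar>f\<bar> powr p \<le> 1"
        using powr_mono2[OF less_imp_le[OF p] abs_ge_zero abs_chi_le[OF r]] by (simp add: f_def)
      \<comment> \<open>Disjointness of the balls forces \<open>x0\<close> and \<open>x1\<close> to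
        be sent into the same ball, and \<open>y0\<close> and \<open>y1\<close> into the
        other.\<close>
      have "h \<in> S" if "f \<noteq> 0" "f1 \<noteq> 0" "f2 \<noteq> 0"
      proof -
        have "\<phi> h x0 \<in> ball a r \<and> \<phi> h y0 \<in> ball b r \<or> \<phi> h x0 \<in> ball b r \<and> \<phi> h y0 \<in> ball a r"
          "\<phi> h x1 \<in> ball a r \<and> \<phi> h y0 \<in> ball b r \<or> \<phi> h x1 \<in> ball b r \<and> \<phi> h y0 \<in> ball a r"
          "\<phi> h x0 \<in> ball a r \<and> \<phi> h y1 \<in> ball b r \<or> \<phi> h x0 \<in> ball b r \<and> \<phi> h y1 \<in> ball a r"
          using that chi_nonzero[OF r] unfolding f_def f1_def f2_def by blast+
        then show ?thesis
          using disj[of "\<phi> h x0"] disj[of "\<phi> h y0"] h unfolding S_def by blast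
      qed
      then consider "f = 0" | "f1 = 0" | "f2 = 0" | "h \<in> S" by blast
      then show ?thesis
        unfolding f_def[symmetric] P1 P2 using p f_le by cases (auto simp: add_increasing add_increasing2)
    qed
    have "p_sum_le (carrier \<Gamma>) p (\<lambda>h. chi a b r (\<phi> h x0) (\<phi> h y0)) (C + C + real (card S))"
    proof (rule p_sum_leI)
      fix H assume H: "finite H" "H \<subseteq> carrier \<Gamma>"
      have "(\<Sum>h\<in>H. \<bar>chi a b r (\<phi> h x0) (\<phi> h y0)\<bar> powr p) \<le>
          (\<Sum>h\<in>H. \<bar>Phi a b r (\<phi> h x0) (\<phi> h y0) (\<phi> h x1)\<bar> powr p + \<bar>Phi a b r (\<phi> h x0) (\<phi> h y0) (\<phi> h y1)\<bar> powr p +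
            (if h \<in> S then 1 else 0))"
        using H by (intro sum_mono ptw) auto
      also have "\<dots> = (\<Sum>h\<in>H. \<bar>Phi a b r (\<phi> h x0) (\<phi> h y0) (\<phi> h x1)\<bar> powr p) +
          (\<Sum>h\<in>H. \<bar>Phi a b r (\<phi> h x0) (\<phi> h y0) (\<phi> h y1)\<bar> powr p) + real (card (H \<inter> S))"
        using H by (simp add: sum.distrib sum.inter_restrict[symmetric])
      also have "\<dots> \<le> C + C + real (card S)"
        using p_sum_leD[OF PC H] S by (intro add_mono) (auto intro: card_mono)
      finally show "(\<Sum>h\<in>H. \<bar>chi a b r (\<phi> h x0) (\<phi> h y0)\<bar> powr p) \<le> C + C + real (card S)" .
    qed
    then have "p_sum_le (carrier \<Gamma>) p (\<lambda>h. chi a b r (\<phi> (h \<otimes> x) c) (\<phi> (h \<otimes> y) c)) (C + C + real (card S))"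
      by (rule p_sum_le_cong) (use xy in \<open>simp add: act_mult x0_def y0_def\<close>)
    then show ?thesis by blast
  qed
  have "bump a r q = 0 \<and> bump b r q = 0" if "q \<in> Q" for q
    using rQ[OF that] r by (auto simp: bump_eq_0_iff dist_commute)
  then show ?thesis using r lp PC by blast
qed

end

section \<open>Cohomology as a vector space\<close>

definition linear_family :: "'g cochain set \<Rightarrow> bool" where
  "linear_family W \<longleftrightarrow> (\<lambda>_ _. 0) \<in> W \<and>
     (\<forall>a\<in>W. \<forall>b\<in>W. \<forall>r t. (\<lambda>xs h. r * a xs h + t * b xs h) \<in> W)"

lemma linear_family_zero: "linear_family W \<Longrightarrow> (\<lambda>_ _. 0) \<in> W"
  by (simp add: linear_family_def)

lemma linear_family_comb:
  assumes "linear_family W" "a \<in> W" "b \<in> W" "\<And>xs h. c xs h = r * a xs h + t * b xs h"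
  shows "c \<in> W"
proof -
  have "c = (\<lambda>xs h. r * a xs h + t * b xs h)" using assms(4) by (intro ext)
  then show ?thesis using assms(1-3) by (simp add: linear_family_def)
qed

lemma linear_family_Int: "linear_family V \<Longrightarrow> linear_family W \<Longrightarrow> linear_family (V \<inter> W)"
  by (simp add: linear_family_def)

lemma linear_family_sum:
  assumes "linear_family W" "finite I" "\<forall>i\<in>I. z i \<in> W"
  shows "(\<lambda>xs h. \<Sum>i\<in>I. r i * z i xs h) \<in> W"
  using assms(2,3)
proof (induction I rule: finite_induct)
  case empty
  then show ?case using linear_family_zero[OF assms(1)] by simp
next
  case (insert i I)
  show ?case
    by (rule linear_family_comb[OF assms(1), of "z i" "\<lambda>xs h. \<Sum>i\<in>I. r i * z i xs h" _ "r i" 1])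
      (use insert in auto)
qed

text \<open>A coset does not depend on the carrier of the ambient module. Fixing \<open>UNIV\<close>
  lets cosets formed in the modules of bounded and of ordinary cocycles be compared
  directly.\<close>

definition coset_class :: "'g cochain set \<Rightarrow> 'g cochain \<Rightarrow> 'g cochain set" where
  "coset_class W c = a_r_coset (cochain_module UNIV) W c"

lemma a_r_coset_cochain_module: "a_r_coset (cochain_module A) W c = coset_class W c"
  by (simp add: coset_class_def a_r_coset_def' cochain_module_def)

lemma coset_class_mem: "u \<in> coset_class W c \<longleftrightarrow> (\<lambda>xs h. u xs h - c xs h) \<in> W"
proof
  assume "u \<in> coset_class W c"
  then obtain w where "w \<in> W" "u = (\<lambda>xs h. w xs h + c xs h)"
    by (auto simp: coset_class_def a_r_coset_def' cochain_module_def)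
  then show "(\<lambda>xs h. u xs h - c xs h) \<in> W" by simp
next
  assume w: "(\<lambda>xs h. u xs h - c xs h) \<in> W"
  have "u = (\<lambda>xs h. (u xs h - c xs h) + c xs h)" by (intro ext) simp
  then show "u \<in> coset_class W c"
    using w by (auto simp: coset_class_def a_r_coset_def' cochain_module_def
        intro!: bexI[of _ "\<lambda>xs h. u xs h - c xs h"])
qed

lemma coset_class_self: "linear_family W \<Longrightarrow> c \<in> coset_class W c"
  by (simp add: coset_class_mem linear_family_zero)

lemma coset_class_eq_iff:
  assumes W: "linear_family W"
  shows "coset_class W c = coset_class W d \<longleftrightarrow> (\<lambda>xs h. c xs h - d xs h) \<in> W"
proof
  assume "coset_class W c = coset_class W d"
  then have "c \<in> coset_class W d" using coset_class_self[OF W, of c] by simp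
  then show "(\<lambda>xs h. c xs h - d xs h) \<in> W" by (simp add: coset_class_mem)
next
  assume cd: "(\<lambda>xs h. c xs h - d xs h) \<in> W"
  show "coset_class W c = coset_class W d"
  proof (rule Set.set_eqI, unfold coset_class_mem, rule iffI)
    fix u assume "(\<lambda>xs h. u xs h - c xs h) \<in> W"
    then show "(\<lambda>xs h. u xs h - d xs h) \<in> W"
      by (rule linear_family_comb[OF W _ cd, where r = 1 and t = 1]) simp
  next
    fix u assume "(\<lambda>xs h. u xs h - d xs h) \<in> W"
    then show "(\<lambda>xs h. u xs h - c xs h) \<in> W"
      by (rule linear_family_comb[OF W _ cd, where r = 1 and t = "-1"]) simp
  qed
qed

lemma coset_class_zero: "coset_class W (\<lambda>_ _. 0) = W"
  by (rule Set.set_eqI) (simp add: coset_class_mem)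

lemma coset_class_add:
  assumes W: "linear_family W"
  shows "set_add (cochain_module A) (coset_class W c) (coset_class W d) =
    coset_class W (\<lambda>xs h. c xs h + d xs h)"
proof (rule Set.set_eqI, rule iffI)
  fix u assume "u \<in> set_add (cochain_module A) (coset_class W c) (coset_class W d)"
  then obtain a b where a: "a \<in> coset_class W c" and b: "b \<in> coset_class W d"
    and u: "u = (\<lambda>xs h. a xs h + b xs h)"
    by (auto simp: set_add_def' cochain_module_def)
  show "u \<in> coset_class W (\<lambda>xs h. c xs h + d xs h)"
    unfolding coset_class_mem
    by (rule linear_family_comb[OF W a[unfolded coset_class_mem] b[unfolded coset_class_mem], where r = 1 and t = 1])
      (simp add: u)
next
  fix u assume u: "u \<in> coset_class W (\<lambda>xs h. c xs h + d xs h)"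
  have "(\<lambda>xs h. u xs h - d xs h) \<in> coset_class W c"
    unfolding coset_class_mem
    by (rule linear_family_comb[OF W u[unfolded coset_class_mem] linear_family_zero[OF W], where r = 1 and t = 1]) simp
  moreover have "d \<in> coset_class W d" by (rule coset_class_self[OF W])
  moreover have "u = (\<lambda>xs h. (u xs h - d xs h) + d xs h)" by (intro ext) simp
  ultimately show "u \<in> set_add (cochain_module A) (coset_class W c) (coset_class W d)"
    unfolding set_add_def' cochain_module_def by fastforce
qed

text \<open>The left side is the scalar multiplication of \<open>quotient_module\<close>, a union
  over representatives that all contribute the same coset.\<close>

lemma coset_class_smult:
  assumes W: "linear_family W"
  shows "(\<Union>a\<in>coset_class W c. coset_class W (\<lambda>xs h. r * a xs h)) = coset_class W (\<lambda>xs h. r * c xs h)"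
proof (rule Set.set_eqI, rule iffI)
  fix u assume "u \<in> (\<Union>a\<in>coset_class W c. coset_class W (\<lambda>xs h. r * a xs h))"
  then obtain a where a: "a \<in> coset_class W c" and u: "u \<in> coset_class W (\<lambda>xs h. r * a xs h)" by blast
  show "u \<in> coset_class W (\<lambda>xs h. r * c xs h)"
    unfolding coset_class_mem
    by (rule linear_family_comb[OF W u[unfolded coset_class_mem] a[unfolded coset_class_mem], where r = 1 and t = r])
      (simp add: algebra_simps)
next
  fix u assume "u \<in> coset_class W (\<lambda>xs h. r * c xs h)"
  then show "u \<in> (\<Union>a\<in>coset_class W c. coset_class W (\<lambda>xs h. r * a xs h))"
    using coset_class_self[OF W] by blast
qed

lemma quotient_simps:
  "carrier (quotient_module (cochain_module A) W) = coset_class W ` A"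
  "zero (quotient_module (cochain_module A) W) = coset_class W (\<lambda>_ _. 0)"
  "linear_family W \<Longrightarrow> add (quotient_module (cochain_module A) W) (coset_class W c) (coset_class W d) =
     coset_class W (\<lambda>xs h. c xs h + d xs h)"
  "linear_family W \<Longrightarrow> smult (quotient_module (cochain_module A) W) r (coset_class W c) =
     coset_class W (\<lambda>xs h. r * c xs h)"
proof -
  show "carrier (quotient_module (cochain_module A) W) = coset_class W ` A"
    by (auto simp: quotient_module_def A_RCOSETS_def' a_r_coset_cochain_module)
      (auto simp: cochain_module_def)
  show "zero (quotient_module (cochain_module A) W) = coset_class W (\<lambda>_ _. 0)"
    by (simp add: quotient_module_def coset_class_zero)
  show "linear_family W \<Longrightarrow> add (quotient_module (cochain_module A) W) (coset_class W c) (coset_class W d) =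
     coset_class W (\<lambda>xs h. c xs h + d xs h)"
    by (simp add: quotient_module_def coset_class_add)
  have "smult (cochain_module A) r a = (\<lambda>xs h. r * a xs h)" for a
    by (simp add: cochain_module_def)
  then show "linear_family W \<Longrightarrow> smult (quotient_module (cochain_module A) W) r (coset_class W c) =
     coset_class W (\<lambda>xs h. r * c xs h)"
    by (simp add: quotient_module_def a_r_coset_cochain_module coset_class_smult)
qed

lemma quotient_vectorspace:
  assumes A: "linear_family A" and W: "linear_family W"
  shows "vectorspace class_ring (quotient_module (cochain_module A) W)" (is "vectorspace _ ?Q")
proof -
  note simps = quotient_simps(1,2) quotient_simps(3,4)[OF W]
  have add: "(\<lambda>xs h. c xs h + d xs h) \<in> A" if "c \<in> A" "d \<in> A" for c d
    by (rule linear_family_comb[OF A that, where r = 1 and t = 1]) simp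
  have scale: "(\<lambda>xs h. r * c xs h) \<in> A" if "c \<in> A" for r c
    by (rule linear_family_comb[OF A that that, where r = r and t = 0]) simp
  have "abelian_group ?Q"
  proof (rule abelian_groupI)
    fix X Y assume "X \<in> carrier ?Q" "Y \<in> carrier ?Q"
    then show "X \<oplus>\<^bsub>?Q\<^esub> Y \<in> carrier ?Q" "X \<oplus>\<^bsub>?Q\<^esub> Y = Y \<oplus>\<^bsub>?Q\<^esub> X"
      by (auto simp: simps add add.commute)
  next
    show "\<zero>\<^bsub>?Q\<^esub> \<in> carrier ?Q" using linear_family_zero[OF A] by (simp add: simps)
  next
    fix X Y Z assume "X \<in> carrier ?Q" "Y \<in> carrier ?Q" "Z \<in> carrier ?Q"
    then show "(X \<oplus>\<^bsub>?Q\<^esub> Y) \<oplus>\<^bsub>?Q\<^esub> Z = X \<oplus>\<^bsub>?Q\<^esub> (Y \<oplus>\<^bsub>?Q\<^esub> Z)"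
      by (auto simp: simps add.assoc)
  next
    fix X assume X: "X \<in> carrier ?Q"
    then show "\<zero>\<^bsub>?Q\<^esub> \<oplus>\<^bsub>?Q\<^esub> X = X" by (auto simp: simps)
    obtain c where c: "c \<in> A" "X = coset_class W c" using X by (auto simp: simps)
    have "coset_class W (\<lambda>xs h. (-1) * c xs h) \<oplus>\<^bsub>?Q\<^esub> X = \<zero>\<^bsub>?Q\<^esub>"
      by (simp add: c simps)
    moreover have "coset_class W (\<lambda>xs h. (-1) * c xs h) \<in> carrier ?Q"
      unfolding simps by (rule imageI[OF scale[OF c(1)]])
    ultimately show "\<exists>Y\<in>carrier ?Q. Y \<oplus>\<^bsub>?Q\<^esub> X = \<zero>\<^bsub>?Q\<^esub>" by blast
  qed
  then have "module (class_ring :: real ring) ?Q"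
  proof (rule moduleI[rotated])
    show "cring (class_ring :: real ring)"
      by (rule domain.axioms(1)[OF field.axioms(1)[OF class_field]])
  qed (auto simp: simps scale algebra_simps)
  then show ?thesis
    by (intro vectorspace.intro class_field)
qed

lemma quotient_finsum:
  assumes A: "linear_family A" and W: "linear_family W" and I: "finite I" "\<forall>i\<in>I. z i \<in> A"
  shows "finsum (quotient_module (cochain_module A) W)
      (\<lambda>i. smult (quotient_module (cochain_module A) W) (r i) (coset_class W (z i))) I =
    coset_class W (\<lambda>xs h. \<Sum>i\<in>I. r i * z i xs h)" (is "finsum ?Q ?f I = _")
  using I
proof (induction I rule: finite_induct)
  interpret V: vectorspace class_ring ?Q by (rule quotient_vectorspace[OF A W])
  have scale: "(\<lambda>xs h. r * c xs h) \<in> A" if "c \<in> A" for r c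
    by (rule linear_family_comb[OF A that that, where r = r and t = 0]) simp
  {
    case empty
    show ?case by (simp add: quotient_simps)
  next
    case (insert i I)
    have mem: "?f j \<in> carrier ?Q" if "j \<in> insert i I" for j
    proof -
      have "z j \<in> A" using insert.prems that by auto
      from imageI[OF scale[OF this]] show ?thesis by (simp add: quotient_simps(1) quotient_simps(4)[OF W])
    qed
    have "finsum ?Q ?f (insert i I) = ?f i \<oplus>\<^bsub>?Q\<^esub> finsum ?Q ?f I"
      using insert.hyps mem by (intro V.finsum_insert) auto
    also have "finsum ?Q ?f I = coset_class W (\<lambda>xs h. \<Sum>i\<in>I. r i * z i xs h)"
      using insert by simp
    also have "?f i \<oplus>\<^bsub>?Q\<^esub> \<dots> = coset_class W (\<lambda>xs h. \<Sum>i\<in>insert i I. r i * z i xs h)"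
      using insert.hyps by (simp add: quotient_simps(3,4)[OF W])
    finally show ?case .
  }
qed

text \<open>Linear independence concerns the set of classes, so these must also be pairwise
  distinct; \<open>indep\<close> with coefficients \<open>1\<close> and \<open>- 1\<close> shows it.
  As \<open>indep\<close> admits only nonzero coefficients, a dependence is stripped of its zero
  ones.\<close>

lemma quotient_infinite_dim:
  fixes z :: "nat \<Rightarrow> 'g cochain"
  assumes A: "linear_family A" and W: "linear_family W" and z: "\<forall>i. z i \<in> A"
    and indep: "\<forall>I r. finite I \<and> I \<noteq> {} \<and> (\<forall>i\<in>I. r i \<noteq> 0) \<longrightarrow> (\<lambda>xs h. \<Sum>i\<in>I. r i * z i xs h) \<notin> W"
  shows "\<not> vectorspace.fin_dim class_ring (quotient_module (cochain_module A) W)"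
    (is "\<not> vectorspace.fin_dim _ ?Q")
proof
  assume fd: "vectorspace.fin_dim class_ring ?Q"
  interpret V: vectorspace class_ring ?Q by (rule quotient_vectorspace[OF A W])
  define X where "X i = coset_class W (z i)" for i
  have inj: "inj X"
  proof (rule injI, rule ccontr)
    fix i j assume e: "X i = X j" and ij: "i \<noteq> j"
    define r where "r k = (if k = i then 1 else - 1 :: real)" for k
    have "(\<lambda>xs h. \<Sum>k\<in>{i, j}. r k * z k xs h) \<notin> W"
      by (rule indep[rule_format]) (auto simp: r_def)
    moreover have "(\<lambda>xs h. \<Sum>k\<in>{i, j}. r k * z k xs h) = (\<lambda>xs h. z i xs h - z j xs h)"
      using ij by (intro ext) (simp add: r_def)
    ultimately show False using e by (simp add: X_def coset_class_eq_iff[OF W])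
  qed
  have "V.lin_indpt (range X)"
  proof
    assume "V.lin_dep (range X)"
    then obtain S a v where S: "finite S" "S \<subseteq> range X" and 0: "V.lincomb a S = \<zero>\<^bsub>?Q\<^esub>"
      and v: "v \<in> S" "a v \<noteq> 0"
      unfolding V.lin_dep_def by auto
    define I where "I = X -` S"
    have I: "finite I" "S = X ` I"
      using S inj by (auto simp: I_def finite_vimageI)
    define r where "r i = a (X i)" for i
    have mem: "a (X i) \<odot>\<^bsub>?Q\<^esub> X i \<in> carrier ?Q" for i
    proof -
      have "z i \<in> A" using z by blast
      then have "(\<lambda>xs h. a (X i) * z i xs h) \<in> A"
        by (rule linear_family_comb[OF A _ linear_family_zero[OF A], where r = "a (X i)" and t = 0]) simp
      from imageI[OF this] show ?thesis
        unfolding X_def by (simp add: quotient_simps(1) quotient_simps(4)[OF W])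
    qed
    have "V.lincomb a S = finsum ?Q (\<lambda>i. r i \<odot>\<^bsub>?Q\<^esub> X i) I"
      unfolding V.lincomb_def I(2) r_def
      by (rule V.finsum_reindex) (use mem inj in \<open>auto intro: inj_on_subset\<close>)
    also have "\<dots> = coset_class W (\<lambda>xs h. \<Sum>i\<in>I. r i * z i xs h)"
      unfolding X_def by (rule quotient_finsum[OF A W I(1)]) (use z in blast)
    finally have "coset_class W (\<lambda>xs h. \<Sum>i\<in>I. r i * z i xs h) = coset_class W (\<lambda>_ _. 0)"
      using 0 by (simp add: quotient_simps(2))
    then have "(\<lambda>xs h. \<Sum>i\<in>I. r i * z i xs h) \<in> W"
      unfolding coset_class_eq_iff[OF W] by simp
    moreover have "(\<Sum>i\<in>I. r i * z i xs h) = (\<Sum>i\<in>{i\<in>I. r i \<noteq> 0}. r i * z i xs h)" for xs h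
      using I(1) by (intro sum.mono_neutral_right) auto
    moreover have "(\<lambda>xs h. \<Sum>i\<in>{i\<in>I. r i \<noteq> 0}. r i * z i xs h) \<notin> W"
      by (rule indep[rule_format]) (use I v in \<open>auto simp: r_def\<close>)
    ultimately show False by simp
  qed
  then have "finite (range X)"
    by (rule V.li_le_dim(1)[OF fd, rotated]) (use z in \<open>auto simp: X_def quotient_simps(1)\<close>)
  then show False using inj finite_imageD by blast
qed

text \<open>The kernel consists of the bounded cocycles that bound some cochain, modulo coboundaries
  of bounded cochains. The union in \<open>comparison_map\<close> collapses, since two
  representatives differ by a coboundary.\<close>

lemma comparison_kernel_eq:
  assumes W: "linear_family (coboundaries \<Gamma> (bounded_cochains \<Gamma> p) n)"
    and B: "linear_family (coboundaries \<Gamma> (cochains \<Gamma> p) n)"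
    and sub: "coboundaries \<Gamma> (bounded_cochains \<Gamma> p) n \<subseteq> coboundaries \<Gamma> (cochains \<Gamma> p) n"
  shows "comparison_kernel \<Gamma> p n =
    quotient_module (cochain_module (cocycles \<Gamma> (bounded_cochains \<Gamma> p) n \<inter> coboundaries \<Gamma> (cochains \<Gamma> p) n))
      (coboundaries \<Gamma> (bounded_cochains \<Gamma> p) n)"
proof -
  define Z W B where "Z = cocycles \<Gamma> (bounded_cochains \<Gamma> p) n" and "W = coboundaries \<Gamma> (bounded_cochains \<Gamma> p) n"
    and "B = coboundaries \<Gamma> (cochains \<Gamma> p) n"
  note defs = Z_def[symmetric] W_def[symmetric] B_def[symmetric]
  note W' = W[unfolded defs] and B' = B[unfolded defs] and sub' = sub[unfolded defs]
  have cm: "comparison_map \<Gamma> p n (coset_class W c) = coset_class B c" for c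
  proof -
    have "comparison_map \<Gamma> p n (coset_class W c) = (\<Union>d\<in>coset_class W c. coset_class B d)"
      by (simp add: comparison_map_def a_r_coset_cochain_module defs)
    also have "\<dots> = coset_class B c"
    proof -
      have "coset_class B d = coset_class B c" if "d \<in> coset_class W c" for d
        using that sub' by (auto simp: coset_class_eq_iff[OF B'] coset_class_mem)
      then show ?thesis using coset_class_self[OF W', of c] by blast
    qed
    finally show ?thesis .
  qed
  have Beq: "coset_class B c = B \<longleftrightarrow> c \<in> B" for c
    using coset_class_eq_iff[OF B', of c "\<lambda>_ _. 0"] by (simp add: coset_class_zero)
  have zero: "zero (cohomology \<Gamma> (cochains \<Gamma> p) n) = B"
    by (simp add: cohomology_def quotient_module_def B_def)
  have car: "a_kernel (cohomology \<Gamma> (bounded_cochains \<Gamma> p) n) (cohomology \<Gamma> (cochains \<Gamma> p) n)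
          (comparison_map \<Gamma> p n) = coset_class W ` (Z \<inter> B)"
  proof -
    have "a_kernel (cohomology \<Gamma> (bounded_cochains \<Gamma> p) n) (cohomology \<Gamma> (cochains \<Gamma> p) n)
          (comparison_map \<Gamma> p n) = {X \<in> coset_class W ` Z. comparison_map \<Gamma> p n X = B}"
      unfolding a_kernel_def' zero by (simp add: cohomology_def quotient_simps(1) defs)
    also have "\<dots> = coset_class W ` {c \<in> Z. comparison_map \<Gamma> p n (coset_class W c) = B}" by blast
    also have "\<dots> = coset_class W ` (Z \<inter> B)" unfolding cm Beq by (simp add: Int_def)
    finally show ?thesis .
  qed
  have "comparison_kernel \<Gamma> p n = quotient_module (cochain_module (Z \<inter> B)) W"
    unfolding comparison_kernel_def car
    using quotient_simps(1)[of "Z \<inter> B" W]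
    by (simp add: cohomology_def quotient_module_def defs a_r_coset_cochain_module set_add_def')
       (simp add: cochain_module_def)
  then show ?thesis by (simp add: defs)
qed

section \<open>Cochain spaces in terms of partial sums\<close>

lemma lp_space_iff:
  assumes p: "0 < p"
  shows "f \<in> lp_space \<Gamma> p \<longleftrightarrow> (\<forall>h. h \<notin> carrier \<Gamma> \<longrightarrow> f h = 0) \<and> (\<exists>C. p_sum_le (carrier \<Gamma>) p f C)"
proof -
  have "(\<lambda>h. \<bar>f h\<bar> powr p) summable_on carrier \<Gamma> \<longleftrightarrow> (\<exists>C. p_sum_le (carrier \<Gamma>) p f C)"
  proof
    assume s: "(\<lambda>h. \<bar>f h\<bar> powr p) summable_on carrier \<Gamma>"
    have "p_sum_le (carrier \<Gamma>) p f (\<Sum>\<^sub>\<infinity>h\<in>carrier \<Gamma>. \<bar>f h\<bar> powr p)"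
      by (rule p_sum_leI) (rule finite_sum_le_infsum[OF s], auto)
    then show "\<exists>C. p_sum_le (carrier \<Gamma>) p f C" ..
  next
    assume "\<exists>C. p_sum_le (carrier \<Gamma>) p f C"
    then obtain C where C: "p_sum_le (carrier \<Gamma>) p f C" ..
    show "(\<lambda>h. \<bar>f h\<bar> powr p) summable_on carrier \<Gamma>"
    proof (rule nonneg_bdd_above_summable_on)
      show "bdd_above (sum (\<lambda>h. \<bar>f h\<bar> powr p) ` {F. F \<subseteq> carrier \<Gamma> \<and> finite F})"
        using p_sum_leD[OF C] by (intro bdd_aboveI[of _ C]) auto
    qed simp
  qed
  then show ?thesis by (simp add: lp_space_def)
qed

lemma lp_norm_le_iff_sums:
  assumes p: "0 < p" and f: "f \<in> lp_space \<Gamma> p"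
  shows "p_sum_le (carrier \<Gamma>) p f C \<Longrightarrow> lp_norm \<Gamma> p f \<le> C powr (1 / p)"
    and "lp_norm \<Gamma> p f \<le> B \<Longrightarrow> p_sum_le (carrier \<Gamma>) p f (max 0 B powr p)"
proof -
  let ?I = "\<Sum>\<^sub>\<infinity>h\<in>carrier \<Gamma>. \<bar>f h\<bar> powr p"
  have s: "(\<lambda>h. \<bar>f h\<bar> powr p) summable_on carrier \<Gamma>" using f by (simp add: lp_space_def)
  have I0: "0 \<le> ?I" by (rule infsum_nonneg) simp
  show "lp_norm \<Gamma> p f \<le> C powr (1 / p)" if C: "p_sum_le (carrier \<Gamma>) p f C"
  proof -
    have "?I \<le> C" by (rule infsum_le_finite_sums[OF s]) (rule p_sum_leD[OF C])
    then show ?thesis unfolding lp_norm_def using p I0 by (intro powr_mono2) auto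
  qed
  show "p_sum_le (carrier \<Gamma>) p f (max 0 B powr p)" if B: "lp_norm \<Gamma> p f \<le> B"
  proof (rule p_sum_leI)
    fix H assume H: "finite H" "H \<subseteq> carrier \<Gamma>"
    have "(\<Sum>h\<in>H. \<bar>f h\<bar> powr p) \<le> ?I" by (rule finite_sum_le_infsum[OF s H]) simp
    also have "?I = (?I powr (1 / p)) powr p" using p I0 by (simp add: powr_powr)
    also have "\<dots> \<le> max 0 B powr p"
      using p B unfolding lp_norm_def by (intro powr_mono2) auto
    finally show "(\<Sum>h\<in>H. \<bar>f h\<bar> powr p) \<le> max 0 B powr p" .
  qed
qed

lemma bounded_cochains_iff:
  assumes p: "0 < p"
  shows "c \<in> bounded_cochains \<Gamma> p n \<longleftrightarrow> c \<in> cochains \<Gamma> p n \<and>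
    (\<exists>C. \<forall>xs\<in>tuples \<Gamma> (n + 1). p_sum_le (carrier \<Gamma>) p (c xs) C)"
proof
  assume "c \<in> bounded_cochains \<Gamma> p n"
  then obtain B where c: "c \<in> cochains \<Gamma> p n" and B: "\<forall>xs\<in>tuples \<Gamma> (n + 1). lp_norm \<Gamma> p (c xs) \<le> B"
    by (auto simp: bounded_cochains_def)
  have "p_sum_le (carrier \<Gamma>) p (c xs) (max 0 B powr p)" if "xs \<in> tuples \<Gamma> (n + 1)" for xs
    by (rule lp_norm_le_iff_sums(2)[OF p]) (use that c B in \<open>auto simp: cochains_def\<close>)
  then show "c \<in> cochains \<Gamma> p n \<and> (\<exists>C. \<forall>xs\<in>tuples \<Gamma> (n + 1). p_sum_le (carrier \<Gamma>) p (c xs) C)"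
    using c by blast
next
  assume "c \<in> cochains \<Gamma> p n \<and> (\<exists>C. \<forall>xs\<in>tuples \<Gamma> (n + 1). p_sum_le (carrier \<Gamma>) p (c xs) C)"
  then obtain C where c: "c \<in> cochains \<Gamma> p n"
    and C: "\<forall>xs\<in>tuples \<Gamma> (n + 1). p_sum_le (carrier \<Gamma>) p (c xs) C" by blast
  have "lp_norm \<Gamma> p (c xs) \<le> C powr (1 / p)" if "xs \<in> tuples \<Gamma> (n + 1)" for xs
    by (rule lp_norm_le_iff_sums(1)[OF p]) (use that c C in \<open>auto simp: cochains_def\<close>)
  then show "c \<in> bounded_cochains \<Gamma> p n" using c unfolding bounded_cochains_def by blast
qed

lemma p_sum_le_comb:
  assumes "0 < p" "p_sum_le A p f C" "p_sum_le A p g D"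
  shows "p_sum_le A p (\<lambda>h. r * f h + t * g h) (2 powr p * (\<bar>r\<bar> powr p * C + \<bar>t\<bar> powr p * D))"
  by (intro p_sum_le_add p_sum_le_cmult assms)

lemma linear_family_cochains:
  assumes p: "0 < p"
  shows "linear_family (cochains \<Gamma> p n)"
  unfolding linear_family_def
proof (intro conjI ballI allI)
  have "p_sum_le (carrier \<Gamma>) p (\<lambda>_. 0) 0" by (simp add: p_sum_le_def)
  then have "(\<lambda>_. 0) \<in> lp_space \<Gamma> p" unfolding lp_space_iff[OF p] by blast
  then show "(\<lambda>_ _. 0) \<in> cochains \<Gamma> p n" by (auto simp: cochains_def lp_action_def)
next
  fix a b r t assume a: "a \<in> cochains \<Gamma> p n" and b: "b \<in> cochains \<Gamma> p n"
  have "(\<lambda>h. r * a xs h + t * b xs h) \<in> lp_space \<Gamma> p" if xs: "xs \<in> tuples \<Gamma> (n + 1)" for xs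
  proof -
    have m: "a xs \<in> lp_space \<Gamma> p" "b xs \<in> lp_space \<Gamma> p" using a b xs by (auto simp: cochains_def)
    then obtain C D where "p_sum_le (carrier \<Gamma>) p (a xs) C" "p_sum_le (carrier \<Gamma>) p (b xs) D"
      unfolding lp_space_iff[OF p] by blast
    from p_sum_le_comb[OF p this] show ?thesis using m unfolding lp_space_iff[OF p] by auto
  qed
  then show "(\<lambda>xs h. r * a xs h + t * b xs h) \<in> cochains \<Gamma> p n"
    using a b by (auto simp: cochains_def lp_action_def)
qed

lemma linear_family_bounded_cochains:
  assumes p: "0 < p"
  shows "linear_family (bounded_cochains \<Gamma> p n)"
  unfolding linear_family_def
proof (intro conjI ballI allI)
  have "p_sum_le (carrier \<Gamma>) p (\<lambda>_. 0) 0" by (simp add: p_sum_le_def)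
  then show "(\<lambda>_ _. 0) \<in> bounded_cochains \<Gamma> p n"
    unfolding bounded_cochains_iff[OF p] using linear_family_zero[OF linear_family_cochains[OF p]] by blast
next
  fix a b r t assume a: "a \<in> bounded_cochains \<Gamma> p n" and b: "b \<in> bounded_cochains \<Gamma> p n"
  obtain C D where "\<forall>xs\<in>tuples \<Gamma> (n + 1). p_sum_le (carrier \<Gamma>) p (a xs) C"
    "\<forall>xs\<in>tuples \<Gamma> (n + 1). p_sum_le (carrier \<Gamma>) p (b xs) D"
    using a b unfolding bounded_cochains_iff[OF p] by blast
  then have "\<forall>xs\<in>tuples \<Gamma> (n + 1). p_sum_le (carrier \<Gamma>) p (\<lambda>h. r * a xs h + t * b xs h)
      (2 powr p * (\<bar>r\<bar> powr p * C + \<bar>t\<bar> powr p * D))"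
    using p_sum_le_comb[OF p] by blast
  moreover have "(\<lambda>xs h. r * a xs h + t * b xs h) \<in> cochains \<Gamma> p n"
    using a b linear_family_cochains[OF p, of \<Gamma> n] unfolding bounded_cochains_iff[OF p] linear_family_def by blast
  ultimately show "(\<lambda>xs h. r * a xs h + t * b xs h) \<in> bounded_cochains \<Gamma> p n"
    unfolding bounded_cochains_iff[OF p] by blast
qed

lemma coboundary_comb:
  "coboundary \<Gamma> n (\<lambda>xs h. r * a xs h + t * b xs h) =
    (\<lambda>xs h. r * coboundary \<Gamma> n a xs h + t * coboundary \<Gamma> n b xs h)"
  by (intro ext) (simp add: coboundary_def sum.distrib sum_distrib_left algebra_simps)

lemma linear_family_coboundary_image:
  assumes "linear_family V"
  shows "linear_family (coboundary \<Gamma> n ` V)"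
  unfolding linear_family_def
proof (intro conjI ballI allI)
  have "coboundary \<Gamma> n (\<lambda>_ _. 0) = (\<lambda>_ _. 0)" by (intro ext) (simp add: coboundary_def)
  then show "(\<lambda>_ _. 0) \<in> coboundary \<Gamma> n ` V"
    using linear_family_zero[OF assms] by (metis imageI)
next
  fix a b r t assume "a \<in> coboundary \<Gamma> n ` V" "b \<in> coboundary \<Gamma> n ` V"
  then obtain a' b' where ab: "a' \<in> V" "b' \<in> V" "a = coboundary \<Gamma> n a'" "b = coboundary \<Gamma> n b'" by blast
  have "(\<lambda>xs h. r * a' xs h + t * b' xs h) \<in> V"
    using assms ab by (simp add: linear_family_def)
  from imageI[OF this, of "coboundary \<Gamma> n"]
  show "(\<lambda>xs h. r * a xs h + t * b xs h) \<in> coboundary \<Gamma> n ` V"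
    by (simp add: coboundary_comb ab)
qed

lemma linear_family_cocycles:
  assumes "linear_family (C n)"
  shows "linear_family (cocycles \<Gamma> C n)"
proof -
  have "coboundary \<Gamma> n (\<lambda>_ _. 0) = (\<lambda>_ _. 0)" by (intro ext) (simp add: coboundary_def)
  then show ?thesis
    using assms by (auto simp: linear_family_def cocycles_def coboundary_comb)
qed

lemma coboundaries_2: "coboundaries \<Gamma> C 2 = coboundary \<Gamma> 1 ` C 1"
  by (simp add: coboundaries_def numeral_2_eq_2)

section \<open>Cochains in low degree\<close>

context group
begin

lemma tuples_2: "xs \<in> tuples G 2 \<longleftrightarrow> (\<exists>x\<in>carrier G. \<exists>y\<in>carrier G. xs = [x, y])"
  by (auto simp: tuples_def numeral_2_eq_2 length_Suc_conv)

lemma tuples_3: "xs \<in> tuples G 3 \<longleftrightarrow> (\<exists>x\<in>carrier G. \<exists>y\<in>carrier G. \<exists>z\<in>carrier G. xs = [x, y, z])"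
  by (auto simp: tuples_def numeral_3_eq_3 length_Suc_conv)

lemma coboundary_1:
  assumes "x \<in> carrier G" "y \<in> carrier G" "z \<in> carrier G"
  shows "coboundary G 1 c [x, y, z] h = c [y, z] h - c [x, z] h + c [x, y] h"
proof -
  have "[x, y, z] \<in> tuples G (1 + 2)" using assms by (simp add: tuples_def)
  moreover have "{..1 + 1} = {0, 1, 2::nat}" by auto
  ultimately show ?thesis unfolding coboundary_def by (simp add: numeral_2_eq_2)
qed

lemma coboundary_2_1: "coboundary G 2 (coboundary G 1 c) = (\<lambda>_ _. 0)"
proof (intro ext)
  fix xs h
  show "coboundary G 2 (coboundary G 1 c) xs h = 0"
  proof (cases "xs \<in> tuples G (2 + 2)")
    case True
    then have "length xs = Suc (Suc (Suc (Suc 0)))" "set xs \<subseteq> carrier G" by (simp_all add: tuples_def)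
    then obtain x y z w where xs: "xs = [x, y, z, w]" and
      c: "x \<in> carrier G" "y \<in> carrier G" "z \<in> carrier G" "w \<in> carrier G"
      by (auto simp: length_Suc_conv)
    have "{..2 + 1} = {0, 1, 2, 3::nat}" by auto
    then show ?thesis
      using True c unfolding coboundary_def[of G 2] xs
      by (simp add: numeral_2_eq_2 numeral_3_eq_3 coboundary_1[simplified])
  qed (simp add: coboundary_def)
qed

lemma cochain_1_shift:
  assumes c: "c \<in> cochains G p 1" and "x \<in> carrier G" "y \<in> carrier G" "h \<in> carrier G"
  shows "c [h \<otimes> x, h \<otimes> y] \<one> = c [x, y] h"
proof -
  have "[x, y] \<in> tuples G (1 + 1)" using assms by (simp add: tuples_def)
  then have "c (map (\<lambda>x. h \<otimes> x) [x, y]) = lp_action G h (c [x, y])"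
    using c assms(4) unfolding cochains_def by blast
  then show ?thesis using assms by (simp add: lp_action_def)
qed

lemma p_sum_le_coboundary_1:
  assumes p: "0 < p" and "p_sum_le A p (c [y, z]) C" "p_sum_le A p (c [x, z]) C" "p_sum_le A p (c [x, y]) C"
    and "x \<in> carrier G" "y \<in> carrier G" "z \<in> carrier G"
  shows "p_sum_le A p (coboundary G 1 c [x, y, z]) (2 powr p * (C + 2 powr p * (C + C)))"
proof -
  have "p_sum_le A p (\<lambda>h. c [y, z] h + (1 * c [x, y] h + (- 1) * c [x, z] h))
      (2 powr p * (C + 2 powr p * (\<bar>1\<bar> powr p * C + \<bar>- 1\<bar> powr p * C)))"
    by (intro p_sum_le_add p_sum_le_comb assms)
  moreover have "coboundary G 1 c [x, y, z] = (\<lambda>h. c [y, z] h + (1 * c [x, y] h + (- 1) * c [x, z] h))"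
    using assms(5-7) by (intro ext) (simp add: coboundary_1[simplified])
  ultimately show ?thesis by simp
qed

lemma coboundary_1_cochain:
  assumes p: "0 < p" and c: "c \<in> cochains G p 1"
  shows "coboundary G 1 c \<in> cochains G p 2"
  unfolding cochains_def
proof (intro CollectI conjI allI impI ballI)
  fix xs assume "xs \<notin> tuples G (2 + 1)"
  then show "coboundary G 1 c xs = (\<lambda>_. 0)" by (intro ext) (simp add: coboundary_def numeral_3_eq_3)
next
  fix xs assume "xs \<in> tuples G (2 + 1)"
  then obtain x y z where x: "x \<in> carrier G" "y \<in> carrier G" "z \<in> carrier G" and xs: "xs = [x, y, z]"
    using tuples_3[of xs] by auto
  have t: "[x, y] \<in> tuples G (1 + 1)" "[y, z] \<in> tuples G (1 + 1)" "[x, z] \<in> tuples G (1 + 1)"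
    using x by (simp_all add: tuples_def)
  have lp: "c [x, y] \<in> lp_space G p" "c [y, z] \<in> lp_space G p" "c [x, z] \<in> lp_space G p"
    using c t unfolding cochains_def by blast+
  then obtain C1 C2 C3 where "p_sum_le (carrier G) p (c [x, y]) C1" "p_sum_le (carrier G) p (c [y, z]) C2"
    "p_sum_le (carrier G) p (c [x, z]) C3" unfolding lp_space_iff[OF p] by blast
  then have C: "p_sum_le (carrier G) p (c [x, y]) (max C1 (max C2 C3))"
    "p_sum_le (carrier G) p (c [y, z]) (max C1 (max C2 C3))"
    "p_sum_le (carrier G) p (c [x, z]) (max C1 (max C2 C3))"
    by (auto elim: p_sum_le_mono)
  have supp: "\<forall>h. h \<notin> carrier G \<longrightarrow> coboundary G 1 c xs h = 0"
    using lp x unfolding lp_space_iff[OF p] xs by (simp add: coboundary_1[simplified])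
  show "coboundary G 1 c xs \<in> lp_space G p"
    unfolding lp_space_iff[OF p] using supp p_sum_le_coboundary_1[OF p C(2,3,1) x] xs by blast
  fix g assume g: "g \<in> carrier G"
  show "coboundary G 1 c (map (\<lambda>x. g \<otimes> x) xs) = lp_action G g (coboundary G 1 c xs)"
  proof (rule ext)
    fix h
    have e: "c (map (\<lambda>x. g \<otimes> x) ys) h = lp_action G g (c ys) h" if "ys \<in> tuples G (1 + 1)" for ys
      using c that g unfolding cochains_def by auto
    show "coboundary G 1 c (map (\<lambda>x. g \<otimes> x) xs) h = lp_action G g (coboundary G 1 c xs) h"
      using e[OF t(1)] e[OF t(2)] e[OF t(3)] x g unfolding xs
      by (simp add: coboundary_1[simplified] lp_action_def)
  qed
qed

text \<open>The inverse of evaluation at \<open>\<one>\<close>. Since the action on functions is by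
  right multiplication of the argument, the result is equivariant for every \<open>F\<close>, with
  no invariance required of it.\<close>

definition pair_cochain :: "('a \<Rightarrow> 'a \<Rightarrow> real) \<Rightarrow> 'a cochain" where
  "pair_cochain F xs h =
     (if xs \<in> tuples G 2 \<and> h \<in> carrier G then F (h \<otimes> xs ! 0) (h \<otimes> xs ! 1) else 0)"

lemma pair_cochain_apply:
  "x \<in> carrier G \<Longrightarrow> y \<in> carrier G \<Longrightarrow> h \<in> carrier G \<Longrightarrow> pair_cochain F [x, y] h = F (h \<otimes> x) (h \<otimes> y)"
  by (simp add: pair_cochain_def tuples_def)

lemma pair_cochain_in_cochains:
  assumes p: "0 < p"
    and F: "\<forall>x\<in>carrier G. \<forall>y\<in>carrier G. \<exists>C. p_sum_le (carrier G) p (\<lambda>h. F (h \<otimes> x) (h \<otimes> y)) C"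
  shows "pair_cochain F \<in> cochains G p 1"
  unfolding cochains_def
proof (intro CollectI conjI allI impI ballI)
  fix xs assume "xs \<notin> tuples G (1 + 1)"
  then show "pair_cochain F xs = (\<lambda>_. 0)" by (intro ext) (simp add: pair_cochain_def numeral_2_eq_2)
next
  fix xs assume "xs \<in> tuples G (1 + 1)"
  then obtain x y where x: "x \<in> carrier G" "y \<in> carrier G" and xs: "xs = [x, y]"
    using tuples_2[of xs] by (auto simp: numeral_2_eq_2)
  obtain C where "p_sum_le (carrier G) p (\<lambda>h. F (h \<otimes> x) (h \<otimes> y)) C" using F x by blast
  then have "p_sum_le (carrier G) p (pair_cochain F xs) C"
    by (rule p_sum_le_cong) (simp add: xs pair_cochain_apply x)
  then show "pair_cochain F xs \<in> lp_space G p"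
    unfolding lp_space_iff[OF p] by (auto simp: pair_cochain_def)
  fix g assume g: "g \<in> carrier G"
  show "pair_cochain F (map (\<lambda>x. g \<otimes> x) xs) = lp_action G g (pair_cochain F xs)"
  proof (rule ext)
    fix h
    show "pair_cochain F (map (\<lambda>x. g \<otimes> x) xs) h = lp_action G g (pair_cochain F xs) h"
      using x g unfolding xs by (cases "h \<in> carrier G")
        (simp_all add: pair_cochain_apply lp_action_def m_assoc, simp add: pair_cochain_def)
  qed
qed

end

section \<open>An independent family in the kernel\<close>

context hyperbolic_action
begin

text \<open>Passing to inverses turns each coincidence into a common repelling point. By
  \<open>common_repelling_point\<close> some group element then carries one ordered pair to the
  other, or to its reverse, against \<open>orb\<close>.\<close>

lemma fixed_points_disjoint:
  fixes a b :: "nat \<Rightarrow> 'x"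
  assumes inf: "infinite (UNIV :: 'x set)"
    and \<gamma>: "\<forall>i. \<gamma> i \<in> carrier \<Gamma> \<and> north_south (\<phi> (\<gamma> i)) (a i) (b i)"
    and orb: "\<forall>k\<in>carrier \<Gamma>. \<forall>i j. i \<noteq> j \<longrightarrow>
        (\<phi> k (a i), \<phi> k (b i)) \<noteq> (a j, b j) \<and> (\<phi> k (a i), \<phi> k (b i)) \<noteq> (b j, a j)"
    and ij: "i \<noteq> j"
  shows "a i \<noteq> a j" "a i \<noteq> b j" "b i \<noteq> b j"
proof -
  have g: "\<gamma> i \<in> carrier \<Gamma>" "north_south (\<phi> (\<gamma> i)) (a i) (b i)" for i using \<gamma> by auto
  have g': "inv (\<gamma> i) \<in> carrier \<Gamma>" "north_south (\<phi> (inv (\<gamma> i))) (b i) (a i)" for i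
    using g north_south_inv by auto
  obtain w where w: "w \<notin> {a i, b i}" using ex_new_if_finite[OF inf, of "{a i, b i}"] by auto
  show "b i \<noteq> b j"
  proof
    assume e: "b i = b j"
    obtain k where "k \<in> carrier \<Gamma>" "\<phi> k (a j) = a i" "\<phi> k (b i) = b i"
      using common_repelling_point[OF g[of i] _ _ w, of "\<gamma> j" "a j"] g[of j] e by auto
    then show False using orb ij e by metis
  qed
  show "a i \<noteq> a j"
  proof
    assume e: "a i = a j"
    have w': "w \<notin> {b i, a i}" using w by auto
    obtain k where "k \<in> carrier \<Gamma>" "\<phi> k (b j) = b i" "\<phi> k (a i) = a i"
      using common_repelling_point[OF g'[of i] _ _ w', of "inv (\<gamma> j)" "b j"] g'[of j] e by auto
    then show False using orb ij e by metis
  qed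
  show "a i \<noteq> b j"
  proof
    assume e: "a i = b j"
    have w': "w \<notin> {b i, a i}" using w by auto
    obtain k where "k \<in> carrier \<Gamma>" "\<phi> k (a j) = b i" "\<phi> k (a i) = a i"
      using common_repelling_point[OF g'[of i] _ _ w', of "\<gamma> j" "a j"] g[of j] e by auto
    then show False using orb ij e by metis
  qed
qed

lemma comparison_kernel_infinite_dim:
  fixes a b :: "nat \<Rightarrow> 'x"
  assumes inf: "infinite (UNIV :: 'x set)" and count: "countable (carrier \<Gamma>)" and p: "0 < p"
    and \<gamma>: "\<forall>i. \<gamma> i \<in> carrier \<Gamma> \<and> north_south (\<phi> (\<gamma> i)) (a i) (b i)"
    and orb: "\<forall>k\<in>carrier \<Gamma>. \<forall>i j. i \<noteq> j \<longrightarrow>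
        (\<phi> k (a i), \<phi> k (b i)) \<noteq> (a j, b j) \<and> (\<phi> k (a i), \<phi> k (b i)) \<noteq> (b j, a j)"
  shows "\<not> vectorspace.fin_dim class_ring (comparison_kernel \<Gamma> p 2)"
proof -
  note dist = fixed_points_disjoint[OF inf \<gamma> orb]
  have s: "\<gamma> 0 \<in> carrier \<Gamma>" "north_south (\<phi> (\<gamma> 0)) (a 0) (b 0)" using \<gamma> by auto
  \<comment> \<open>The cut-off of index \<open>i\<close> vanishes at the fixed points of all
    \<open>\<gamma> l\<close> with \<open>l < i\<close>, among them \<open>\<gamma> 0\<close>, which
    acts as \<open>s\<close>. Only points enter, not earlier radii, so all radii can be chosen
    independently.\<close>
  define good where "good i r \<longleftrightarrow> 0 < r \<and> (\<forall>x\<in>carrier \<Gamma>. \<forall>y\<in>carrier \<Gamma>. \<exists>C.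
        p_sum_le (carrier \<Gamma>) p (\<lambda>h. chi (a i) (b i) r (\<phi> (h \<otimes> x) (a 0)) (\<phi> (h \<otimes> y) (a 0))) C) \<and>
     (\<exists>C. \<forall>x y z. p_sum_le (carrier \<Gamma>) p (\<lambda>h. Phi (a i) (b i) r (\<phi> h x) (\<phi> h y) (\<phi> h z)) C) \<and>
     (\<forall>q\<in>a ` {..<i} \<union> b ` {..<i}. bump (a i) r q = 0 \<and> bump (b i) r q = 0)" for i r
  have "\<exists>r. good (Suc i) r" for i
  proof -
    have ab: "a (Suc i) \<noteq> b (Suc i)" using \<gamma> by (auto simp: north_south_def)
    obtain w where w: "w \<notin> {a (Suc i), b (Suc i)}"
      using ex_new_if_finite[OF inf, of "{a (Suc i), b (Suc i)}"] by auto
    have Q: "finite (a ` {..<Suc i} \<union> b ` {..<Suc i})"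
      "a (Suc i) \<notin> a ` {..<Suc i} \<union> b ` {..<Suc i}" "b (Suc i) \<notin> a ` {..<Suc i} \<union> b ` {..<Suc i}"
      using dist by (auto simp: image_iff) (metis less_irrefl)+
    show ?thesis
      unfolding good_def by (rule localized_chi[OF s ab w p Q]) (use orb in auto)
  qed
  then have "\<forall>i. \<exists>r. good (Suc i) r" by blast
  from choice[OF this] obtain \<rho> where \<rho>: "\<forall>i. good (Suc i) (\<rho> i)" by (elim exE) (rule that)
  define \<kappa> where "\<kappa> i = chi (a (Suc i)) (b (Suc i)) (\<rho> i)" for i
  define c where "c i = pair_cochain (\<lambda>x y. \<kappa> i (\<phi> x (a 0)) (\<phi> y (a 0)))" for i
  have c1: "c i \<in> cochains \<Gamma> p 1" for i
    unfolding c_def using \<rho> by (intro pair_cochain_in_cochains p) (simp add: good_def \<kappa>_def)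
  have cP: "coboundary \<Gamma> 1 (c i) [x, y, z] h =
      Phi (a (Suc i)) (b (Suc i)) (\<rho> i) (\<phi> h (\<phi> x (a 0))) (\<phi> h (\<phi> y (a 0))) (\<phi> h (\<phi> z (a 0)))"
    if "x \<in> carrier \<Gamma>" "y \<in> carrier \<Gamma>" "z \<in> carrier \<Gamma>" "h \<in> carrier \<Gamma>" for i x y z h
    unfolding coboundary_1[OF that(1-3)] c_def Phi_def
    using that chi_swap[of "a (Suc i)" "b (Suc i)" "\<rho> i" "\<phi> h (\<phi> x (a 0))" "\<phi> h (\<phi> z (a 0))"]
    by (simp add: pair_cochain_apply act_mult \<kappa>_def)
  define W B A where "W = coboundaries \<Gamma> (bounded_cochains \<Gamma> p) 2" and "B = coboundaries \<Gamma> (cochains \<Gamma> p) 2"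
    and "A = cocycles \<Gamma> (bounded_cochains \<Gamma> p) 2 \<inter> coboundaries \<Gamma> (cochains \<Gamma> p) 2"
  have linW: "linear_family W" and linB: "linear_family B"
    unfolding W_def B_def coboundaries_2
    by (intro linear_family_coboundary_image linear_family_bounded_cochains linear_family_cochains p)+
  have linA: "linear_family A"
    unfolding A_def
    by (intro linear_family_Int linear_family_cocycles linear_family_bounded_cochains p linB[unfolded B_def])
  have sub: "W \<subseteq> B" unfolding W_def B_def coboundaries_2 by (auto simp: bounded_cochains_def)
  have eq: "comparison_kernel \<Gamma> p 2 = quotient_module (cochain_module A) W"
    using comparison_kernel_eq[OF linW[unfolded W_def] linB[unfolded B_def] sub[unfolded W_def B_def]]
    by (simp add: A_def W_def)
  define z where "z i = coboundary \<Gamma> 1 (c i)" for i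
  have zA: "z i \<in> A" for i
  proof -
    obtain C where C: "\<forall>x y z. p_sum_le (carrier \<Gamma>) p
        (\<lambda>h. Phi (a (Suc i)) (b (Suc i)) (\<rho> i) (\<phi> h x) (\<phi> h y) (\<phi> h z)) C"
      using \<rho> unfolding good_def by blast
    have "p_sum_le (carrier \<Gamma>) p (z i xs) C" if xs: "xs \<in> tuples \<Gamma> (2 + 1)" for xs
    proof -
      obtain x y t where x: "x \<in> carrier \<Gamma>" "y \<in> carrier \<Gamma>" "t \<in> carrier \<Gamma>" and e: "xs = [x, y, t]"
        using xs tuples_3[of xs] by auto
      show ?thesis
        by (rule p_sum_le_cong[OF C[rule_format]]) (simp only: z_def e cP x)
    qed
    then have "z i \<in> bounded_cochains \<Gamma> p 2"
      unfolding bounded_cochains_iff[OF p] using coboundary_1_cochain[OF p c1] unfolding z_def by blast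
    then show ?thesis
      using c1 unfolding A_def coboundaries_2 cocycles_def z_def by (simp add: coboundary_2_1[simplified])
  qed
  have "(\<lambda>xs h. \<Sum>i\<in>I. r i * z i xs h) \<notin> W"
    if I: "finite I" "I \<noteq> {}" and r: "\<forall>i\<in>I. r i \<noteq> 0" for I r
  proof
    assume "(\<lambda>xs h. \<Sum>i\<in>I. r i * z i xs h) \<in> W"
    then obtain \<beta> where \<beta>: "\<beta> \<in> bounded_cochains \<Gamma> p 1"
      and \<beta>z: "(\<lambda>xs h. \<Sum>i\<in>I. r i * z i xs h) = coboundary \<Gamma> 1 \<beta>"
      unfolding W_def coboundaries_2 by blast
    obtain C where \<beta>1: "\<beta> \<in> cochains \<Gamma> p 1" and C: "\<forall>xs\<in>tuples \<Gamma> (1 + 1). p_sum_le (carrier \<Gamma>) p (\<beta> xs) C"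
      using \<beta> unfolding bounded_cochains_iff[OF p] by blast
    define F where "F = (\<lambda>xs h. \<Sum>i\<in>I. r i * c i xs h)"
    \<comment> \<open>\<open>F\<close> and \<open>\<beta>\<close> have the same coboundary, so
      \<open>\<psi>\<close> is a cocycle; it has finite norm on each pair but need not be
      bounded.\<close>
    define \<psi> where "\<psi> = (\<lambda>xs h. F xs h - \<beta> xs h)"
    have F1: "F \<in> cochains \<Gamma> p 1"
      unfolding F_def by (rule linear_family_sum[OF linear_family_cochains[OF p] I(1)]) (use c1 in blast)
    have \<psi>1: "\<psi> \<in> cochains \<Gamma> p 1"
      by (rule linear_family_comb[OF linear_family_cochains[OF p] F1 \<beta>1, where r = 1 and t = "- 1"])
        (simp add: \<psi>_def)
    define X where "X x y = (\<Sum>i\<in>I. r i * \<kappa> i x y)" for x y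
    \<comment> \<open>The other indices in \<open>I\<close> are larger, so their cut-offs vanish at
      the fixed points of \<open>\<gamma> (Suc j)\<close>, and rigidity with this \<open>g\<close>
      isolates the coefficient \<open>r j\<close>.\<close>
    define j where "j = Min I"
    have j: "j \<in> I" "\<And>i. i \<in> I \<Longrightarrow> i \<noteq> j \<Longrightarrow> j < i"
      using I by (auto simp: j_def le_neq_implies_less)
    have \<rho>0: "0 < \<rho> i" for i using \<rho> by (simp add: good_def)
    have bz: "bump (a (Suc i)) (\<rho> i) q = 0" "bump (b (Suc i)) (\<rho> i) q = 0"
      if "q \<in> a ` {..<Suc i} \<union> b ` {..<Suc i}" for i q
      using \<rho> that unfolding good_def by blast+
    have "X (b (Suc j)) (a 0) + X (b 0) (a (Suc j)) = X (b (Suc j)) (a (Suc j))"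
    proof (rule cocycle_rigidity[OF count p s, where g = "\<gamma> (Suc j)" and B = C
          and \<beta> = "\<lambda>x y. \<beta> [x, y] \<one>" and \<psi> = "\<lambda>x y. \<psi> [x, y] \<one>"])
      show "\<gamma> (Suc j) \<in> carrier \<Gamma>" "north_south (\<phi> (\<gamma> (Suc j))) (a (Suc j)) (b (Suc j))" using \<gamma> by auto
      show "a (Suc j) \<noteq> a 0" "a (Suc j) \<noteq> b 0" "b (Suc j) \<noteq> a 0" "b (Suc j) \<noteq> b 0"
        using dist[of "Suc j" 0] dist[of 0 "Suc j"] by auto
      show "X x x = 0" for x by (simp add: X_def \<kappa>_def)
      show "(\<lambda>n. X (f n) (g n)) \<longlonglongrightarrow> X l k" if "f \<longlonglongrightarrow> l" "g \<longlonglongrightarrow> k" for f g l k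
        unfolding X_def \<kappa>_def using that \<rho>0 by (intro tendsto_intros chi_tendsto)
      fix x y assume x: "x \<in> carrier \<Gamma>" "y \<in> carrier \<Gamma>"
      show "X (\<phi> x (a 0)) (\<phi> y (a 0)) = \<beta> [x, y] \<one> + \<psi> [x, y] \<one>"
        using x by (simp add: \<psi>_def F_def X_def c_def pair_cochain_apply)
      have "p_sum_le (carrier \<Gamma>) p (\<beta> [x, y]) C" using C x by (simp add: tuples_def)
      then show "p_sum_le (carrier \<Gamma>) p (\<lambda>h. \<beta> [h \<otimes> x, h \<otimes> y] \<one>) C"
        by (rule p_sum_le_cong) (simp add: cochain_1_shift[OF \<beta>1] x)
      have "[x, y] \<in> tuples \<Gamma> (1 + 1)" using x by (simp add: tuples_def)
      then have "\<psi> [x, y] \<in> lp_space \<Gamma> p" using \<psi>1 unfolding cochains_def by blast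
      then obtain D where "p_sum_le (carrier \<Gamma>) p (\<psi> [x, y]) D" unfolding lp_space_iff[OF p] by blast
      then have "p_sum_le (carrier \<Gamma>) p (\<lambda>h. \<psi> [h \<otimes> x, h \<otimes> y] \<one>) D"
        by (rule p_sum_le_cong) (simp add: cochain_1_shift[OF \<psi>1] x)
      then show "\<exists>D. p_sum_le (carrier \<Gamma>) p (\<lambda>h. \<psi> [h \<otimes> x, h \<otimes> y] \<one>) D" ..
      fix t assume t: "t \<in> carrier \<Gamma>"
      have "(\<Sum>i\<in>I. r i * z i [x, y, t] \<one>) = coboundary \<Gamma> 1 \<beta> [x, y, t] \<one>"
        using fun_cong[OF fun_cong[OF \<beta>z, of "[x, y, t]"], of \<one>] .
      then have "F [y, t] \<one> - F [x, t] \<one> + F [x, y] \<one> = \<beta> [y, t] \<one> - \<beta> [x, t] \<one> + \<beta> [x, y] \<one>"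
        unfolding z_def coboundary_1[OF x t] F_def
        by (simp add: algebra_simps sum.distrib sum_subtractf)
      then show "\<psi> [x, y] \<one> + \<psi> [y, t] \<one> = \<psi> [x, t] \<one>"
        by (simp add: \<psi>_def)
    qed
    moreover have "X (b (Suc j)) (a 0) = 0" "X (b 0) (a (Suc j)) = 0"
      by (simp_all add: X_def \<kappa>_def chi_def bz)
    moreover have "X (b (Suc j)) (a (Suc j)) = r j * \<kappa> j (b (Suc j)) (a (Suc j))"
    proof -
      have "r i * \<kappa> i (b (Suc j)) (a (Suc j)) = 0" if "i \<in> I - {j}" for i
        using j(2)[of i] that by (simp add: \<kappa>_def chi_def bz)
      then have "(\<Sum>i\<in>I - {j}. r i * \<kappa> i (b (Suc j)) (a (Suc j))) = 0" by (rule sum.neutral[OF ballI])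
      then show ?thesis using I(1) j(1) by (simp add: X_def sum.remove[of I j])
    qed
    moreover have "\<kappa> j (b (Suc j)) (a (Suc j)) \<noteq> 0"
    proof -
      have ab: "a (Suc j) \<noteq> b (Suc j)" using \<gamma> by (auto simp: north_south_def)
      \<comment> \<open>By symmetry of the distance both cross bumps equal \<open>t\<close>, while
        both bumps at their centres are 1. So the value is \<open>t * t - 1\<close>, and
        \<open>t < 1\<close> because the two fixed points differ.\<close>
      define t where "t = bump (a (Suc j)) (\<rho> j) (b (Suc j))"
      have t: "0 \<le> t" "t < 1" "bump (b (Suc j)) (\<rho> j) (a (Suc j)) = t"
        using \<rho>0[of j] ab by (auto simp: t_def bump_def dist_commute)
      then have "t * t < 1" by (meson mult_left_le less_eq_real_def order_le_less_trans)
      then show ?thesis using t by (simp add: \<kappa>_def chi_def t_def[symmetric])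
    qed
    ultimately show False using r j(1) by simp
  qed
  then show ?thesis
    unfolding eq using zA by (intro quotient_infinite_dim[OF linA linW, of z]) blast+
qed

end

theorem theorem3p3:
  fixes \<Gamma> :: "('g, 'm) monoid_scheme"
    and \<phi> :: "'g \<Rightarrow> 'x::metric_space \<Rightarrow> 'x"
    and G S :: "'g set"
  assumes "bounded (UNIV :: 'x set)"
    and "\<forall>x::'x. x islimpt UNIV"
    and "group \<Gamma>"
    and "countable (carrier \<Gamma>)"
    and "group_action \<Gamma> UNIV \<phi>"
    and "\<forall>g\<in>carrier \<Gamma>. homeomorphism UNIV UNIV (\<phi> g) (\<phi> (inv\<^bsub>\<Gamma>\<^esub> g))"
    and "weakly_hyperbolic \<Gamma> \<phi>"
    and "subgroup G \<Gamma>"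
    and "free_basis \<Gamma> S G"
    and "card S = 2"
    and "\<forall>g\<in>G - {\<one>\<^bsub>\<Gamma>\<^esub>}. \<exists>a b. north_south (\<phi> g) a b"
    and "\<exists>\<gamma>::nat \<Rightarrow> 'g. (\<forall>i. \<gamma> i \<in> G - {\<one>\<^bsub>\<Gamma>\<^esub>}) \<and>
           disjoint_family (\<lambda>(i, inverted).
             orbit \<Gamma> (\<lambda>h. map_prod (\<phi> h) (\<phi> h))
               (fixed_pair (\<phi> (if inverted then inv\<^bsub>\<Gamma>\<^esub> (\<gamma> i) else \<gamma> i))))"
    and "\<exists>f. embedding_map (boundary_topology \<Gamma> S) euclidean f \<and>
           (\<forall>g\<in>G. \<forall>\<xi>\<in>gromov_boundary \<Gamma> S. f (boundary_action \<Gamma> g \<xi>) = \<phi> g (f \<xi>))"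
    and "metrically_proper \<Gamma> \<phi>"
  shows "\<forall>p>1. \<not> vectorspace.fin_dim class_ring (comparison_kernel \<Gamma> p 2)"
proof (intro allI impI)
  fix p :: real assume p: "1 < p"
  interpret act: group_action \<Gamma> UNIV \<phi> by fact
  interpret hyperbolic_action \<Gamma> \<phi>
  proof (intro hyperbolic_action.intro hyperbolic_action_axioms.intro)
    show "group \<Gamma>" "bounded (UNIV :: 'x set)" "weakly_hyperbolic \<Gamma> \<phi>" "metrically_proper \<Gamma> \<phi>" by fact+
    show "\<phi> \<one>\<^bsub>\<Gamma>\<^esub> x = x" for x using act.id_eq_one by (metis UNIV_I restrict_apply')
    show "\<phi> (g \<otimes>\<^bsub>\<Gamma>\<^esub> h) x = \<phi> g (\<phi> h x)" if "g \<in> carrier \<Gamma>" "h \<in> carrier \<Gamma>" for g h x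
      by (rule act.composition_rule) (use that in auto)
    show "continuous_on UNIV (\<phi> g)" if "g \<in> carrier \<Gamma>" for g
      using assms(6) that homeomorphism_cont1 by blast
  qed
  \<comment> \<open>Infinitude supplies a point outside any fixed pair; such a point makes
    \<open>fixed_pair\<close> well defined and is the \<open>w\<close> of the counting
    arguments.\<close>
  have inf: "infinite (UNIV :: 'x set)" using assms(2) islimpt_finite by blast
  obtain \<gamma> where \<gamma>: "\<forall>i::nat. \<gamma> i \<in> G - {\<one>\<^bsub>\<Gamma>\<^esub>}" and disj: "disjoint_family (\<lambda>(i, inverted).
             orbit \<Gamma> (\<lambda>h. map_prod (\<phi> h) (\<phi> h))
               (fixed_pair (\<phi> (if inverted then inv\<^bsub>\<Gamma>\<^esub> (\<gamma> i) else \<gamma> i))))"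
    using assms(12) by (elim exE conjE) (rule that)
  have \<gamma>c: "\<gamma> i \<in> carrier \<Gamma>" for i using \<gamma> subgroup.subset[OF assms(8)] by blast
  have "\<forall>i. \<exists>q. north_south (\<phi> (\<gamma> i)) (fst q) (snd q)" using assms(11) \<gamma> by auto
  from choice[OF this] obtain q where q: "\<forall>i. north_south (\<phi> (\<gamma> i)) (fst (q i)) (snd (q i))"
    by (elim exE) (rule that)
  define a b where "a i = fst (q i)" and "b i = snd (q i)" for i
  have ns: "north_south (\<phi> (\<gamma> i)) (a i) (b i)" for i using q by (simp add: a_def b_def)
  \<comment> \<open>The inverse has the reversed pair, so disjointness of the orbits excludes both
    orders at once.\<close>
  define P where "P i inverted = (if inverted then (b i, a i) else (a i, b i))" for i and inverted :: bool
  have P: "fixed_pair (\<phi> (if inverted then inv\<^bsub>\<Gamma>\<^esub> (\<gamma> i) else \<gamma> i)) = P i inverted" for i inverted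
  proof -
    obtain w where w: "w \<notin> {a i, b i}" using ex_new_if_finite[OF inf, of "{a i, b i}"] by auto
    then show ?thesis
      using fixed_pair_eq[OF ns w] fixed_pair_eq[OF north_south_inv[OF \<gamma>c ns], of w i] by (simp add: P_def)
  qed
  have orb: "map_prod (\<phi> k) (\<phi> k) (P i e) \<noteq> P j e'"
    if "k \<in> carrier \<Gamma>" "i \<noteq> j" for k i j e e'
  proof
    assume eq: "map_prod (\<phi> k) (\<phi> k) (P i e) = P j e'"
    have "orbit \<Gamma> (\<lambda>h. map_prod (\<phi> h) (\<phi> h)) (P i e) \<inter> orbit \<Gamma> (\<lambda>h. map_prod (\<phi> h) (\<phi> h)) (P j e') = {}"
      using disj that(2) unfolding disjoint_family_on_def P
      by (auto dest!: bspec[of _ _ "(i, e)"] bspec[of _ _ "(j, e')"])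
    moreover have "P j e' \<in> orbit \<Gamma> (\<lambda>h. map_prod (\<phi> h) (\<phi> h)) (P i e)"
      unfolding orbit_def using eq that(1) by force
    moreover have "map_prod (\<phi> \<one>\<^bsub>\<Gamma>\<^esub>) (\<phi> \<one>\<^bsub>\<Gamma>\<^esub>) (P j e') = P j e'"
      by (cases "P j e'") (simp add: act_one)
    then have "P j e' \<in> orbit \<Gamma> (\<lambda>h. map_prod (\<phi> h) (\<phi> h)) (P j e')"
      unfolding orbit_def using one_closed by force
    ultimately show False by blast
  qed
  show "\<not> vectorspace.fin_dim class_ring (comparison_kernel \<Gamma> p 2)"
  proof (rule comparison_kernel_infinite_dim[OF inf assms(4)])
    show "0 < p" using p by simp
    show "\<forall>i. \<gamma> i \<in> carrier \<Gamma> \<and> north_south (\<phi> (\<gamma> i)) (a i) (b i)" using \<gamma>c ns by blast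
    show "\<forall>k\<in>carrier \<Gamma>. \<forall>i j. i \<noteq> j \<longrightarrow>
        (\<phi> k (a i), \<phi> k (b i)) \<noteq> (a j, b j) \<and> (\<phi> k (a i), \<phi> k (b i)) \<noteq> (b j, a j)"
    proof (intro ballI allI impI)
      fix k i j assume "k \<in> carrier \<Gamma>" "i \<noteq> (j :: nat)"
      from orb[OF this, of False False] orb[OF this, of False True]
      show "(\<phi> k (a i), \<phi> k (b i)) \<noteq> (a j, b j) \<and> (\<phi> k (a i), \<phi> k (b i)) \<noteq> (b j, a j)"
        by (simp add: P_def)
    qed
  qed
qed

end
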